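(* Let $S\in\mathcal H_0^+$, let $b$ be a natural drift of $S$ with flow $\psi$, and let $L\subset\tilde D^\circ$ be a limit cycle of $b$, i.e. $$\exists x\in L\ \ \exists T>0\colon\quad b(x)\ne0,\quad L=\psi(x,[0,T)),\quad\psi(x,T)=x.$$ (i) If $A_1\subset\tilde D\setminus L$ and $A_2\subset L$, then the minimization problem $P(A_1,A_2)$ does not have any solutions (neither weak nor strong minimizers). (ii) Points $x\in L$ do not have local minimizers (neither weak nor strong).
   Context: $D\subseteq\mathbb R^n$ is open and connected; $\tilde D\subseteq D$ is connected and closed in $D$; $\tilde D^\circ$ is its interior in $\mathbb R^n$; $\bar B_r(x)$ is the closed Euclidean ball. Curves. An unparameterized oriented curve in $D$ is an equivalence class of functions $\varphi\in C([0,T],D)$, $T>0$, that are identical up to continuous non-decreasing changes of parameterization (their Fréchet distance vanishes); the representatives are its parameterizations. $\gamma\subset G$ means that the image of $\gamma$ lies in $G$. $\Gamma$ is the set of rectifiable curves. $\tilde C(0,1)$ is the set of $\varphi\in C([0,1],D)$ that are absolutely continuous in neighborhoods of all but at most finitely many $\alpha_i\in[0,1]$, and $\tilde\Gamma\supset\Gamma$ is the set of curves that can be parameterized by some $\varphi\in\tilde C(0,1)$. For $x\in D$, $\tilde\Gamma(x)\subset\tilde\Gamma$ is the set of curves that can be parameterized by some $\varphi\in C([0,1],D)$ which is either absolutely continuous on $[0,1]$, or satisfies $\varphi(\frac12)=x$ and is absolutely continuous on $[0,\frac12-a]$ and on $[\frac12+a,1]$ for all $a\in(0,\frac12)$. For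 $A_1,A_2\subset\tilde D$, $\Gamma_{A_1}^{A_2}$ (resp. $\tilde\Gamma_{A_1}^{A_2}$) is the set of $\gamma\in\Gamma$ (resp. $\tilde\Gamma$) with $\gamma\subset\tilde D$ that start in $A_1$ and end in $A_2$; $\Gamma_{x_1}^{x_2}$ and $\tilde\Gamma_{x_1}^{x_2}(x)$ are defined analogously. For Borel $E$ and $\gamma\in\tilde\Gamma$ with parameterization $\varphi\in\tilde C(0,1)$, $\operatorname{length}(\gamma|_E):=\int_0^1|\varphi'|\mathbf 1_{\varphi\in E}\,d\alpha$. Standing assumption on $\tilde D$: $\forall x\in\tilde D\ \forall\nu>0\ \exists r>0\ \forall w\in\bar B_r(x)\cap\tilde D\ \exists\gamma\in\Gamma_x^w$ with $\operatorname{length}(\gamma)\le\nu$. The class $\mathcal H_0^+$. Consider Hamiltonians $H\in C(D\times\mathbb R^n,\mathbb R)$, $H=H(x,\theta)$, with the properties: (H1) $H(x,0)\le0$ for all $x\in D$; (H2) $H_\theta,H_{\theta\theta}$ exist and are continuous in $(x,\theta)$; (H3) for every compact $K\subset D$ there is $m_K>0$ with $\langle\xi,H_{\theta\theta}(x,\theta)\xi\rangle\ge m_K|\xi|^2$ for all $x\in K$, $\theta,\xi\in\mathbb R^n$. Such $H$ induces the local action $\ell(x,y):=\max\{\langle y,\theta\rangle\mid\theta\in\mathbb R^n,\ H(x,\theta)\le0\}$ and the geometric action $S(\gamma):=\int_0^1\ell(\varphi,\varphi')\,d\alpha$ for $\gamma\in\tilde\Gamma$, with $\varphi\in\tilde C(0,1)$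 any parameterization of $\gamma$. $\mathcal H$ is the class of all actions so induced. $\mathcal H_0^+\subset\mathcal H$ is the class of actions induced by some Hamiltonian satisfying (H1') $H(x,0)=0$ for all $x\in D$, (H2') the derivatives $H_x$, $H_\theta$, $H_{x\theta}=(H_{\theta x})^T$, $H_{\theta\theta}$, $H_{x\theta\theta}$ exist and are continuous in $(x,\theta)$, and (H3). A natural drift of $S\in\mathcal H$ is a vector field $b(x):=H_\theta(x,0)$ with $H$ any Hamiltonian (satisfying (H1)-(H3)) inducing $S$, provided $b$ is $C^1$. Its flow $\psi$ solves $\partial_t\psi(x,t)=b(\psi(x,t))$, $\psi(x,0)=x$; flows are assumed throughout to be defined for all $t\in\mathbb R$. Minimizers. $P(A_1,A_2)$ denotes the problem $\inf_{\gamma\in\Gamma_{A_1}^{A_2}}S(\gamma)$, $P(x_1,x_2):=P(\{x_1\},\{x_2\})$. A strong (weak) minimizer is $\gamma^\star\in\Gamma_{A_1}^{A_2}$ ($\gamma^\star\in\tilde\Gamma_{A_1}^{A_2}$) with $S(\gamma^\star)=\inf_{\gamma\in\Gamma_{A_1}^{A_2}}S(\gamma)$. A point $x\in\tilde D$ has strong local minimizers if there exist $r,\eta>0$ and a compact $K\subset\tilde D$ such that for all $x_1,x_2\in\bar B_r(x)\cap\tilde D$ the problem $P(x_1,x_2)$ has a strong minimizer $\gamma^\star\in\Gamma_{x_1}^{x_2}$ with $\gamma^\star\subset K$ and $\operatorname{length}(\gamma^\star)\le\eta$. It has weak local minimizers if there exist $r>0$, a function $\eta\colon(0,\infty)\to[0,\infty)$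 and a compact $K\subset\tilde D$ such that for all $x_1,x_2\in\bar B_r(x)\cap\tilde D$ the problem $P(x_1,x_2)$ has a weak minimizer $\gamma^\star\in\tilde\Gamma_{x_1}^{x_2}(x)$ with $\gamma^\star\subset K$ and $\operatorname{length}(\gamma^\star|_{\bar B_u(x)^c})\le\eta(u)$ for all $u>0$. *)

theory Defs
  imports "HOL-Analysis.Analysis"
begin

section \<open>Unparameterized oriented curves\<close>

text \<open>A parameterization is a pair \<open>(T, \<phi>)\<close>; only the values of \<open>\<phi>\<close> on \<open>[0, T]\<close> matter.
  A curve in \<open>D\<close> is the class of all parameterizations at mutual Frechet distance 0.\<close>

type_synonym 'a param = "real \<times> (real \<Rightarrow> 'a)"
type_synonym 'a curve = "'a param set"

definition params :: "'a::euclidean_space set \<Rightarrow> 'a param set" where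
  "params D = {(T, \<phi>). T > 0 \<and> continuous_on {0..T} \<phi> \<and> \<phi> ` {0..T} \<subseteq> D}"

definition time_changes :: "real \<Rightarrow> (real \<Rightarrow> real) set" where
  "time_changes T = {\<alpha>. continuous_on {0..1} \<alpha> \<and> mono_on {0..1} \<alpha> \<and> \<alpha> ` {0..1} = {0..T}}"

definition frechet_dist :: "'a::euclidean_space param \<Rightarrow> 'a param \<Rightarrow> real" where
  "frechet_dist = (\<lambda>(T\<^sub>1, \<phi>\<^sub>1) (T\<^sub>2, \<phi>\<^sub>2).
     INF (\<alpha>, \<beta>) \<in> time_changes T\<^sub>1 \<times> time_changes T\<^sub>2. SUP s\<in>{0..1}. dist (\<phi>\<^sub>1 (\<alpha> s)) (\<phi>\<^sub>2 (\<beta> s)))"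

definition curves :: "'a::euclidean_space set \<Rightarrow> 'a curve set" where
  "curves D = params D // {(p, q). p \<in> params D \<and> q \<in> params D \<and> frechet_dist p q = 0}"

definition curve_image :: "'a::euclidean_space curve \<Rightarrow> 'a set" where
  "curve_image \<gamma> = (\<Union>(T, \<phi>)\<in>\<gamma>. \<phi> ` {0..T})"

text \<open>Restriction of a set of curves to those that lie in \<open>G\<close>, start in \<open>A\<^sub>1\<close> and end in \<open>A\<^sub>2\<close>.
  End points do not depend on the parameterization.\<close>

definition curves_from_to ::
    "'a::euclidean_space curve set \<Rightarrow> 'a set \<Rightarrow> 'a set \<Rightarrow> 'a set \<Rightarrow> 'a curve set" where
  "curves_from_to \<C> G A\<^sub>1 A\<^sub>2 =
     {\<gamma> \<in> \<C>. curve_image \<gamma> \<subseteq> G \<and> (\<forall>(T, \<phi>)\<in>\<gamma>. \<phi> 0 \<in> A\<^sub>1 \<and> \<phi> T \<in> A\<^sub>2)}"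


section \<open>Rectifiable curves and absolute continuity\<close>

definition param_length :: "'a::euclidean_space param \<Rightarrow> ennreal" where
  "param_length = (\<lambda>(T, \<phi>).
     SUP d\<in>{d. d division_of {0..T}}. \<Sum>k\<in>d. ennreal (norm (\<phi> (Sup k) - \<phi> (Inf k))))"

text \<open>The length is the same for all parameterizations of a curve.\<close>

definition curve_length :: "'a::euclidean_space curve \<Rightarrow> ennreal" where
  "curve_length \<gamma> = param_length (SOME p. p \<in> \<gamma>)"

definition rect_curves :: "'a::euclidean_space set \<Rightarrow> 'a curve set" where
  "rect_curves D = {\<gamma> \<in> curves D. curve_length \<gamma> < \<infinity>}"

text \<open>The usual \<open>\<epsilon>\<close>-\<open>\<delta>\<close> definition on an interval \<open>I\<close>: \<open>d\<close> ranges over the finite families of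
  non-overlapping compact subintervals \<open>[Inf k, Sup k]\<close> of \<open>I\<close>.\<close>

definition abs_continuous_on :: "real set \<Rightarrow> (real \<Rightarrow> 'a::euclidean_space) \<Rightarrow> bool" where
  "abs_continuous_on I \<phi> \<longleftrightarrow>
     (\<forall>\<epsilon>>0. \<exists>\<delta>>0. \<forall>d. d division_of \<Union>d \<and> \<Union>d \<subseteq> I \<and> (\<Sum>k\<in>d. Sup k - Inf k) < \<delta> \<longrightarrow>
        (\<Sum>k\<in>d. norm (\<phi> (Sup k) - \<phi> (Inf k))) < \<epsilon>)"

text \<open>The space \<open>C~(0,1)\<close>, the curve set \<open>\<Gamma>~\<close> and its subset \<open>\<Gamma>~(x)\<close>.\<close>

definition weak_params :: "'a::euclidean_space set \<Rightarrow> (real \<Rightarrow> 'a) set" where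
  "weak_params D = {\<phi>. (1, \<phi>) \<in> params D \<and>
     (\<exists>F. finite F \<and> F \<subseteq> {0..1} \<and>
        (\<forall>\<alpha>\<in>{0..1} - F. \<exists>\<delta>>0. abs_continuous_on ({0..1} \<inter> {\<alpha> - \<delta>..\<alpha> + \<delta>}) \<phi>))}"

definition weak_curves :: "'a::euclidean_space set \<Rightarrow> 'a curve set" where
  "weak_curves D = {\<gamma> \<in> curves D. \<exists>\<phi>\<in>weak_params D. (1, \<phi>) \<in> \<gamma>}"

definition weak_curves_at :: "'a::euclidean_space set \<Rightarrow> 'a \<Rightarrow> 'a curve set" where
  "weak_curves_at D x = {\<gamma> \<in> weak_curves D. \<exists>\<phi>. (1, \<phi>) \<in> params D \<and> (1, \<phi>) \<in> \<gamma> \<and>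
     (abs_continuous_on {0..1} \<phi> \<or>
      \<phi> (1/2) = x \<and>
      (\<forall>a\<in>{0<..<1/2}. abs_continuous_on {0..1/2 - a} \<phi> \<and> abs_continuous_on {1/2 + a..1} \<phi>))}"

text \<open>Length of the part of a curve in \<open>\<Gamma>~\<close> that lies in the Borel set \<open>E\<close>; the value does not
  depend on the choice of \<open>\<phi>\<close>.  The derivative exists almost everywhere.\<close>

definition length_within :: "'a::euclidean_space set \<Rightarrow> 'a curve \<Rightarrow> 'a set \<Rightarrow> ennreal" where
  "length_within D \<gamma> E = (let \<phi> = (SOME \<phi>. \<phi> \<in> weak_params D \<and> (1, \<phi>) \<in> \<gamma>) in
     \<integral>\<^sup>+\<alpha>\<in>{0..1}. ennreal (norm (vector_derivative \<phi> (at \<alpha>))) * indicator E (\<phi> \<alpha>) \<partial>lborel)"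

definition locally_rect_connected :: "'a::euclidean_space set \<Rightarrow> 'a set \<Rightarrow> bool" where
  "locally_rect_connected D G \<longleftrightarrow>
     (\<forall>x\<in>G. \<forall>\<nu>>0. \<exists>r>0. \<forall>w\<in>cball x r \<inter> G.
        \<exists>\<gamma>\<in>curves_from_to (rect_curves D) G {x} {w}. curve_length \<gamma> \<le> ennreal \<nu>)"


section \<open>Hamiltonians and geometric actions\<close>

text \<open>Existence and joint continuity of the \<open>\<theta>\<close>-gradient \<open>H\<^sub>\<theta>\<close> and the \<open>\<theta>\<close>-Hessian \<open>H\<^sub>\<theta>\<^sub>\<theta>\<close>.\<close>

definition theta_derivs :: "'a::euclidean_space set \<Rightarrow> ('a \<Rightarrow> 'a \<Rightarrow> real) \<Rightarrow>
    ('a \<Rightarrow> 'a \<Rightarrow> 'a) \<Rightarrow> ('a \<Rightarrow> 'a \<Rightarrow> 'a \<Rightarrow>\<^sub>L 'a) \<Rightarrow> bool" where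
  "theta_derivs D H H\<^sub>\<theta> H\<^sub>\<theta>\<^sub>\<theta> \<longleftrightarrow>
     (\<forall>x\<in>D. \<forall>\<theta>. GDERIV (H x) \<theta> :> H\<^sub>\<theta> x \<theta>) \<and>
     (\<forall>x\<in>D. \<forall>\<theta>. (H\<^sub>\<theta> x has_derivative blinfun_apply (H\<^sub>\<theta>\<^sub>\<theta> x \<theta>)) (at \<theta>)) \<and>
     continuous_on (D \<times> UNIV) (\<lambda>(x, \<theta>). H\<^sub>\<theta> x \<theta>) \<and>
     continuous_on (D \<times> UNIV) (\<lambda>(x, \<theta>). H\<^sub>\<theta>\<^sub>\<theta> x \<theta>)"

text \<open>The remaining derivatives: \<open>H\<^sub>x\<^sub>\<theta>\<close> is the \<open>\<theta>\<close>-Jacobian of the gradient \<open>H\<^sub>x\<close>, its transpose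
  \<open>H\<^sub>\<theta>\<^sub>x\<close> is the \<open>x\<close>-Jacobian of \<open>H\<^sub>\<theta>\<close>, and \<open>H\<^sub>x\<^sub>\<theta>\<^sub>\<theta>\<close> is the \<open>x\<close>-derivative of \<open>H\<^sub>\<theta>\<^sub>\<theta>\<close>.\<close>

definition x_derivs :: "'a::euclidean_space set \<Rightarrow> ('a \<Rightarrow> 'a \<Rightarrow> real) \<Rightarrow>
    ('a \<Rightarrow> 'a \<Rightarrow> 'a) \<Rightarrow> ('a \<Rightarrow> 'a \<Rightarrow> 'a \<Rightarrow>\<^sub>L 'a) \<Rightarrow> bool" where
  "x_derivs D H H\<^sub>\<theta> H\<^sub>\<theta>\<^sub>\<theta> \<longleftrightarrow>
     (\<exists>(H\<^sub>x :: 'a \<Rightarrow> 'a \<Rightarrow> 'a) (H\<^sub>x\<^sub>\<theta> :: 'a \<Rightarrow> 'a \<Rightarrow> 'a \<Rightarrow>\<^sub>L 'a) (H\<^sub>\<theta>\<^sub>x :: 'a \<Rightarrow> 'a \<Rightarrow> 'a \<Rightarrow>\<^sub>L 'a)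
        (H\<^sub>x\<^sub>\<theta>\<^sub>\<theta> :: 'a \<Rightarrow> 'a \<Rightarrow> 'a \<Rightarrow>\<^sub>L 'a \<Rightarrow>\<^sub>L 'a).
        (\<forall>x\<in>D. \<forall>\<theta>. GDERIV (\<lambda>x. H x \<theta>) x :> H\<^sub>x x \<theta>) \<and>
        (\<forall>x\<in>D. \<forall>\<theta>. (H\<^sub>x x has_derivative blinfun_apply (H\<^sub>x\<^sub>\<theta> x \<theta>)) (at \<theta>)) \<and>
        (\<forall>x\<in>D. \<forall>\<theta>. ((\<lambda>x. H\<^sub>\<theta> x \<theta>) has_derivative blinfun_apply (H\<^sub>\<theta>\<^sub>x x \<theta>)) (at x)) \<and>
        (\<forall>x\<in>D. \<forall>\<theta> u v. u \<bullet> blinfun_apply (H\<^sub>x\<^sub>\<theta> x \<theta>) v = blinfun_apply (H\<^sub>\<theta>\<^sub>x x \<theta>) u \<bullet> v) \<and>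
        (\<forall>x\<in>D. \<forall>\<theta>. ((\<lambda>x. H\<^sub>\<theta>\<^sub>\<theta> x \<theta>) has_derivative blinfun_apply (H\<^sub>x\<^sub>\<theta>\<^sub>\<theta> x \<theta>)) (at x)) \<and>
        continuous_on (D \<times> UNIV) (\<lambda>(x, \<theta>). H\<^sub>x x \<theta>) \<and>
        continuous_on (D \<times> UNIV) (\<lambda>(x, \<theta>). H\<^sub>x\<^sub>\<theta> x \<theta>) \<and>
        continuous_on (D \<times> UNIV) (\<lambda>(x, \<theta>). H\<^sub>\<theta>\<^sub>x x \<theta>) \<and>
        continuous_on (D \<times> UNIV) (\<lambda>(x, \<theta>). H\<^sub>x\<^sub>\<theta>\<^sub>\<theta> x \<theta>))"

definition locally_uniformly_convex ::
    "'a::euclidean_space set \<Rightarrow> ('a \<Rightarrow> 'a \<Rightarrow> 'a \<Rightarrow>\<^sub>L 'a) \<Rightarrow> bool" where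
  "locally_uniformly_convex D H\<^sub>\<theta>\<^sub>\<theta> \<longleftrightarrow>
     (\<forall>K. compact K \<and> K \<subseteq> D \<longrightarrow>
        (\<exists>m>0. \<forall>x\<in>K. \<forall>\<theta> \<xi>. \<xi> \<bullet> blinfun_apply (H\<^sub>\<theta>\<^sub>\<theta> x \<theta>) \<xi> \<ge> m * (norm \<xi>)\<^sup>2))"

text \<open>Hamiltonians with (H1), (H2), (H3), and those with (H1'), (H2'), (H3).\<close>

definition hamiltonian :: "'a::euclidean_space set \<Rightarrow> ('a \<Rightarrow> 'a \<Rightarrow> real) \<Rightarrow> bool" where
  "hamiltonian D H \<longleftrightarrow>
     continuous_on (D \<times> UNIV) (\<lambda>(x, \<theta>). H x \<theta>) \<and>
     (\<forall>x\<in>D. H x 0 \<le> 0) \<and>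
     (\<exists>H\<^sub>\<theta> H\<^sub>\<theta>\<^sub>\<theta>. theta_derivs D H H\<^sub>\<theta> H\<^sub>\<theta>\<^sub>\<theta> \<and> locally_uniformly_convex D H\<^sub>\<theta>\<^sub>\<theta>)"

definition hamiltonian_0_plus :: "'a::euclidean_space set \<Rightarrow> ('a \<Rightarrow> 'a \<Rightarrow> real) \<Rightarrow> bool" where
  "hamiltonian_0_plus D H \<longleftrightarrow>
     continuous_on (D \<times> UNIV) (\<lambda>(x, \<theta>). H x \<theta>) \<and>
     (\<forall>x\<in>D. H x 0 = 0) \<and>
     (\<exists>H\<^sub>\<theta> H\<^sub>\<theta>\<^sub>\<theta>. theta_derivs D H H\<^sub>\<theta> H\<^sub>\<theta>\<^sub>\<theta> \<and> x_derivs D H H\<^sub>\<theta> H\<^sub>\<theta>\<^sub>\<theta> \<and>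
        locally_uniformly_convex D H\<^sub>\<theta>\<^sub>\<theta>)"

text \<open>For a Hamiltonian and \<open>x \<in> D\<close> the supremum is attained: \<open>{\<theta>. H x \<theta> \<le> 0}\<close> is compact, and it
  contains 0, so the local action is nonnegative.\<close>

definition local_action :: "('a::euclidean_space \<Rightarrow> 'a \<Rightarrow> real) \<Rightarrow> 'a \<Rightarrow> 'a \<Rightarrow> real" where
  "local_action H x y = Sup {y \<bullet> \<theta> |\<theta>. H x \<theta> \<le> 0}"

text \<open>\<open>H\<close> induces the action \<open>S\<close> on \<open>\<Gamma>~\<close>.  The integral is the same for every parameterization of
  \<open>\<gamma>\<close> in \<open>C~(0,1)\<close>; it may be infinite.\<close>

definition induces :: "'a::euclidean_space set \<Rightarrow> ('a \<Rightarrow> 'a \<Rightarrow> real) \<Rightarrow> ('a curve \<Rightarrow> ennreal) \<Rightarrow> bool" where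
  "induces D H S \<longleftrightarrow>
     (\<forall>\<gamma>\<in>weak_curves D. \<forall>\<phi>\<in>weak_params D. (1, \<phi>) \<in> \<gamma> \<longrightarrow>
        S \<gamma> = (\<integral>\<^sup>+\<alpha>\<in>{0..1}. ennreal (local_action H (\<phi> \<alpha>) (vector_derivative \<phi> (at \<alpha>))) \<partial>lborel))"

definition actions_0_plus :: "'a::euclidean_space set \<Rightarrow> ('a curve \<Rightarrow> ennreal) set" where
  "actions_0_plus D = {S. \<exists>H. hamiltonian_0_plus D H \<and> induces D H S}"

definition C1_on :: "'a::euclidean_space set \<Rightarrow> ('a \<Rightarrow> 'a) \<Rightarrow> bool" where
  "C1_on D b \<longleftrightarrow> (\<exists>b' :: 'a \<Rightarrow> 'a \<Rightarrow>\<^sub>L 'a.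
     (\<forall>x\<in>D. (b has_derivative blinfun_apply (b' x)) (at x)) \<and> continuous_on D b')"

definition natural_drift ::
    "'a::euclidean_space set \<Rightarrow> ('a curve \<Rightarrow> ennreal) \<Rightarrow> ('a \<Rightarrow> 'a) \<Rightarrow> bool" where
  "natural_drift D S b \<longleftrightarrow> C1_on D b \<and>
     (\<exists>H. hamiltonian D H \<and> induces D H S \<and> (\<forall>x\<in>D. GDERIV (H x) 0 :> b x))"

definition flow_of :: "'a::euclidean_space set \<Rightarrow> ('a \<Rightarrow> 'a) \<Rightarrow> ('a \<Rightarrow> real \<Rightarrow> 'a) \<Rightarrow> bool" where
  "flow_of D b \<psi> \<longleftrightarrow> (\<forall>x\<in>D. \<psi> x 0 = x \<and>
     (\<forall>t. \<psi> x t \<in> D \<and> (\<psi> x has_vector_derivative b (\<psi> x t)) (at t)))"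

definition limit_cycle ::
    "('a::euclidean_space \<Rightarrow> 'a) \<Rightarrow> ('a \<Rightarrow> real \<Rightarrow> 'a) \<Rightarrow> 'a set \<Rightarrow> bool" where
  "limit_cycle b \<psi> L \<longleftrightarrow> (\<exists>x\<in>L. \<exists>T>0. b x \<noteq> 0 \<and> L = \<psi> x ` {0..<T} \<and> \<psi> x T = x)"


section \<open>Minimizers\<close>

text \<open>Strong and weak minimizers of the problem \<open>P(A\<^sub>1, A\<^sub>2)\<close> of curves in \<open>G\<close>; the infimum is
  over rectifiable curves in both cases.\<close>

definition min_value :: "'a::euclidean_space set \<Rightarrow> 'a set \<Rightarrow> ('a curve \<Rightarrow> ennreal) \<Rightarrow>
    'a set \<Rightarrow> 'a set \<Rightarrow> ennreal" where
  "min_value D G S A\<^sub>1 A\<^sub>2 = (INF \<gamma>\<in>curves_from_to (rect_curves D) G A\<^sub>1 A\<^sub>2. S \<gamma>)"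

definition strong_minimizer :: "'a::euclidean_space set \<Rightarrow> 'a set \<Rightarrow> ('a curve \<Rightarrow> ennreal) \<Rightarrow>
    'a set \<Rightarrow> 'a set \<Rightarrow> 'a curve \<Rightarrow> bool" where
  "strong_minimizer D G S A\<^sub>1 A\<^sub>2 \<gamma> \<longleftrightarrow>
     \<gamma> \<in> curves_from_to (rect_curves D) G A\<^sub>1 A\<^sub>2 \<and> S \<gamma> = min_value D G S A\<^sub>1 A\<^sub>2"

definition weak_minimizer :: "'a::euclidean_space set \<Rightarrow> 'a set \<Rightarrow> ('a curve \<Rightarrow> ennreal) \<Rightarrow>
    'a set \<Rightarrow> 'a set \<Rightarrow> 'a curve \<Rightarrow> bool" where
  "weak_minimizer D G S A\<^sub>1 A\<^sub>2 \<gamma> \<longleftrightarrow>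
     \<gamma> \<in> curves_from_to (weak_curves D) G A\<^sub>1 A\<^sub>2 \<and> S \<gamma> = min_value D G S A\<^sub>1 A\<^sub>2"

definition has_strong_local_minimizers ::
    "'a::euclidean_space set \<Rightarrow> 'a set \<Rightarrow> ('a curve \<Rightarrow> ennreal) \<Rightarrow> 'a \<Rightarrow> bool" where
  "has_strong_local_minimizers D G S x \<longleftrightarrow>
     (\<exists>r>0. \<exists>\<eta>>0. \<exists>K. compact K \<and> K \<subseteq> G \<and>
        (\<forall>x\<^sub>1\<in>cball x r \<inter> G. \<forall>x\<^sub>2\<in>cball x r \<inter> G.
           \<exists>\<gamma>. strong_minimizer D G S {x\<^sub>1} {x\<^sub>2} \<gamma> \<and> curve_image \<gamma> \<subseteq> K \<and>
              curve_length \<gamma> \<le> ennreal \<eta>))"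

definition has_weak_local_minimizers ::
    "'a::euclidean_space set \<Rightarrow> 'a set \<Rightarrow> ('a curve \<Rightarrow> ennreal) \<Rightarrow> 'a \<Rightarrow> bool" where
  "has_weak_local_minimizers D G S x \<longleftrightarrow>
     (\<exists>r>0. \<exists>\<eta>::real \<Rightarrow> real. (\<forall>u>0. \<eta> u \<ge> 0) \<and> (\<exists>K. compact K \<and> K \<subseteq> G \<and>
        (\<forall>x\<^sub>1\<in>cball x r \<inter> G. \<forall>x\<^sub>2\<in>cball x r \<inter> G.
           \<exists>\<gamma>\<in>weak_curves_at D x. weak_minimizer D G S {x\<^sub>1} {x\<^sub>2} \<gamma> \<and> curve_image \<gamma> \<subseteq> K \<and>
              (\<forall>u>0. length_within D \<gamma> (- cball x u) \<le> ennreal (\<eta> u)))))"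

end

theory Submission
  imports Defs
begin

text \<open>The drift \<open>b\<close> is followed at no cost, and a deviation \<open>v\<close> from it costs at most a
  multiple of \<open>|v|\<^sup>2\<close>.
  Two estimates for paths close to the limit cycle \<open>L\<close> exclude minimizers that end on \<open>L\<close>.

  Upper bound (\<open>reach_limit_cycle\<close>): from a point at distance \<open>\<delta>\<close> from \<open>L\<close>, every point of \<open>L\<close> is
  reached with action at most \<open>C \<delta>\<^sup>2\<close>.  The path follows the trajectory through the closest point of \<open>L\<close>
  for at least one period and reduces its deviation from that trajectory linearly to 0.

  Lower bound (\<open>barrier\<close>, \<open>action_ge_potential\<close>): let \<open>z\<close> be the point at which a path meets \<open>L\<close> for the
  first time.  By continuity the last part of the path stays in a small ball around \<open>z\<close>, so that it has
  no room for approaching \<open>L\<close> slowly.  In a ball whose radius is proportional to a small number \<open>a\<close>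
  there is a subsolution \<open>f\<close> of the Hamilton-Jacobi equation, \<open>H(x, \<nabla>f) \<le> 0\<close>, with \<open>f z = 0\<close> and
  \<open>f \<le> - (\<kappa> / a) dist(x, L)\<^sup>2\<close>, where \<open>\<kappa>\<close> does not depend on \<open>a\<close>.  Since \<open>y \<bullet> \<nabla>f\<close> is at most the local
  action at \<open>(x, y)\<close>, the last part costs at least \<open>(\<kappa> / a) \<delta>\<^sup>2\<close> if it starts at distance \<open>\<delta>\<close> from \<open>L\<close>.

  For \<open>a < \<kappa> / C\<close>, replacing the end of the path by a way around the cycle makes the action strictly
  smaller (\<open>no_weak_minimizer\<close>).  The infimum is over rectifiable curves only, so the remaining first
  part of a weak minimizer is also made rectifiable, at arbitrarily small cost (\<open>reach_approx\<close>).
  This proves (i).  Part (ii) follows because the cycle has empty interior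
  (\<open>limit_cycle_empty_interior\<close>): close to \<open>x \<in> L\<close> there is a point \<open>x\<^sub>1\<close> off the cycle, and (i) applies to
  paths from \<open>x\<^sub>1\<close> to \<open>x\<close>.

  The quadratic cost of deviations holds because the Hamiltonian that defines the natural drift
  vanishes at \<open>\<theta> = 0\<close> (\<open>natural_drift_hamiltonian_vanishes\<close>).  Three facts about curves are used
  throughout: absolutely continuous functions are differentiable almost everywhere and are integrals
  of their derivatives, length is an invariant of the Frechet class, and rectifiable curves have
  Lipschitz parameterizations.\<close>

section \<open>Variation of curves\<close>

lemma division_cell:
  assumes "d division_of S" "k \<in> d"
  obtains u v where "u \<le> (v::real)" "k = {u..v}" "Inf k = u" "Sup k = v"
proof -
  obtain u v where "k = cbox u v" using division_ofD(4)[OF assms] by blast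
  moreover have "k \<noteq> {}" using division_ofD(3)[OF assms] .
  ultimately show ?thesis using that[of u v] by auto
qed

text \<open>The size of the increment of \<open>\<phi>\<close> over the compact interval \<open>k\<close>.\<close>

definition jump :: "(real \<Rightarrow> 'a::euclidean_space) \<Rightarrow> real set \<Rightarrow> ennreal" where
  "jump \<phi> k = ennreal (norm (\<phi> (Sup k) - \<phi> (Inf k)))"

text \<open>The total variation of \<open>\<phi>\<close> over \<open>[a, b]\<close>, which is the length if \<open>[a, b]\<close> is the whole domain.\<close>

definition variation :: "(real \<Rightarrow> 'a::euclidean_space) \<Rightarrow> real \<Rightarrow> real \<Rightarrow> ennreal" where
  "variation \<phi> a b = (SUP d\<in>{d. d division_of {a..b}}. \<Sum>k\<in>d. jump \<phi> k)"

lemma param_length_eq_variation: "param_length (T, \<phi>) = variation \<phi> 0 T"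
  by (simp add: param_length_def variation_def jump_def)

lemma variation_upper: "d division_of {a..b} \<Longrightarrow> (\<Sum>k\<in>d. jump \<phi> k) \<le> variation \<phi> a b"
  unfolding variation_def by (rule SUP_upper) auto

lemma jump_le_variation:
  assumes "a \<le> b" shows "ennreal (norm (\<phi> b - \<phi> a)) \<le> variation \<phi> a b"
proof -
  have "{{a..b}} division_of {a..b}"
    using division_of_self[of a b] assms by auto
  from variation_upper[OF this, of \<phi>] show ?thesis using assms by (simp add: jump_def)
qed

text \<open>Non-overlapping sets that have the same nonempty trace on \<open>A\<close>, an interval, meet \<open>A\<close> in one point.\<close>

lemma jump_degenerate:
  assumes "k \<inter> A = l \<inter> A" "interior k \<inter> interior l = {}" "k \<inter> A = {u..v}" "u \<le> v"
  shows "jump \<phi> (k \<inter> A) = 0"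
proof -
  have "interior (k \<inter> A) \<subseteq> interior k \<inter> interior l"
    using assms(1) by (metis interior_mono inf_le1 le_inf_iff)
  then have "interior {u..v} = {}" using assms by auto
  then have "u = v" using assms by (simp add: interior_atLeastAtMost_real)
  then have "k \<inter> A = {v}" using assms(3) by simp
  then show ?thesis by (simp add: jump_def)
qed

lemma variation_subadditive:
  assumes "a \<le> b" "b \<le> c"
  shows "variation \<phi> a c \<le> variation \<phi> a b + variation \<phi> b c"
proof -
  have "(\<Sum>k\<in>d. jump \<phi> k) \<le> variation \<phi> a b + variation \<phi> b c" if d: "d division_of {a..c}" for d
  proof -
    have d': "d division_of cbox a c" using d by simp
    have fin: "finite d" using d by (rule division_of_finite)
    define dL where "dL = {l \<in> d. l \<inter> {..b} \<noteq> {}}"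
    define dR where "dR = {l \<in> d. l \<inter> {b..} \<noteq> {}}"
    have L: "(\<lambda>l. l \<inter> {..b}) ` dL division_of {a..b}"
    proof -
      have "{x. x \<bullet> 1 \<le> b} = {..b}" "{a..c} \<inter> {..b} = {a..b}" using assms by auto
      moreover have "{l \<inter> {..b} | l. l \<in> d \<and> l \<inter> {..b} \<noteq> {}} = (\<lambda>l. l \<inter> {..b}) ` dL"
        by (auto simp: dL_def)
      ultimately show ?thesis using division_split(1)[OF d', of 1 b] by (simp del: Int_atLeastAtMostR1 Int_atLeastAtMostL1 Int_atLeastAtMostR2 Int_atLeastAtMostL2)
    qed
    have R: "(\<lambda>l. l \<inter> {b..}) ` dR division_of {b..c}"
    proof -
      have "{x. b \<le> x \<bullet> 1} = {b..}" "{a..c} \<inter> {b..} = {b..c}" using assms by auto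
      moreover have "{l \<inter> {b..} | l. l \<in> d \<and> l \<inter> {b..} \<noteq> {}} = (\<lambda>l. l \<inter> {b..}) ` dR"
        by (auto simp: dR_def)
      ultimately show ?thesis using division_split(2)[OF d', of 1 b] by (simp del: Int_atLeastAtMostR1 Int_atLeastAtMostL1 Int_atLeastAtMostR2 Int_atLeastAtMostL2)
    qed
    have sL: "(\<Sum>l\<in>dL. jump \<phi> (l \<inter> {..b})) \<le> variation \<phi> a b"
    proof -
      have "(\<Sum>k\<in>(\<lambda>l. l \<inter> {..b}) ` dL. jump \<phi> k) = sum (jump \<phi> \<circ> (\<lambda>l. l \<inter> {..b})) dL"
      proof (rule sum.reindex_nontrivial)
        show "finite dL" using fin by (simp add: dL_def)
        fix x y assume xy: "x \<in> dL" "y \<in> dL" "x \<noteq> y" "x \<inter> {..b} = y \<inter> {..b}"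
        have "x \<inter> {..b} \<in> (\<lambda>l. l \<inter> {..b}) ` dL" using xy by auto
        from division_cell[OF L this] obtain u v where "x \<inter> {..b} = {u..v}" "u \<le> v" by metis
        with xy division_ofD(5)[OF d, of x y] show "jump \<phi> (x \<inter> {..b}) = 0"
          by (intro jump_degenerate[of x _ y]) (auto simp: dL_def)
      qed
      then show ?thesis using variation_upper[OF L, of \<phi>] by simp
    qed
    have sR: "(\<Sum>l\<in>dR. jump \<phi> (l \<inter> {b..})) \<le> variation \<phi> b c"
    proof -
      have "(\<Sum>k\<in>(\<lambda>l. l \<inter> {b..}) ` dR. jump \<phi> k) = sum (jump \<phi> \<circ> (\<lambda>l. l \<inter> {b..})) dR"
      proof (rule sum.reindex_nontrivial)
        show "finite dR" using fin by (simp add: dR_def)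
        fix x y assume xy: "x \<in> dR" "y \<in> dR" "x \<noteq> y" "x \<inter> {b..} = y \<inter> {b..}"
        have "x \<inter> {b..} \<in> (\<lambda>l. l \<inter> {b..}) ` dR" using xy by auto
        from division_cell[OF R this] obtain u v where "x \<inter> {b..} = {u..v}" "u \<le> v" by metis
        with xy division_ofD(5)[OF d, of x y] show "jump \<phi> (x \<inter> {b..}) = 0"
          by (intro jump_degenerate[of x _ y]) (auto simp: dR_def)
      qed
      then show ?thesis using variation_upper[OF R, of \<phi>] by simp
    qed
    \<comment> \<open>only a cell that contains \<open>b\<close> in its interior is split, and there the triangle inequality applies\<close>
    have *: "jump \<phi> l \<le> (if l \<in> dL then jump \<phi> (l \<inter> {..b}) else 0) + (if l \<in> dR then jump \<phi> (l \<inter> {b..}) else 0)"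
      if l: "l \<in> d" for l
    proof -
      obtain u v where uv: "u \<le> v" "l = {u..v}" using division_cell[OF d l] by metis
      consider "v \<le> b" | "b \<le> u" | "u < b" "b < v" by linarith
      then show ?thesis
      proof cases
        case 1
        then have "l \<inter> {..b} = l" "l \<in> dL" using uv l by (auto simp: dL_def)
        then show ?thesis by simp
      next
        case 2
        then have "l \<inter> {b..} = l" "l \<in> dR" using uv l by (auto simp: dR_def)
        then show ?thesis by simp
      next
        case 3
        then have "l \<inter> {b..} = {b..v}" "l \<in> dR" "l \<inter> {..b} = {u..b}" "l \<in> dL"
          using uv l by (auto simp: dR_def dL_def)
        moreover have "norm (\<phi> v - \<phi> u) \<le> norm (\<phi> b - \<phi> u) + norm (\<phi> v - \<phi> b)"
          by (smt (verit) norm_triangle_sub diff_add_cancel add.commute add_diff_eq norm_triangle_ineq)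
        ultimately show ?thesis using uv 3
          by (simp add: jump_def flip: ennreal_plus)
      qed
    qed
    have "(\<Sum>k\<in>d. jump \<phi> k) \<le> (\<Sum>l\<in>d. (if l \<in> dL then jump \<phi> (l \<inter> {..b}) else 0) + (if l \<in> dR then jump \<phi> (l \<inter> {b..}) else 0))"
      by (rule sum_mono) (rule *)
    also have "\<dots> = (\<Sum>l\<in>dL. jump \<phi> (l \<inter> {..b})) + (\<Sum>l\<in>dR. jump \<phi> (l \<inter> {b..}))"
    proof -
      have "d \<inter> dL = dL" "d \<inter> dR = dR" by (auto simp: dL_def dR_def)
      then show ?thesis using fin by (simp add: sum.distrib flip: sum.inter_restrict)
    qed
    finally show ?thesis using sL sR by (meson add_mono order_trans)
  qed
  then show ?thesis unfolding variation_def[of \<phi> a c] by (auto intro!: SUP_least)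
qed

lemma variation_superadditive:
  assumes "a \<le> b" "b \<le> c"
  shows "variation \<phi> a b + variation \<phi> b c \<le> variation \<phi> a c"
proof -
  have *: "(\<Sum>k\<in>d. jump \<phi> k) + (\<Sum>k\<in>e. jump \<phi> k) \<le> variation \<phi> a c"
    if d: "d division_of {a..b}" and e: "e division_of {b..c}" for d e
  proof -
    have "interior {a..b} \<inter> interior {b..c} = {}" by (auto simp: interior_atLeastAtMost_real)
    from division_disjoint_union[OF d e this]
    have de: "d \<union> e division_of {a..c}" using assms by (simp add: ivl_disj_un_two_touch)
    have z: "jump \<phi> k = 0" if k: "k \<in> d \<inter> e" for k
    proof -
      have "k \<subseteq> {a..b} \<inter> {b..c}" using k division_ofD(2)[OF d] division_ofD(2)[OF e] by blast
      then have "k \<subseteq> {b}" by auto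
      moreover have "k \<noteq> {}" using k division_ofD(3)[OF d] by blast
      ultimately have "k = {b}" by auto
      then show ?thesis by (simp add: jump_def)
    qed
    have "(\<Sum>k\<in>d. jump \<phi> k) + (\<Sum>k\<in>e. jump \<phi> k) = (\<Sum>k\<in>d \<union> e. jump \<phi> k) + (\<Sum>k\<in>d \<inter> e. jump \<phi> k)"
      using d e by (simp add: division_of_finite sum.union_inter)
    also have "(\<Sum>k\<in>d \<inter> e. jump \<phi> k) = 0" using z by (simp add: sum.neutral)
    finally show ?thesis using variation_upper[OF de, of \<phi>] by simp
  qed
  have ne: "{d. d division_of {u..v}} \<noteq> {}" for u v :: real
    using elementary_interval[of u v] by (metis box_real(2) empty_iff mem_Collect_eq)
  show ?thesis
    unfolding variation_def[of \<phi> a b] variation_def[of \<phi> b c]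
    unfolding ennreal_SUP_add_left[OF ne, symmetric] ennreal_SUP_add_right[OF ne]
    by (intro SUP_least) (auto intro: *)
qed

lemma variation_add:
  assumes "a \<le> b" "b \<le> c"
  shows "variation \<phi> a c = variation \<phi> a b + variation \<phi> b c"
  using variation_subadditive[OF assms] variation_superadditive[OF assms] by (rule antisym)

lemma variation_mono:
  assumes "a \<le> a'" "a' \<le> b'" "b' \<le> b"
  shows "variation \<phi> a' b' \<le> variation \<phi> a b"
proof -
  have "variation \<phi> a b = variation \<phi> a a' + (variation \<phi> a' b' + variation \<phi> b' b)"
    using variation_add[of a a' b \<phi>] variation_add[of a' b' b \<phi>] assms by simp
  then show ?thesis by (metis add.commute le_iff_add add.assoc)
qed

lemma abs_continuous_on_subset: "abs_continuous_on I \<phi> \<Longrightarrow> J \<subseteq> I \<Longrightarrow> abs_continuous_on J \<phi>"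
  unfolding abs_continuous_on_def by (meson order_trans)

lemma division_length:
  assumes "d division_of {a..b::real}" "a \<le> b"
  shows "(\<Sum>k\<in>d. Sup k - Inf k) = b - a"
proof -
  have "(\<Sum>k\<in>d. Sup k - Inf k) = sum (measure lborel) d"
  proof (rule sum.cong[OF refl])
    fix k assume "k \<in> d"
    with assms obtain u v where "u \<le> v" "k = {u..v}" by (meson division_cell)
    then show "Sup k - Inf k = measure lborel k" by simp
  qed
  also have "\<dots> = b - a" using additive_content_division[of d a b] assms by simp
  finally show ?thesis .
qed

lemma jump_sum_real: "(\<Sum>k\<in>d. jump \<phi> k) = ennreal (\<Sum>k\<in>d. norm (\<phi> (Sup k) - \<phi> (Inf k)))"
  by (simp add: jump_def sum_ennreal)

lemma variation_finite:
  assumes ac: "abs_continuous_on {a..b} \<phi>" and ab: "a \<le> b"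
  shows "variation \<phi> a b < \<infinity>"
proof -
  obtain \<delta> where \<delta>: "\<delta> > 0" and H: "\<And>d. \<lbrakk>d division_of \<Union>d; \<Union>d \<subseteq> {a..b}; (\<Sum>k\<in>d. Sup k - Inf k) < \<delta>\<rbrakk>
       \<Longrightarrow> (\<Sum>k\<in>d. norm (\<phi> (Sup k) - \<phi> (Inf k))) < 1"
    using ac[unfolded abs_continuous_on_def, rule_format, of 1] by auto
  have loc: "variation \<phi> c d \<le> 1" if "a \<le> c" "c \<le> d" "d \<le> b" "d - c < \<delta>" for c d
  proof -
    have "(\<Sum>k\<in>e. jump \<phi> k) \<le> 1" if e: "e division_of {c..d}" for e
    proof -
      have "\<Union>e = {c..d}" using e by (rule division_ofD(6))
      then have "(\<Sum>k\<in>e. norm (\<phi> (Sup k) - \<phi> (Inf k))) < 1"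
        using e division_length[OF e] that \<open>a \<le> c\<close> \<open>c \<le> d\<close> \<open>d \<le> b\<close> \<open>d - c < \<delta>\<close> by (intro H) auto
      then show ?thesis by (simp add: jump_sum_real)
    qed
    then show ?thesis unfolding variation_def by (auto intro!: SUP_least)
  qed
  have "a \<le> a \<and> b \<le> b \<longrightarrow> variation \<phi> a b < \<infinity>"
  proof (rule Bolzano[OF ab, where P = "\<lambda>c d. a \<le> c \<and> d \<le> b \<longrightarrow> variation \<phi> c d < \<infinity>"])
    fix c d e
    assume "a \<le> c \<and> d \<le> b \<longrightarrow> variation \<phi> c d < \<infinity>" "a \<le> d \<and> e \<le> b \<longrightarrow> variation \<phi> d e < \<infinity>" "c \<le> d" "d \<le> e"
    then show "a \<le> c \<and> e \<le> b \<longrightarrow> variation \<phi> c e < \<infinity>"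
      using variation_add[of c d e \<phi>] by auto
  next
    fix x
    show "\<exists>e>0. \<forall>c d. c \<le> x \<and> x \<le> d \<and> d - c < e \<longrightarrow> a \<le> c \<and> d \<le> b \<longrightarrow> variation \<phi> c d < \<infinity>"
    proof (intro exI[of _ \<delta>] conjI allI impI)
      fix c d assume "c \<le> x \<and> x \<le> d \<and> d - c < \<delta>" "a \<le> c \<and> d \<le> b"
      then have "variation \<phi> c d \<le> 1" by (intro loc) auto
      then show "variation \<phi> c d < \<infinity>" by (simp add: le_less_trans)
    qed (rule \<delta>)
  qed
  then show ?thesis by simp
qed

lemma variation_less_imp_division:
  assumes "variation \<phi> a b < \<infinity>" "e > 0"
  obtains d where "d division_of {a..b}" "variation \<phi> a b < (\<Sum>k\<in>d. jump \<phi> k) + ennreal e"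
proof -
  have ne: "{d. d division_of {a..b}} \<noteq> {}" for u v :: real
    using elementary_interval[of a b] by (metis box_real(2) empty_iff mem_Collect_eq)
  have "\<exists>d\<in>{d. d division_of {a..b}}. variation \<phi> a b < (\<Sum>k\<in>d. jump \<phi> k) + ennreal e"
    using assms(1) by (intro SUP_approx_ennreal[OF assms(2) ne variation_def]) auto
  then show ?thesis using that by auto
qed

text \<open>Absolute continuity is inherited by the indefinite variation: nearly optimal divisions of the cells
  \<open>k\<close> form together a division with the same total length.\<close>

lemma abs_continuous_variation:
  assumes ac: "abs_continuous_on {a..b} \<phi>" and e: "e > 0"
  obtains \<delta> where "\<delta> > 0" "\<And>d. \<lbrakk>d division_of \<Union>d; \<Union>d \<subseteq> {a..b}; (\<Sum>k\<in>d. Sup k - Inf k) < \<delta>\<rbrakk>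
       \<Longrightarrow> (\<Sum>k\<in>d. variation \<phi> (Inf k) (Sup k)) \<le> ennreal e"
proof -
  obtain \<delta> where \<delta>: "\<delta> > 0" and H: "\<And>d. \<lbrakk>d division_of \<Union>d; \<Union>d \<subseteq> {a..b}; (\<Sum>k\<in>d. Sup k - Inf k) < \<delta>\<rbrakk>
       \<Longrightarrow> (\<Sum>k\<in>d. norm (\<phi> (Sup k) - \<phi> (Inf k))) < e/2"
    using ac[unfolded abs_continuous_on_def, rule_format, of "e/2"] e by auto
  show ?thesis
  proof (rule that[OF \<delta>])
    fix d assume d: "d division_of \<Union>d" "\<Union>d \<subseteq> {a..b}" "(\<Sum>k\<in>d. Sup k - Inf k) < \<delta>"
    have fin: "finite d" using d(1) by (rule division_of_finite)
    define e' where "e' = e / (2 * (card d + 1))"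
    have e': "e' > 0" using e by (simp add: e'_def)
    have "\<exists>c. c division_of k \<and> variation \<phi> (Inf k) (Sup k) \<le> (\<Sum>j\<in>c. jump \<phi> j) + ennreal e'" if k: "k \<in> d" for k
    proof -
      obtain u v where uv: "u \<le> v" "k = {u..v}" "Inf k = u" "Sup k = v" using division_cell[OF d(1) k] .
      have "k \<subseteq> {a..b}" using k d(2) by auto
      then have "variation \<phi> u v < \<infinity>" using uv
        by (intro variation_finite abs_continuous_on_subset[OF ac]) auto
      from variation_less_imp_division[OF this e'] uv show ?thesis by (metis order_less_imp_le)
    qed
    then obtain c where c: "\<And>k. k \<in> d \<Longrightarrow> c k division_of k"
        "\<And>k. k \<in> d \<Longrightarrow> variation \<phi> (Inf k) (Sup k) \<le> (\<Sum>j\<in>c k. jump \<phi> j) + ennreal e'"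
      by metis
    have cU: "\<And>k. k \<in> d \<Longrightarrow> \<Union>(c k) = k" using c(1) by (meson division_ofD(6))
    have deg: "\<exists>u. j = {u}" if h: "k \<in> d" "l \<in> d" "k \<noteq> l" "j \<in> c k" "j \<in> c l" for j k l
    proof -
      obtain u v where uv: "u \<le> v" "j = {u..v}" using division_cell[OF c(1)[OF h(1)] h(4)] .
      have "j \<subseteq> k" "j \<subseteq> l" using that cU by blast+
      then have "interior j \<subseteq> interior k \<inter> interior l" by (simp add: interior_mono)
      then have "interior j = {}" using division_ofD(5)[OF d(1) that(1-3)] by auto
      then have "u = v" using uv by (simp add: interior_atLeastAtMost_real)
      then show ?thesis using uv by auto
    qed
    have int: "interior j \<inter> interior i = {}" if "k \<in> d" "l \<in> d" "j \<in> c k" "i \<in> c l" "j \<noteq> i" for i j k l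
    proof (cases "k = l")
      case True
      then show ?thesis using division_ofD(5)[OF c(1)[OF that(1)], of j i] that by auto
    next
      case False
      have "j \<subseteq> k" "i \<subseteq> l" using that cU by blast+
      then have "interior j \<inter> interior i \<subseteq> interior k \<inter> interior l" by (meson Int_mono interior_mono)
      then show ?thesis using division_ofD(5)[OF d(1) that(1,2) False] by auto
    qed
    have UU: "\<Union>(\<Union>(c ` d)) = \<Union>d"
    proof -
      have "\<Union>(\<Union>(c ` d)) = (\<Union>k\<in>d. \<Union>(c k))" by auto
      also have "\<dots> = (\<Union>k\<in>d. k)" using cU by (intro SUP_cong) auto
      finally show ?thesis by simp
    qed
    have div: "\<Union>(c ` d) division_of \<Union>(\<Union>(c ` d))"
    proof (rule division_of_Union)
      show "finite (c ` d)" using fin by auto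
      show "p division_of \<Union>p" if "p \<in> c ` d" for p using that c(1) cU by auto
    qed (use int in blast)
    have reindex: "sum g (\<Union>(c ` d)) = (\<Sum>k\<in>d. sum g (c k))"
      if g: "\<And>u. g {u} = 0" for g :: "real set \<Rightarrow> real"
    proof -
      have "sum g (\<Union>(c ` d)) = sum g (snd ` (SIGMA k:d. c k))" by (rule arg_cong[where f="sum g"]) force
      also have "\<dots> = sum (g \<circ> snd) (SIGMA k:d. c k)"
      proof (rule sum.reindex_nontrivial)
        show "finite (SIGMA k:d. c k)" using fin c(1) by (auto dest: division_of_finite)
        fix x y assume "x \<in> (SIGMA k:d. c k)" "y \<in> (SIGMA k:d. c k)" "x \<noteq> y" "snd x = snd y"
        then have "fst x \<in> d" "fst y \<in> d" "fst x \<noteq> fst y" "snd x \<in> c (fst x)" "snd x \<in> c (fst y)"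
          by (auto simp: prod_eq_iff)
        from deg[OF this] show "g (snd x) = 0" using g by auto
      qed
      also have "\<dots> = (\<Sum>k\<in>d. sum g (c k))"
        using fin c(1) by (subst sum.Sigma) (auto dest: division_of_finite simp: case_prod_beta)
      finally show ?thesis .
    qed
    have "(\<Sum>j\<in>\<Union>(c ` d). Sup j - Inf j) = (\<Sum>k\<in>d. Sup k - Inf k)"
    proof (subst reindex)
      show "(\<Sum>k\<in>d. \<Sum>j\<in>c k. Sup j - Inf j) = (\<Sum>k\<in>d. Sup k - Inf k)"
      proof (rule sum.cong[OF refl])
        fix k assume k: "k \<in> d"
        obtain u v where uv: "u \<le> v" "k = {u..v}" "Inf k = u" "Sup k = v" using division_cell[OF d(1) k] .
        show "(\<Sum>j\<in>c k. Sup j - Inf j) = Sup k - Inf k"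
          using division_length[of "c k" u v] uv c(1)[OF k] by simp
      qed
    qed auto
    then have "(\<Sum>j\<in>\<Union>(c ` d). norm (\<phi> (Sup j) - \<phi> (Inf j))) < e/2"
      using d div by (intro H) (simp_all only: UU)
    then have *: "(\<Sum>k\<in>d. \<Sum>j\<in>c k. norm (\<phi> (Sup j) - \<phi> (Inf j))) < e/2"
      by (subst (asm) reindex) auto
    have "(\<Sum>k\<in>d. variation \<phi> (Inf k) (Sup k)) \<le> (\<Sum>k\<in>d. (\<Sum>j\<in>c k. jump \<phi> j) + ennreal e')"
      by (rule sum_mono) (rule c(2))
    also have "\<dots> = ennreal (\<Sum>k\<in>d. \<Sum>j\<in>c k. norm (\<phi> (Sup j) - \<phi> (Inf j))) + ennreal (card d * e')"
      using e' by (simp add: sum.distrib jump_sum_real sum_ennreal sum_nonneg ennreal_mult ennreal_of_nat_eq_real_of_nat)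
    also have "\<dots> = ennreal ((\<Sum>k\<in>d. \<Sum>j\<in>c k. norm (\<phi> (Sup j) - \<phi> (Inf j))) + card d * e')"
      using e' by (subst ennreal_plus) (auto intro!: sum_nonneg)
    also have "\<dots> \<le> ennreal e"
    proof (rule ennreal_leI)
      have "card d * e' \<le> e/2" using e by (simp add: e'_def field_simps)
      with * show "(\<Sum>k\<in>d. \<Sum>j\<in>c k. norm (\<phi> (Sup j) - \<phi> (Inf j))) + card d * e' \<le> e" by linarith
    qed
    finally show "(\<Sum>k\<in>d. variation \<phi> (Inf k) (Sup k)) \<le> ennreal e" .
  qed
qed

section \<open>The fundamental theorem of calculus for absolutely continuous functions\<close>

lemma abs_continuous_pair:
  assumes "abs_continuous_on {a..b} \<phi>" "e > 0"
  obtains \<delta> where "\<delta> > 0"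
    "\<And>s t. \<lbrakk>s \<in> {a..b}; t \<in> {a..b}; \<bar>t - s\<bar> < \<delta>\<rbrakk> \<Longrightarrow> norm (\<phi> t - \<phi> s) < e"
proof -
  obtain \<delta> where \<delta>: "\<delta> > 0" and H: "\<And>d. \<lbrakk>d division_of \<Union>d; \<Union>d \<subseteq> {a..b}; (\<Sum>k\<in>d. Sup k - Inf k) < \<delta>\<rbrakk>
       \<Longrightarrow> (\<Sum>k\<in>d. norm (\<phi> (Sup k) - \<phi> (Inf k))) < e"
    using assms(1)[unfolded abs_continuous_on_def, rule_format, of e] assms(2) by auto
  have 1: "norm (\<phi> t - \<phi> s) < e" if "s \<in> {a..b}" "t \<in> {a..b}" "\<bar>t - s\<bar> < \<delta>" "s \<le> t" for s t
  proof -
    have "{{s..t}} division_of {s..t}" using division_of_self[of s t] that by auto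
    then show ?thesis using H[of "{{s..t}}"] that by auto
  qed
  have "norm (\<phi> t - \<phi> s) < e" if "s \<in> {a..b}" "t \<in> {a..b}" "\<bar>t - s\<bar> < \<delta>" for s t
    using 1[of s t] 1[of t s] that by (cases "s \<le> t") (auto simp: norm_minus_commute abs_minus_commute)
  with \<delta> that show ?thesis by blast
qed

lemma abs_continuous_imp_continuous:
  assumes "abs_continuous_on {a..b} \<phi>"
  shows "continuous_on {a..b} \<phi>"
  unfolding continuous_on_iff
proof (intro ballI allI impI)
  fix x and e :: real assume x: "x \<in> {a..b}" and e: "0 < e"
  from abs_continuous_pair[OF assms e] obtain \<delta> where "\<delta> > 0"
    "\<And>s t. \<lbrakk>s \<in> {a..b}; t \<in> {a..b}; \<bar>t - s\<bar> < \<delta>\<rbrakk> \<Longrightarrow> norm (\<phi> t - \<phi> s) < e" by blast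
  then show "\<exists>d>0. \<forall>x'\<in>{a..b}. dist x' x < d \<longrightarrow> dist (\<phi> x') (\<phi> x) < e"
    using x by (intro exI[of _ \<delta>]) (auto simp: dist_norm)
qed

text \<open>The Stieltjes measure of a monotone absolutely continuous function has no mass on Lebesgue
  null sets: these are covered by countably many non-overlapping intervals of small total length.\<close>

lemma interval_measure_null:
  fixes F :: "real \<Rightarrow> real"
  assumes mono: "\<And>x y. x \<le> y \<Longrightarrow> F x \<le> F y" and cont: "continuous_on UNIV F"
    and ac: "abs_continuous_on {a..b} F" and N: "N \<in> null_sets lborel" "N \<subseteq> {a..b}"
  shows "emeasure (interval_measure F) N = 0"
proof -
  have "emeasure (interval_measure F) N \<le> 0 + ennreal e" if e: "e > 0" for e
  proof -
    obtain \<delta> where \<delta>: "\<delta> > 0" and H: "\<And>d. \<lbrakk>d division_of \<Union>d; \<Union>d \<subseteq> {a..b}; (\<Sum>k\<in>d. Sup k - Inf k) < \<delta>\<rbrakk>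
         \<Longrightarrow> (\<Sum>k\<in>d. norm (F (Sup k) - F (Inf k))) < e"
      using ac[unfolded abs_continuous_on_def, rule_format, of e] e by auto
    have "negligible N" using N by (auto simp: negligible_iff_null_sets intro: null_sets_completionI)
    then have Nm: "N \<in> lmeasurable" "measure lebesgue N = 0"
      using negligible_imp_measurable negligible_imp_measure0 by auto
    obtain \<D> where \<D>: "countable \<D>"
        "\<And>K. K \<in> \<D> \<Longrightarrow> K \<subseteq> cbox a b \<and> K \<noteq> {} \<and> (\<exists>c d. K = cbox c d)"
        "pairwise (\<lambda>A B. interior A \<inter> interior B = {}) \<D>"
        "N \<subseteq> \<Union>\<D>" "\<Union>\<D> \<in> lmeasurable" "measure lebesgue (\<Union>\<D>) \<le> measure lebesgue N + \<delta>/2"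
      by (rule measurable_outer_intervals_bounded[OF Nm(1) N(2)[folded box_real(2)] half_gt_zero[OF \<delta>]])
        (rule that; (assumption | blast))
    have div: "d division_of \<Union>d" if d: "finite d" "d \<subseteq> \<D>" for d
    proof (intro division_ofI)
      fix K assume K: "K \<in> d"
      show "K \<subseteq> \<Union>d" using K by blast
      show "K \<noteq> {}" "\<exists>a b. K = cbox a b" using K d \<D>(2)[of K] by blast+
      show "interior K \<inter> interior K' = {}" if "K' \<in> d" "K \<noteq> K'" for K'
        using pairwiseD[OF \<D>(3), of K K'] K that d by blast
    qed (use d in auto)
    have sm: "emeasure (interval_measure F) (\<Union>d) \<le> ennreal e" if d: "finite d" "d \<subseteq> \<D>" for d
    proof -
      note dd = div[OF d]
      have sub: "\<Union>d \<subseteq> {a..b}" unfolding box_real(2)[symmetric] using d \<D>(2) by blast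
      have "(\<Sum>k\<in>d. Sup k - Inf k) = sum (measure lebesgue) d"
      proof (rule sum.cong[OF refl])
        fix k assume "k \<in> d"
        with division_cell[OF dd] obtain u v where "u \<le> v" "k = {u..v}" by metis
        then show "Sup k - Inf k = measure lebesgue k" by simp
      qed
      also have "\<dots> = measure lebesgue (\<Union>d)" using content_division[OF dd] by simp
      also have "\<dots> \<le> measure lebesgue (\<Union>\<D>)"
        using d \<D>(5) dd by (intro measure_mono_fmeasurable) (auto simp: fmeasurableD lmeasurable_division)
      also have "\<dots> < \<delta>" using \<D>(6) Nm \<delta> by simp
      finally have "(\<Sum>k\<in>d. norm (F (Sup k) - F (Inf k))) < e" using H dd sub by blast
      moreover have "emeasure (interval_measure F) k = ennreal (norm (F (Sup k) - F (Inf k)))" if k: "k \<in> d" for k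
      proof -
        obtain u v where uv: "u \<le> v" "k = {u..v}" using division_cell[OF dd k] by metis
        then show ?thesis using emeasure_interval_measure_Icc[OF uv(1) mono cont] mono[OF uv(1)] by simp
      qed
      moreover have "emeasure (interval_measure F) (\<Union>d) \<le> (\<Sum>k\<in>d. emeasure (interval_measure F) k)"
      proof -
        have "emeasure (interval_measure F) (\<Union>k\<in>d. k) \<le> (\<Sum>k\<in>d. emeasure (interval_measure F) k)"
        proof (rule emeasure_subadditive_finite)
          show "(\<lambda>k. k) ` d \<subseteq> sets (interval_measure F)"
          proof clarify
            fix k assume "k \<in> d"
            then obtain u v where "k = cbox u v" using division_ofD(4)[OF dd] by blast
            then show "k \<in> sets (interval_measure F)" by simp
          qed
        qed (rule d(1))
        then show ?thesis by simp
      qed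
      moreover have "(\<Sum>k\<in>d. ennreal (norm (F (Sup k) - F (Inf k)))) = ennreal (\<Sum>k\<in>d. norm (F (Sup k) - F (Inf k)))"
        by (rule sum_ennreal) simp
      ultimately show ?thesis by (simp cong: sum.cong) (meson ennreal_leI less_imp_le order_trans)
    qed
    show ?thesis
    proof (cases "\<D> = {}")
      case True
      then have "N = {}" using \<D>(4) by (simp only: Union_empty subset_empty)
      then show ?thesis by (simp only: emeasure_empty zero_le)
    next
      case False
      define A where "A n = \<Union>(from_nat_into \<D> ` {..n})" for n :: nat
      have fD: "from_nat_into \<D> ` {..n} \<subseteq> \<D>" for n by (rule image_subsetI) (rule from_nat_into[OF False])
      have UA: "(\<Union>n. A n) = \<Union>\<D>"
      proof -
        have "(\<Union>n. A n) = \<Union>(from_nat_into \<D> ` (\<Union>n. {..n}))" unfolding A_def by blast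
        also have "(\<Union>n::nat. {..n}) = UNIV" by blast
        finally have "(\<Union>n. A n) = \<Union>(range (from_nat_into \<D>))" .
        then show ?thesis using range_from_nat_into[OF False \<D>(1)] by simp
      qed
      have Am: "A n \<in> sets (interval_measure F)" for n
      proof -
        have *: "from_nat_into \<D> i \<in> sets (interval_measure F)" for i
        proof -
          obtain c d where "from_nat_into \<D> i = cbox c d"
            using \<D>(2)[OF from_nat_into[OF False, of i]] by (elim conjE exE)
          then show ?thesis by simp
        qed
        show ?thesis unfolding A_def by (intro sets.finite_UN finite_atMost *)
      qed
      have "emeasure (interval_measure F) N \<le> emeasure (interval_measure F) (\<Union>n. A n)"
      proof (rule emeasure_mono)
        show "N \<subseteq> (\<Union>n. A n)" unfolding UA by (rule \<D>(4))
        show "(\<Union>n. A n) \<in> sets (interval_measure F)" by (rule sets.countable_UN, rule image_subsetI, rule Am)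
      qed
      also have "\<dots> = (SUP n. emeasure (interval_measure F) (A n))"
      proof (rule SUP_emeasure_incseq[symmetric])
        show "range A \<subseteq> sets (interval_measure F)" by (rule image_subsetI, rule Am)
        show "incseq A" unfolding incseq_def A_def by (intro allI impI Union_mono image_mono) simp
      qed
      also have "\<dots> \<le> ennreal e"
        unfolding A_def by (intro SUP_least sm fD) auto
      finally show ?thesis by simp
    qed
  qed
  then have "emeasure (interval_measure F) N \<le> 0" by (rule ennreal_le_epsilon)
  then show ?thesis by simp
qed

text \<open>The derivative is the Radon-Nikodym density of the Stieltjes measure, for the extension \<open>F\<close> of \<open>V\<close> by
  constants.\<close>

lemma mono_abs_continuous_integral:
  fixes V :: "real \<Rightarrow> real"
  assumes mono: "\<And>x y. \<lbrakk>a \<le> x; x \<le> y; y \<le> b\<rbrakk> \<Longrightarrow> V x \<le> V y" and ac: "abs_continuous_on {a..b} V" and ab: "a \<le> b"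
  obtains g :: "real \<Rightarrow> real" where "set_integrable lborel {a..b} g" "\<And>t. t \<in> {a..b} \<Longrightarrow> integral {a..t} g = V t - V a"
proof -
  define F where "F t = V (max a (min b t))" for t
  have FV: "F t = V t" if "t \<in> {a..b}" for t using that by (simp add: F_def)
  have mF: "F x \<le> F y" if "x \<le> y" for x y unfolding F_def using that ab by (intro mono) auto
  have cF: "continuous_on UNIV F"
    unfolding F_def using ab
    by (intro continuous_on_compose2[OF abs_continuous_imp_continuous[OF ac]] continuous_intros) auto
  have acF: "abs_continuous_on {a..b} F"
    unfolding abs_continuous_on_def
  proof (intro allI impI)
    fix e :: real assume "e > 0"
    then obtain \<delta> where \<delta>: "\<delta> > 0" and H: "\<And>d. \<lbrakk>d division_of \<Union>d; \<Union>d \<subseteq> {a..b}; (\<Sum>k\<in>d. Sup k - Inf k) < \<delta>\<rbrakk>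
         \<Longrightarrow> (\<Sum>k\<in>d. norm (V (Sup k) - V (Inf k))) < e"
      using ac[unfolded abs_continuous_on_def, rule_format, of e] by auto
    show "\<exists>\<delta>>0. \<forall>d. d division_of \<Union> d \<and> \<Union> d \<subseteq> {a..b} \<and> (\<Sum>k\<in>d. Sup k - Inf k) < \<delta> \<longrightarrow> (\<Sum>k\<in>d. norm (F (Sup k) - F (Inf k))) < e"
    proof (intro exI[of _ \<delta>] conjI allI impI)
      fix d assume d: "d division_of \<Union> d \<and> \<Union> d \<subseteq> {a..b} \<and> (\<Sum>k\<in>d. Sup k - Inf k) < \<delta>"
      have "(\<Sum>k\<in>d. norm (F (Sup k) - F (Inf k))) = (\<Sum>k\<in>d. norm (V (Sup k) - V (Inf k)))"
      proof (rule sum.cong[OF refl])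
        fix k assume k: "k \<in> d"
        obtain u v where uv: "u \<le> v" "k = {u..v}" "Inf k = u" "Sup k = v" using division_cell[OF conjunct1[OF d] k] .
        then have "u \<in> {a..b}" "v \<in> {a..b}" using d k by (auto simp: subset_eq)
        then show "norm (F (Sup k) - F (Inf k)) = norm (V (Sup k) - V (Inf k))" using uv FV by simp
      qed
      then show "(\<Sum>k\<in>d. norm (F (Sup k) - F (Inf k))) < e" using H d by simp
    qed (rule \<delta>)
  qed
  let ?\<mu> = "interval_measure F"
  have Icc: "emeasure ?\<mu> {s..t} = F t - F s" if "s \<le> t" for s t
    using emeasure_interval_measure_Icc[OF that mF cF] .
  have lo: "{..a} \<in> null_sets ?\<mu>"
  proof -
    have "(\<Union>n::nat. {a - real n..a}) \<in> null_sets ?\<mu>"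
      by (intro null_sets_UN) (auto simp: null_sets_def Icc F_def)
    moreover have "(\<Union>n::nat. {a - real n..a}) = {..a}"
      by (auto, metis real_arch_simple diff_le_eq add.commute le_diff_eq)
    ultimately show ?thesis by simp
  qed
  have hi: "{b..} \<in> null_sets ?\<mu>"
  proof -
    have "(\<Union>n::nat. {b..b + real n}) \<in> null_sets ?\<mu>"
      by (intro null_sets_UN) (auto simp: null_sets_def Icc F_def)
    moreover have "(\<Union>n::nat. {b..b + real n}) = {b..}"
      by (auto, metis real_arch_simple diff_le_eq add.commute)
    ultimately show ?thesis by simp
  qed
  have "absolutely_continuous (lborel :: real measure) ?\<mu>"
    unfolding absolutely_continuous_def
  proof
    fix N :: "real set" assume N: "N \<in> null_sets lborel"
    then have "N \<inter> {a..b} \<in> null_sets lborel" by (intro null_set_Int2) auto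
    then have "N \<inter> {a..b} \<in> null_sets ?\<mu>"
      using interval_measure_null[OF mF cF acF, of "N \<inter> {a..b}"] by (auto simp: null_sets_def)
    then have "(N \<inter> {a..b}) \<union> ({..a} \<union> {b..}) \<in> null_sets ?\<mu>" using lo hi by auto
    then show "N \<in> null_sets ?\<mu>"
      by (rule null_sets_subset) (use N in \<open>auto simp: null_sets_def\<close>)
  qed
  from sigma_finite_measure.Radon_Nikodym[OF sigma_finite_lborel this]
  obtain f where f [measurable]: "f \<in> borel_measurable lborel" and fd: "density lborel f = ?\<mu>" by auto
  have If: "(\<integral>\<^sup>+x\<in>{a..t}. f x \<partial>lborel) = ennreal (V t - V a)" if "t \<in> {a..b}" for t
  proof -
    have "(\<integral>\<^sup>+x\<in>{a..t}. f x \<partial>lborel) = emeasure ?\<mu> {a..t}" unfolding fd[symmetric] by (simp add: emeasure_density)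
    then show ?thesis using Icc[of a t] that FV by simp
  qed
  have fin: "AE x in lborel. f x * indicator {a..b} x \<noteq> \<infinity>"
    using If[of b] ab by (intro nn_integral_PInf_AE) auto
  define g where "g x = enn2real (f x)" for x
  have g [measurable]: "g \<in> borel_measurable lborel" unfolding g_def by measurable
  have Ig: "(\<integral>\<^sup>+x\<in>{a..t}. ennreal (g x) \<partial>lborel) = ennreal (V t - V a)" if t: "t \<in> {a..b}" for t
  proof -
    have "(\<integral>\<^sup>+x\<in>{a..t}. ennreal (g x) \<partial>lborel) = (\<integral>\<^sup>+x\<in>{a..t}. f x \<partial>lborel)"
      using fin by (intro nn_integral_cong_AE, eventually_elim) (use t in \<open>auto simp: g_def indicator_def less_top split: if_splits\<close>)
    then show ?thesis using If[OF t] by simp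
  qed
  show ?thesis
  proof (rule that)
    show "set_integrable lborel {a..b} g"
      unfolding set_integrable_def
    proof (rule integrableI_nonneg)
      have "(\<integral>\<^sup>+ x. ennreal (indicator {a..b} x *\<^sub>R g x) \<partial>lborel) = (\<integral>\<^sup>+x\<in>{a..b}. ennreal (g x) \<partial>lborel)"
        by (intro nn_integral_cong) (auto simp: indicator_def)
      then show "(\<integral>\<^sup>+ x. ennreal (indicator {a..b} x *\<^sub>R g x) \<partial>lborel) < \<infinity>" using Ig[of b] ab by simp
    qed (auto simp: g_def)
    fix t assume t: "t \<in> {a..b}"
    have "(\<integral>\<^sup>+x\<in>{a..t}. ennreal (g x) \<partial>lborel) = ennreal (integral {a..t} g)"
      using Ig[OF t] by (intro set_nn_integral_lborel_eq_integral) (auto simp: set_borel_measurable_def g_def)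
    then have "ennreal (integral {a..t} g) = ennreal (V t - V a)" using Ig[OF t] by simp
    moreover have "integral {a..t} g \<ge> 0"
      by (cases "g integrable_on {a..t}") (auto intro: integral_nonneg simp: g_def not_integrable_integral)
    ultimately show "integral {a..t} g = V t - V a" using mono[of a t] t by simp
  qed
qed

lemma abs_continuous_onI_le:
  assumes "\<And>e. e > 0 \<Longrightarrow> \<exists>\<delta>>0. \<forall>d. d division_of \<Union>d \<and> \<Union>d \<subseteq> I \<and> (\<Sum>k\<in>d. Sup k - Inf k) < \<delta> \<longrightarrow>
        (\<Sum>k\<in>d. norm (\<phi> (Sup k) - \<phi> (Inf k))) \<le> e"
  shows "abs_continuous_on I \<phi>"
  unfolding abs_continuous_on_def
proof (intro allI impI)
  fix e :: real assume "e > 0"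
  then obtain \<delta> where "\<delta> > 0" "\<And>d. d division_of \<Union>d \<and> \<Union>d \<subseteq> I \<and> (\<Sum>k\<in>d. Sup k - Inf k) < \<delta> \<Longrightarrow>
        (\<Sum>k\<in>d. norm (\<phi> (Sup k) - \<phi> (Inf k))) \<le> e/2"
    using assms[of "e/2"] by auto
  with \<open>e > 0\<close> show "\<exists>\<delta>>0. \<forall>d. d division_of \<Union>d \<and> \<Union>d \<subseteq> I \<and> (\<Sum>k\<in>d. Sup k - Inf k) < \<delta> \<longrightarrow>
        (\<Sum>k\<in>d. norm (\<phi> (Sup k) - \<phi> (Inf k))) < e"
    by (intro exI[of _ \<delta>] conjI allI impI) (assumption, rule le_less_trans[of _ "e/2"], auto)
qed

text \<open>An absolutely continuous real function \<open>h\<close> is the difference of \<open>V + h\<close> and its indefinite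
  variation \<open>V\<close>, which are both monotone and absolutely continuous.\<close>

lemma abs_continuous_integral:
  fixes h :: "real \<Rightarrow> real"
  assumes ac: "abs_continuous_on {a..b} h" and ab: "a \<le> b"
  obtains g :: "real \<Rightarrow> real" where "set_integrable lborel {a..b} g" "\<And>t. t \<in> {a..b} \<Longrightarrow> integral {a..t} g = h t - h a"
proof -
  define V where "V t = enn2real (variation h a t)" for t
  have fin: "variation h s t < \<infinity>" if "a \<le> s" "s \<le> t" "t \<le> b" for s t
    using that by (intro variation_finite abs_continuous_on_subset[OF ac]) auto
  have Vd: "V t - V s = enn2real (variation h s t)" if "a \<le> s" "s \<le> t" "t \<le> b" for s t
    using variation_add[of a s t h] fin[of a s] fin[of s t] that
    by (simp add: V_def enn2real_plus)
  have jmp: "\<bar>h t - h s\<bar> \<le> V t - V s" if "a \<le> s" "s \<le> t" "t \<le> b" for s t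
  proof -
    have "ennreal \<bar>h t - h s\<bar> \<le> variation h s t" using jump_le_variation[of s t h] that by simp
    then have "enn2real (ennreal \<bar>h t - h s\<bar>) \<le> enn2real (variation h s t)"
      using fin[OF that] by (intro enn2real_mono) auto
    then show ?thesis using Vd[OF that] by simp
  qed
  have small: "\<exists>\<delta>>0. \<forall>d. d division_of \<Union>d \<and> \<Union>d \<subseteq> {a..b} \<and> (\<Sum>k\<in>d. Sup k - Inf k) < \<delta> \<longrightarrow>
        (\<Sum>k\<in>d. V (Sup k) - V (Inf k)) \<le> e" if e: "e > 0" for e
  proof -
    obtain \<delta> where \<delta>: "\<delta> > 0" "\<And>d. \<lbrakk>d division_of \<Union>d; \<Union>d \<subseteq> {a..b}; (\<Sum>k\<in>d. Sup k - Inf k) < \<delta>\<rbrakk>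
       \<Longrightarrow> (\<Sum>k\<in>d. variation h (Inf k) (Sup k)) \<le> ennreal e"
      using abs_continuous_variation[OF ac e] by blast
    show ?thesis
    proof (intro exI[of _ \<delta>] conjI allI impI)
      fix d assume d: "d division_of \<Union>d \<and> \<Union>d \<subseteq> {a..b} \<and> (\<Sum>k\<in>d. Sup k - Inf k) < \<delta>"
      have cell: "a \<le> Inf k \<and> Inf k \<le> Sup k \<and> Sup k \<le> b" if kd: "k \<in> d" for k
      proof -
        obtain u v where uv: "u \<le> v" "k = {u..v}" "Inf k = u" "Sup k = v"
          using division_cell[OF conjunct1[OF d] kd] .
        then have "u \<in> {a..b}" "v \<in> {a..b}" using d kd by (auto simp: subset_eq)
        then show ?thesis using uv by auto
      qed
      have "ennreal (\<Sum>k\<in>d. V (Sup k) - V (Inf k)) = (\<Sum>k\<in>d. ennreal (V (Sup k) - V (Inf k)))"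
        using jmp cell by (intro sum_ennreal[symmetric]) (meson abs_ge_zero order_trans)
      also have "\<dots> = (\<Sum>k\<in>d. variation h (Inf k) (Sup k))"
        
      proof (rule sum.cong[OF refl])
        fix k assume "k \<in> d"
        then show "ennreal (V (Sup k) - V (Inf k)) = variation h (Inf k) (Sup k)"
          using cell[of k] fin[of "Inf k" "Sup k"] by (simp add: Vd)
      qed
      also have "\<dots> \<le> ennreal e" using d \<delta>(2) by blast
      finally show "(\<Sum>k\<in>d. V (Sup k) - V (Inf k)) \<le> e" using e by simp
    qed (rule \<delta>)
  qed
  have acV: "abs_continuous_on {a..b} (\<lambda>t. c * V t + c' * h t)" if c: "\<bar>c\<bar> \<le> 1" "\<bar>c'\<bar> \<le> 1" for c c'
  proof (rule abs_continuous_onI_le)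
    fix e :: real assume "e > 0"
    then obtain \<delta> where \<delta>: "\<delta> > 0" "\<And>d. d division_of \<Union>d \<and> \<Union>d \<subseteq> {a..b} \<and> (\<Sum>k\<in>d. Sup k - Inf k) < \<delta> \<Longrightarrow>
        (\<Sum>k\<in>d. V (Sup k) - V (Inf k)) \<le> e/2" using small[of "e/2"] by auto
    show "\<exists>\<delta>>0. \<forall>d. d division_of \<Union>d \<and> \<Union>d \<subseteq> {a..b} \<and> (\<Sum>k\<in>d. Sup k - Inf k) < \<delta> \<longrightarrow>
        (\<Sum>k\<in>d. norm (c * V (Sup k) + c' * h (Sup k) - (c * V (Inf k) + c' * h (Inf k)))) \<le> e"
    proof (intro exI[of _ \<delta>] conjI allI impI)
      fix d assume d: "d division_of \<Union>d \<and> \<Union>d \<subseteq> {a..b} \<and> (\<Sum>k\<in>d. Sup k - Inf k) < \<delta>"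
      have "(\<Sum>k\<in>d. norm (c * V (Sup k) + c' * h (Sup k) - (c * V (Inf k) + c' * h (Inf k)))) \<le> (\<Sum>k\<in>d. 2 * (V (Sup k) - V (Inf k)))"
      proof (rule sum_mono)
        fix k assume "k \<in> d"
        then obtain u v where uv: "u \<le> v" "k = {u..v}" "Inf k = u" "Sup k = v"
          using division_cell[OF conjunct1[OF d]] by metis
        then have "u \<in> {a..b}" "v \<in> {a..b}" using d \<open>k \<in> d\<close> by (auto simp: subset_eq)
        then have j: "\<bar>h v - h u\<bar> \<le> V v - V u" using jmp[of u v] uv by auto
        have "norm (c * V v + c' * h v - (c * V u + c' * h u)) = \<bar>c * (V v - V u) + c' * (h v - h u)\<bar>"
          by (simp add: algebra_simps)
        also have "\<dots> \<le> \<bar>c\<bar> * \<bar>V v - V u\<bar> + \<bar>c'\<bar> * \<bar>h v - h u\<bar>"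
          by (metis abs_mult abs_triangle_ineq)
        also have "\<dots> \<le> 1 * \<bar>V v - V u\<bar> + 1 * \<bar>h v - h u\<bar>"
          using c by (intro add_mono mult_right_mono) auto
        also have "\<dots> \<le> 2 * (V v - V u)" using j by auto
        finally show "norm (c * V (Sup k) + c' * h (Sup k) - (c * V (Inf k) + c' * h (Inf k))) \<le> 2 * (V (Sup k) - V (Inf k))"
          using uv by simp
      qed
      also have "\<dots> \<le> e" using \<delta>(2)[OF d] unfolding sum_distrib_left[symmetric] by linarith
      finally show "(\<Sum>k\<in>d. norm (c * V (Sup k) + c' * h (Sup k) - (c * V (Inf k) + c' * h (Inf k)))) \<le> e" .
    qed (rule \<delta>)
  qed
  have "V x \<le> V y" if "a \<le> x" "x \<le> y" "y \<le> b" for x y using jmp[OF that] by linarith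
  moreover have "abs_continuous_on {a..b} V" using acV[of 1 0] by simp
  ultimately obtain g1 where g1: "set_integrable lborel {a..b} g1" "\<And>t. t \<in> {a..b} \<Longrightarrow> integral {a..t} g1 = V t - V a"
    using mono_abs_continuous_integral[of a b V] ab by blast
  have "V x + h x \<le> V y + h y" if "a \<le> x" "x \<le> y" "y \<le> b" for x y using jmp[OF that] by linarith
  moreover have "abs_continuous_on {a..b} (\<lambda>t. V t + h t)" using acV[of 1 1] by simp
  ultimately obtain g2 where g2: "set_integrable lborel {a..b} g2" "\<And>t. t \<in> {a..b} \<Longrightarrow> integral {a..t} g2 = (V t + h t) - (V a + h a)"
    using mono_abs_continuous_integral[of a b "\<lambda>t. V t + h t"] ab by blast
  show ?thesis
  proof (rule that)
    show "set_integrable lborel {a..b} (\<lambda>t. g2 t - g1 t)" using g1(1) g2(1) by (rule set_integral_diff(1)[rotated])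
    fix t assume t: "t \<in> {a..b}"
    have "set_integrable lborel {a..t} g1" "set_integrable lborel {a..t} g2"
      using t by (auto intro!: set_integrable_subset[OF g1(1)] set_integrable_subset[OF g2(1)])
    then have "g1 integrable_on {a..t}" "g2 integrable_on {a..t}" using set_borel_integral_eq_integral(1) by blast+
    then show "integral {a..t} (\<lambda>t. g2 t - g1 t) = h t - h a"
      using g1(2)[OF t] g2(2)[OF t] by (simp add: integral_diff)
  qed
qed

text \<open>One-sided Lebesgue differentiation, applied to \<open>g\<close> and to its reflection.\<close>

lemma integral_has_derivative_ae:
  fixes g h :: "real \<Rightarrow> real"
  assumes g: "g integrable_on {a..b}" and h: "\<And>t. t \<in> {a..b} \<Longrightarrow> integral {a..t} g = h t - h a"
  obtains N where "negligible N" "\<And>t. \<lbrakk>t \<in> {a<..<b}; t \<notin> N\<rbrakk> \<Longrightarrow> (h has_real_derivative g t) (at t)"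
proof -
  define g0 where "g0 t = (if t \<in> {a..b} then g t else 0)" for t
  have g0U: "g0 integrable_on UNIV" 
    using g integrable_restrict_UNIV[of "{a..b}" g] by (simp add: g0_def[abs_def] del: atLeastAtMost_iff)
  then have g0: "g0 integrable_on cbox c d" for c d by (rule integrable_on_subcbox) auto
  have g0r: "(\<lambda>t. g0 (- t)) integrable_on cbox c d" for c d :: real
    using g0[of "-d" "-c"] Henstock_Kurzweil_Integration.integrable_reflect_real[where f = g0 and a = "-d" and b = "-c"] by simp
  obtain N1 where N1: "negligible N1" "\<And>x e. \<lbrakk>x \<notin> N1; 0 < e\<rbrakk> \<Longrightarrow>
      \<exists>d>0. \<forall>k. 0 < k \<and> k < d \<longrightarrow> norm (integral (cbox x (x + k *\<^sub>R One)) g0 /\<^sub>R k ^ DIM(real) - g0 x) < e"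
    using integrable_ccontinuous_explicit[of g0] g0 by blast
  obtain N2 where N2: "negligible N2" "\<And>x e. \<lbrakk>x \<notin> N2; 0 < e\<rbrakk> \<Longrightarrow>
      \<exists>d>0. \<forall>k. 0 < k \<and> k < d \<longrightarrow> norm (integral (cbox x (x + k *\<^sub>R One)) (\<lambda>t. g0 (- t)) /\<^sub>R k ^ DIM(real) - g0 (- x)) < e"
    using integrable_ccontinuous_explicit[of "\<lambda>t. g0 (- t)"] g0r by blast
  have hd: "integral {s..t} g0 = h t - h s" if st: "a \<le> s" "s \<le> t" "t \<le> b" for s t
  proof -
    have "integral {s..t} g0 = integral {s..t} g" using st by (intro integral_cong) (auto simp: g0_def)
    moreover have "integral {a..s} g + integral {s..t} g = integral {a..t} g"
      using st by (intro Henstock_Kurzweil_Integration.integral_combine integrable_on_subinterval[OF g]) auto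
    ultimately show ?thesis using h[of s] h[of t] st by auto
  qed
  show ?thesis
  proof (rule that[of "N1 \<union> uminus ` N2"])
    have "negligible (uminus ` N2)"
      by (rule negligible_differentiable_image_negligible[OF order_refl N2(1)]) (auto intro!: derivative_intros)
    then show "negligible (N1 \<union> uminus ` N2)" using N1(1) by auto
    fix t assume t: "t \<in> {a<..<b}" "t \<notin> N1 \<union> uminus ` N2"
    then have tn: "t \<notin> N1" "- t \<notin> N2" by force+
    have gt: "g0 t = g t" using t by (simp add: g0_def)
    show "(h has_real_derivative g t) (at t)"
      unfolding DERIV_def LIM_def
    proof (intro allI impI)
      fix e :: real assume e: "e > 0"
      obtain d1 where d1: "d1 > 0" "\<And>k. 0 < k \<Longrightarrow> k < d1 \<Longrightarrow> \<bar>integral {t..t + k} g0 / k - g t\<bar> < e"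
        using N1(2)[OF tn(1) e] gt by (auto simp: divide_inverse mult.commute)
      obtain d2 where d2: "d2 > 0" "\<And>k. 0 < k \<Longrightarrow> k < d2 \<Longrightarrow> \<bar>integral {-t..-t + k} (\<lambda>t. g0 (- t)) / k - g t\<bar> < e"
        using N2(2)[OF tn(2) e] gt by (auto simp: divide_inverse mult.commute)
      define d where "d = min (min d1 d2) (min (t - a) (b - t))"
      have "d > 0" using t d1 d2 by (auto simp: d_def)
      moreover have "\<bar>(h (t + k) - h t) / k - g t\<bar> < e" if k: "k \<noteq> 0" "\<bar>k\<bar> < d" for k
      proof (cases "k > 0")
        case True
        then show ?thesis using d1(2)[of k] hd[of t "t + k"] k t by (auto simp: d_def)
      next
        case False
        then have k0: "- k > 0" "- k < d2" using k by (auto simp: d_def)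
        have tk: "- t + - k = - (t + k)" by simp
        have "integral {-t..-t + - k} (\<lambda>t. g0 (- t)) = integral {t + k..t} g0"
          unfolding tk by (rule Henstock_Kurzweil_Integration.integral_reflect_real)
        also have "\<dots> = h t - h (t + k)" using hd[of "t + k" t] k t k0 by (auto simp: d_def)
        finally have "\<bar>(h t - h (t + k)) / (- k) - g t\<bar> < e" using d2(2)[OF k0] by (simp only:)
        then show ?thesis by (metis minus_diff_eq minus_divide_divide minus_minus)
      qed
      ultimately show "\<exists>d>0. \<forall>x. x \<noteq> 0 \<and> dist x 0 < d \<longrightarrow> dist ((h (t + x) - h t) / x) (g t) < e"
        by (auto simp: dist_real_def)
    qed
  qed
qed

lemma AE_not_negligible: "negligible N \<Longrightarrow> AE x in lborel. x \<notin> N"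
  by (rule iffD1[OF AE_completion_iff], rule AE_not_in) (simp only: negligible_iff_null_sets)

text \<open>One half of the fundamental theorem of calculus.  The upper bound \<open>\<Lambda>\<close> for the derivative need not be
  measurable.\<close>

lemma abs_continuous_integral_bound:
  fixes h :: "real \<Rightarrow> real" and \<Lambda> :: "real \<Rightarrow> ennreal"
  assumes ac: "abs_continuous_on {a..b} h" and ab: "a \<le> b" and N: "negligible N"
    and bound: "\<And>t D. \<lbrakk>t \<in> {a<..<b}; t \<notin> N; (h has_real_derivative D) (at t)\<rbrakk> \<Longrightarrow> ennreal D \<le> \<Lambda> t"
  shows "ennreal (h b - h a) \<le> (\<integral>\<^sup>+t\<in>{a..b}. \<Lambda> t \<partial>lborel)"
proof -
  obtain g where g: "set_integrable lborel {a..b} g" "\<And>t. t \<in> {a..b} \<Longrightarrow> integral {a..t} g = h t - h a"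
    using abs_continuous_integral[OF ac ab] by blast
  have gi: "g integrable_on {a..b}" using g(1) set_borel_integral_eq_integral(1) by blast
  obtain N' where N': "negligible N'" "\<And>t. \<lbrakk>t \<in> {a<..<b}; t \<notin> N'\<rbrakk> \<Longrightarrow> (h has_real_derivative g t) (at t)"
    using integral_has_derivative_ae[OF gi g(2)] by blast
  have int: "integrable lborel (\<lambda>x. indicator {a..b} x *\<^sub>R g x)" using g(1) by (simp add: set_integrable_def)
  have "h b - h a = (LINT x|lborel. indicator {a..b} x *\<^sub>R g x)"
    using g(2)[of b] ab set_borel_integral_eq_integral(2)[OF g(1)] by (simp add: set_lebesgue_integral_def)
  also have "\<dots> \<le> (LINT x|lborel. max 0 (indicator {a..b} x *\<^sub>R g x))"
    using int by (intro integral_mono) auto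
  finally have "ennreal (h b - h a) \<le> ennreal (LINT x|lborel. max 0 (indicator {a..b} x *\<^sub>R g x))"
    by (rule ennreal_leI)
  also have "\<dots> = (\<integral>\<^sup>+x. ennreal (max 0 (indicator {a..b} x *\<^sub>R g x)) \<partial>lborel)"
    using int by (intro nn_integral_eq_integral[symmetric]) auto
  also have "\<dots> \<le> (\<integral>\<^sup>+t\<in>{a..b}. \<Lambda> t \<partial>lborel)"
  proof (rule nn_integral_mono_AE)
    have "AE t in lborel. t \<notin> N \<union> N' \<union> {a, b}" using N N' by (intro AE_not_negligible) auto
    then show "AE t in lborel. ennreal (max 0 (indicator {a..b} t *\<^sub>R g t)) \<le> \<Lambda> t * indicator {a..b} t"
    proof eventually_elim
      case (elim t)
      then show ?case using bound[OF _ _ N'(2)[of t], of] by (auto simp: indicator_def ennreal_max_0)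
    qed
  qed
  finally show ?thesis .
qed

lemma abs_continuous_on_bound:
  assumes ac: "abs_continuous_on {a..b} \<phi>"
    and le: "\<And>s t. \<lbrakk>s \<in> {a..b}; t \<in> {a..b}\<rbrakk> \<Longrightarrow> norm (h t - h s) \<le> C * norm (\<phi> t - \<phi> s)"
  shows "abs_continuous_on {a..b} h"
proof (rule abs_continuous_onI_le)
  fix e :: real assume e: "e > 0"
  define C' where "C' = \<bar>C\<bar> + 1"
  have C': "C' > 0" "C \<le> C'" by (auto simp: C'_def)
  obtain \<delta> where \<delta>: "\<delta> > 0" "\<And>d. d division_of \<Union>d \<and> \<Union>d \<subseteq> {a..b} \<and> (\<Sum>k\<in>d. Sup k - Inf k) < \<delta> \<Longrightarrow>
        (\<Sum>k\<in>d. norm (\<phi> (Sup k) - \<phi> (Inf k))) < e / C'"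
    using ac[unfolded abs_continuous_on_def, rule_format, of "e / C'"] e C' by auto
  show "\<exists>\<delta>>0. \<forall>d. d division_of \<Union>d \<and> \<Union>d \<subseteq> {a..b} \<and> (\<Sum>k\<in>d. Sup k - Inf k) < \<delta> \<longrightarrow>
        (\<Sum>k\<in>d. norm (h (Sup k) - h (Inf k))) \<le> e"
  proof (intro exI[of _ \<delta>] conjI allI impI)
    fix d assume d: "d division_of \<Union>d \<and> \<Union>d \<subseteq> {a..b} \<and> (\<Sum>k\<in>d. Sup k - Inf k) < \<delta>"
    have "(\<Sum>k\<in>d. norm (h (Sup k) - h (Inf k))) \<le> (\<Sum>k\<in>d. C' * norm (\<phi> (Sup k) - \<phi> (Inf k)))"
    proof (rule sum_mono)
      fix k assume "k \<in> d"
      then obtain u v where uv: "u \<le> v" "k = {u..v}" "Inf k = u" "Sup k = v"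
        using division_cell[OF conjunct1[OF d]] by metis
      then have "u \<in> {a..b}" "v \<in> {a..b}" using d \<open>k \<in> d\<close> by (auto simp: subset_eq)
      then have "norm (h v - h u) \<le> C * norm (\<phi> v - \<phi> u)" using le by auto
      also have "\<dots> \<le> C' * norm (\<phi> v - \<phi> u)" using C' by (intro mult_right_mono) auto
      finally show "norm (h (Sup k) - h (Inf k)) \<le> C' * norm (\<phi> (Sup k) - \<phi> (Inf k))" using uv by simp
    qed
    also have "\<dots> \<le> e" using \<delta>(2)[OF d] C' by (simp add: sum_distrib_left[symmetric] field_simps)
    finally show "(\<Sum>k\<in>d. norm (h (Sup k) - h (Inf k))) \<le> e" .
  qed (rule \<delta>)
qed

lemma lipschitz_abs_continuous:
  assumes "\<And>s t. \<lbrakk>s \<in> {a..b}; t \<in> {a..b}\<rbrakk> \<Longrightarrow> norm (h t - h s) \<le> C * \<bar>t - s\<bar>"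
  shows "abs_continuous_on {a..b} h"
proof -
  have "abs_continuous_on {a..b} (\<lambda>t::real. t)"
  proof (rule abs_continuous_onI_le)
    fix e :: real assume e: "e > 0"
    show "\<exists>\<delta>>0. \<forall>d. d division_of \<Union>d \<and> \<Union>d \<subseteq> {a..b} \<and> (\<Sum>k\<in>d. Sup k - Inf k) < \<delta> \<longrightarrow>
        (\<Sum>k\<in>d. norm (Sup k - Inf k)) \<le> e"
    proof (intro exI[of _ e] conjI allI impI)
      fix d assume d: "d division_of \<Union>d \<and> \<Union>d \<subseteq> {a..b} \<and> (\<Sum>k\<in>d. Sup k - Inf k) < e"
      have "(\<Sum>k\<in>d. norm (Sup k - Inf k)) = (\<Sum>k\<in>d. Sup k - Inf k)"
        by (rule sum.cong[OF refl]) (metis division_cell[OF conjunct1[OF d]] abs_of_nonneg diff_ge_0_iff_ge real_norm_def)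
      then show "(\<Sum>k\<in>d. norm (Sup k - Inf k)) \<le> e" using d by simp
    qed (rule e)
  qed
  then show ?thesis by (rule abs_continuous_on_bound[where C = C]) (use assms in auto)
qed

lemma abs_continuous_differentiable_ae:
  fixes \<phi> :: "real \<Rightarrow> 'a::euclidean_space"
  assumes ac: "abs_continuous_on {a..b} \<phi>" and ab: "a \<le> b"
  obtains N where "negligible N" "\<And>t. \<lbrakk>t \<in> {a<..<b}; t \<notin> N\<rbrakk> \<Longrightarrow> (\<phi> has_vector_derivative vector_derivative \<phi> (at t)) (at t)"
proof -
  have "\<exists>N. negligible N \<and> (\<forall>t\<in>{a<..<b} - N. \<exists>D. ((\<lambda>t. \<phi> t \<bullet> i) has_real_derivative D) (at t))" if i: "i \<in> Basis" for i
  proof -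
    have "abs_continuous_on {a..b} (\<lambda>t. \<phi> t \<bullet> i)"
      using ac by (rule abs_continuous_on_bound[where C = 1])
        (use i in \<open>auto simp: inner_diff_left[symmetric] intro!: Basis_le_norm\<close>)
    then obtain g where g: "set_integrable lborel {a..b} g" "\<And>t. t \<in> {a..b} \<Longrightarrow> integral {a..t} g = \<phi> t \<bullet> i - \<phi> a \<bullet> i"
      using abs_continuous_integral[OF _ ab] by blast
    have gi: "g integrable_on {a..b}" using g(1) set_borel_integral_eq_integral(1) by blast
    obtain N' where N': "negligible N'" "\<And>t. \<lbrakk>t \<in> {a<..<b}; t \<notin> N'\<rbrakk> \<Longrightarrow> ((\<lambda>t. \<phi> t \<bullet> i) has_real_derivative g t) (at t)"
      using integral_has_derivative_ae[OF gi, of "\<lambda>t. \<phi> t \<bullet> i"] g(2) by blast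
    then show ?thesis by (intro exI[of _ N']) blast
  qed
  then obtain N where N: "\<And>i. i \<in> Basis \<Longrightarrow> negligible (N i)"
     "\<And>i t. i \<in> Basis \<Longrightarrow> t \<in> {a<..<b} - N i \<Longrightarrow> \<exists>D. ((\<lambda>t. \<phi> t \<bullet> i) has_real_derivative D) (at t)"
    by metis
  show ?thesis
  proof (rule that[of "\<Union>i\<in>Basis. N i"])
    show "negligible (\<Union>i\<in>Basis. N i)" using N(1) by (intro negligible_Union) auto
    fix t assume "t \<in> {a<..<b}" "t \<notin> (\<Union>i\<in>Basis. N i)"
    then have "\<forall>i\<in>Basis. \<exists>D. ((\<lambda>t. \<phi> t \<bullet> i) has_real_derivative D) (at t)" using N(2) by blast
    then have "\<forall>i\<in>Basis. (\<lambda>t. \<phi> t \<bullet> i) differentiable (at t)" using real_differentiable_def by blast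
    then have "\<phi> differentiable (at t)" by (subst differentiable_componentwise_within)
    then show "(\<phi> has_vector_derivative vector_derivative \<phi> (at t)) (at t)" by (simp add: vector_derivative_works)
  qed
qed

section \<open>Frechet equivalence of parameterizations\<close>

lemma time_changesD:
  assumes "\<alpha> \<in> time_changes T"
  shows "continuous_on {0..1} \<alpha>" "mono_on {0..1} \<alpha>" "\<alpha> ` {0..1} = {0..T}"
    "\<And>s. s \<in> {0..1} \<Longrightarrow> \<alpha> s \<in> {0..T}"
  using assms by (auto simp: time_changes_def)

lemma time_change_ends:
  assumes "\<alpha> \<in> time_changes T" "T > 0"
  shows "\<alpha> 0 = 0" "\<alpha> 1 = T"
proof -
  note t = time_changesD[OF assms(1)]
  have "0 \<in> \<alpha> ` {0..1}" "T \<in> \<alpha> ` {0..1}" unfolding t(3) using assms(2) by auto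
  then obtain s s' where s: "s \<in> {0..1}" "\<alpha> s = 0" "s' \<in> {0..1}" "\<alpha> s' = T" by (metis imageE)
  have "\<alpha> 0 \<le> \<alpha> s" "\<alpha> s' \<le> \<alpha> 1" by (rule mono_onD[OF t(2)]; use s in simp)+
  moreover have "\<alpha> 0 \<in> {0..T}" "\<alpha> 1 \<in> {0..T}" by (rule t(4), simp)+
  ultimately show "\<alpha> 0 = 0" "\<alpha> 1 = T" using s by auto
qed

lemma time_changesI:
  assumes "continuous_on {0..1} \<alpha>" "mono_on {0..1} \<alpha>" "\<alpha> 0 = 0" "\<alpha> 1 = T"
  shows "\<alpha> \<in> time_changes T"
proof -
  have "{0..T} \<subseteq> \<alpha> ` {0..1}"
  proof
    fix y assume "y \<in> {0..T}"
    then have "\<exists>x\<ge>0. x \<le> 1 \<and> \<alpha> x = y" using assms by (intro IVT') auto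
    then show "y \<in> \<alpha> ` {0..1}" by auto
  qed
  moreover have "\<alpha> ` {0..1} \<subseteq> {0..T}"
    using mono_onD[OF assms(2), of 0] mono_onD[OF assms(2), of _ 1] assms(3,4) by fastforce
  ultimately show ?thesis using assms by (auto simp: time_changes_def)
qed

lemma scaling_time_change: "T > 0 \<Longrightarrow> (\<lambda>s. T * s) \<in> time_changes T"
  by (rule time_changesI) (auto intro!: continuous_intros mono_onI)

lemma frechet_sup_bounded:
  assumes "(T\<^sub>1, \<phi>\<^sub>1) \<in> params D" "(T\<^sub>2, \<phi>\<^sub>2) \<in> params D'" "\<alpha> \<in> time_changes T\<^sub>1" "\<beta> \<in> time_changes T\<^sub>2"
  shows "bdd_above ((\<lambda>s. dist (\<phi>\<^sub>1 (\<alpha> s)) (\<phi>\<^sub>2 (\<beta> s))) ` {0..1})"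
proof -
  have "continuous_on {0..1} (\<lambda>s. dist (\<phi>\<^sub>1 (\<alpha> s)) (\<phi>\<^sub>2 (\<beta> s)))"
    using assms time_changesD[OF assms(3)] time_changesD[OF assms(4)]
    by (intro continuous_on_dist continuous_on_compose2[of "{0..T\<^sub>1}" \<phi>\<^sub>1 _ \<alpha>] continuous_on_compose2[of "{0..T\<^sub>2}" \<phi>\<^sub>2 _ \<beta>])
       (auto simp: params_def)
  then have "compact ((\<lambda>s. dist (\<phi>\<^sub>1 (\<alpha> s)) (\<phi>\<^sub>2 (\<beta> s))) ` {0..1})"
    by (rule compact_continuous_image) simp
  then show ?thesis by (intro bounded_imp_bdd_above compact_imp_bounded)
qed

lemma frechet_dist_zeroD:
  assumes p: "(T\<^sub>1, \<phi>\<^sub>1) \<in> params D" "(T\<^sub>2, \<phi>\<^sub>2) \<in> params D'"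
    and 0: "frechet_dist (T\<^sub>1, \<phi>\<^sub>1) (T\<^sub>2, \<phi>\<^sub>2) = 0" and e: "e > 0"
  obtains \<alpha> \<beta> where "\<alpha> \<in> time_changes T\<^sub>1" "\<beta> \<in> time_changes T\<^sub>2"
    "\<And>s. s \<in> {0..1} \<Longrightarrow> dist (\<phi>\<^sub>1 (\<alpha> s)) (\<phi>\<^sub>2 (\<beta> s)) < e"
proof -
  let ?F = "\<lambda>(\<alpha>, \<beta>). SUP s\<in>{0..1::real}. dist (\<phi>\<^sub>1 (\<alpha> s)) (\<phi>\<^sub>2 (\<beta> s))"
  have "(\<lambda>s. T\<^sub>1 * s) \<in> time_changes T\<^sub>1" "(\<lambda>s. T\<^sub>2 * s) \<in> time_changes T\<^sub>2"
    using p by (auto simp: params_def intro: scaling_time_change)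
  then have ne: "?F ` (time_changes T\<^sub>1 \<times> time_changes T\<^sub>2) \<noteq> {}" by auto
  have "Inf (?F ` (time_changes T\<^sub>1 \<times> time_changes T\<^sub>2)) < e"
    using 0 e by (simp add: frechet_dist_def)
  from cInf_lessD[OF ne this] obtain \<alpha> \<beta> where ab: "\<alpha> \<in> time_changes T\<^sub>1" "\<beta> \<in> time_changes T\<^sub>2"
    "(SUP s\<in>{0..1::real}. dist (\<phi>\<^sub>1 (\<alpha> s)) (\<phi>\<^sub>2 (\<beta> s))) < e" by auto
  show ?thesis
  proof (rule that[OF ab(1,2)])
    fix s :: real assume "s \<in> {0..1}"
    then have "dist (\<phi>\<^sub>1 (\<alpha> s)) (\<phi>\<^sub>2 (\<beta> s)) \<le> (SUP s\<in>{0..1::real}. dist (\<phi>\<^sub>1 (\<alpha> s)) (\<phi>\<^sub>2 (\<beta> s)))"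
      by (intro cSUP_upper frechet_sup_bounded[OF p ab(1,2)])
    then show "dist (\<phi>\<^sub>1 (\<alpha> s)) (\<phi>\<^sub>2 (\<beta> s)) < e" using ab(3) by linarith
  qed
qed

lemma frechet_dist_zeroI:
  assumes p: "(T\<^sub>1, \<phi>\<^sub>1) \<in> params D" "(T\<^sub>2, \<phi>\<^sub>2) \<in> params D'"
    and ex: "\<And>e. e > 0 \<Longrightarrow> \<exists>\<alpha>\<in>time_changes T\<^sub>1. \<exists>\<beta>\<in>time_changes T\<^sub>2. \<forall>s\<in>{0..1}. dist (\<phi>\<^sub>1 (\<alpha> s)) (\<phi>\<^sub>2 (\<beta> s)) \<le> e"
  shows "frechet_dist (T\<^sub>1, \<phi>\<^sub>1) (T\<^sub>2, \<phi>\<^sub>2) = 0"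
proof -
  let ?F = "\<lambda>(\<alpha>, \<beta>). SUP s\<in>{0..1::real}. dist (\<phi>\<^sub>1 (\<alpha> s)) (\<phi>\<^sub>2 (\<beta> s))"
  let ?A = "time_changes T\<^sub>1 \<times> time_changes T\<^sub>2"
  have "(\<lambda>s. T\<^sub>1 * s) \<in> time_changes T\<^sub>1" "(\<lambda>s. T\<^sub>2 * s) \<in> time_changes T\<^sub>2"
    using p by (auto simp: params_def intro: scaling_time_change)
  then have ne: "?A \<noteq> {}" by auto
  have nn: "0 \<le> ?F x" if "x \<in> ?A" for x
  proof -
    obtain \<alpha> \<beta> where x: "x = (\<alpha>, \<beta>)" "\<alpha> \<in> time_changes T\<^sub>1" "\<beta> \<in> time_changes T\<^sub>2"
      using \<open>x \<in> ?A\<close> by (metis mem_Sigma_iff prod.exhaust)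
    have "0 \<le> dist (\<phi>\<^sub>1 (\<alpha> 0)) (\<phi>\<^sub>2 (\<beta> 0))" by simp
    also have "\<dots> \<le> (SUP s\<in>{0..1::real}. dist (\<phi>\<^sub>1 (\<alpha> s)) (\<phi>\<^sub>2 (\<beta> s)))"
      by (intro cSUP_upper frechet_sup_bounded[OF p x(2,3)]) simp
    finally show ?thesis using x by simp
  qed
  have bdd: "bdd_below (?F ` ?A)" using nn by (intro bdd_belowI2[of _ 0]) auto
  have "Inf (?F ` ?A) \<le> 0"
  proof (rule field_le_epsilon)
    fix e :: real assume "e > 0"
    then obtain \<alpha> \<beta> where ab: "\<alpha> \<in> time_changes T\<^sub>1" "\<beta> \<in> time_changes T\<^sub>2"
      "\<forall>s\<in>{0..1}. dist (\<phi>\<^sub>1 (\<alpha> s)) (\<phi>\<^sub>2 (\<beta> s)) \<le> e" using ex by blast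
    have "Inf (?F ` ?A) \<le> ?F (\<alpha>, \<beta>)" using ab by (intro cINF_lower bdd) auto
    also have "\<dots> \<le> e" using ab by (auto intro!: cSUP_least)
    finally show "Inf (?F ` ?A) \<le> 0 + e" by simp
  qed
  moreover have "0 \<le> Inf (?F ` ?A)" by (rule cINF_greatest[OF ne nn])
  ultimately show ?thesis by (simp add: frechet_dist_def)
qed

lemma frechet_ends:
  assumes p: "(T\<^sub>1, \<phi>\<^sub>1) \<in> params D" "(T\<^sub>2, \<phi>\<^sub>2) \<in> params D'"
    and 0: "frechet_dist (T\<^sub>1, \<phi>\<^sub>1) (T\<^sub>2, \<phi>\<^sub>2) = 0"
  shows "\<phi>\<^sub>2 0 = \<phi>\<^sub>1 0" "\<phi>\<^sub>2 T\<^sub>2 = \<phi>\<^sub>1 T\<^sub>1"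
proof -
  have T: "T\<^sub>1 > 0" "T\<^sub>2 > 0" using p by (auto simp: params_def)
  have "dist (\<phi>\<^sub>1 0) (\<phi>\<^sub>2 0) < e \<and> dist (\<phi>\<^sub>1 T\<^sub>1) (\<phi>\<^sub>2 T\<^sub>2) < e" if "e > 0" for e
  proof -
    obtain \<alpha> \<beta> where "\<alpha> \<in> time_changes T\<^sub>1" "\<beta> \<in> time_changes T\<^sub>2"
      and d: "\<And>s. s \<in> {0..1} \<Longrightarrow> dist (\<phi>\<^sub>1 (\<alpha> s)) (\<phi>\<^sub>2 (\<beta> s)) < e"
      using frechet_dist_zeroD[OF p 0 \<open>e > 0\<close>] by blast
    then show ?thesis using d[of 0] d[of 1] T by (simp add: time_change_ends)
  qed
  then have "dist (\<phi>\<^sub>1 0) (\<phi>\<^sub>2 0) \<le> 0" "dist (\<phi>\<^sub>1 T\<^sub>1) (\<phi>\<^sub>2 T\<^sub>2) \<le> 0"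
    by (meson dense_ge less_imp_le)+
  then show "\<phi>\<^sub>2 0 = \<phi>\<^sub>1 0" "\<phi>\<^sub>2 T\<^sub>2 = \<phi>\<^sub>1 T\<^sub>1" by auto
qed

lemma frechet_image:
  assumes p: "(T\<^sub>1, \<phi>\<^sub>1) \<in> params D" "(T\<^sub>2, \<phi>\<^sub>2) \<in> params D'"
    and 0: "frechet_dist (T\<^sub>1, \<phi>\<^sub>1) (T\<^sub>2, \<phi>\<^sub>2) = 0"
  shows "\<phi>\<^sub>2 ` {0..T\<^sub>2} \<subseteq> \<phi>\<^sub>1 ` {0..T\<^sub>1}"
proof
  fix y assume "y \<in> \<phi>\<^sub>2 ` {0..T\<^sub>2}"
  then obtain t where t: "t \<in> {0..T\<^sub>2}" "y = \<phi>\<^sub>2 t" by auto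
  have "compact (\<phi>\<^sub>1 ` {0..T\<^sub>1})" using p(1) by (intro compact_continuous_image) (auto simp: params_def)
  then have cl: "closed (\<phi>\<^sub>1 ` {0..T\<^sub>1})" by (rule compact_imp_closed)
  have "\<exists>x\<in>\<phi>\<^sub>1 ` {0..T\<^sub>1}. dist x y < e" if "e > 0" for e
  proof -
    obtain \<alpha> \<beta> where ab: "\<alpha> \<in> time_changes T\<^sub>1" "\<beta> \<in> time_changes T\<^sub>2"
      and d: "\<And>s. s \<in> {0..1} \<Longrightarrow> dist (\<phi>\<^sub>1 (\<alpha> s)) (\<phi>\<^sub>2 (\<beta> s)) < e"
      using frechet_dist_zeroD[OF p 0 \<open>e > 0\<close>] by blast
    from time_changesD(3)[OF ab(2)] t(1) obtain s where "s \<in> {0..1}" "\<beta> s = t" by (metis imageE)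
    then show ?thesis using d[of s] t(2) time_changesD(4)[OF ab(1), of s] by auto
  qed
  then have "y \<in> closure (\<phi>\<^sub>1 ` {0..T\<^sub>1})" by (auto simp: closure_approachable)
  then show "y \<in> \<phi>\<^sub>1 ` {0..T\<^sub>1}" using cl by simp
qed

lemma division_telescope:
  fixes G :: "real \<Rightarrow> real"
  assumes d: "d division_of {a..b}" and ab: "a \<le> b"
  shows "(\<Sum>k\<in>d. G (Sup k) - G (Inf k)) = G b - G a"
proof -
  define p where "p = (\<lambda>k. (Inf k, k)) ` d"
  have "p tagged_division_of cbox a b"
    unfolding p_def
  proof (rule tagged_division_ofI)
    show "finite ((\<lambda>k. (Inf k, k)) ` d)" using d by (auto dest: division_of_finite)
    fix x k assume xk: "(x, k) \<in> (\<lambda>k. (Inf k, k)) ` d"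
    then have k: "k \<in> d" "x = Inf k" by auto
    obtain u v where uv: "u \<le> v" "k = {u..v}" "Inf k = u" using division_cell[OF d k(1)] by metis
    show "x \<in> k" using uv k by auto
    show "k \<subseteq> cbox a b" using division_ofD(2)[OF d k(1)] by simp
    show "\<exists>a b. k = cbox a b" using uv by (metis box_real(2))
    fix x' k' assume "(x', k') \<in> (\<lambda>k. (Inf k, k)) ` d" "(x, k) \<noteq> (x', k')"
    then show "interior k \<inter> interior k' = {}" using k division_ofD(5)[OF d] by auto
  next
    show "\<Union>{k. \<exists>x. (x, k) \<in> (\<lambda>k. (Inf k, k)) ` d} = cbox a b"
      using division_ofD(6)[OF d] by (auto simp: image_iff)
  qed
  from additive_tagged_division_1[OF ab, of p G] this
  have "(\<Sum>(x,k)\<in>p. G (Sup k) - G (Inf k)) = G b - G a" by simp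
  moreover have "(\<Sum>(x,k)\<in>p. G (Sup k) - G (Inf k)) = (\<Sum>k\<in>d. G (Sup k) - G (Inf k))"
    unfolding p_def by (subst sum.reindex) (auto simp: inj_on_def)
  ultimately show ?thesis by simp
qed

lemma variation_reparam_le:
  fixes m :: "real \<Rightarrow> real"
  assumes d: "d division_of {a..b}" and ab: "a \<le> b" and m: "mono_on {a..b} m"
    and fin: "variation \<phi> (m a) (m b) < \<infinity>"
  shows "(\<Sum>k\<in>d. norm (\<phi> (m (Sup k)) - \<phi> (m (Inf k)))) \<le> enn2real (variation \<phi> (m a) (m b))"
proof -
  have mm: "m a \<le> m u" "m u \<le> m v" "m v \<le> m b" if "a \<le> u" "u \<le> v" "v \<le> b" for u v
    by (rule mono_onD[OF m]; use that ab in auto)+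
  define G where "G t = enn2real (variation \<phi> (m a) (m t))" for t
  have "(\<Sum>k\<in>d. norm (\<phi> (m (Sup k)) - \<phi> (m (Inf k)))) \<le> (\<Sum>k\<in>d. G (Sup k) - G (Inf k))"
  proof (rule sum_mono)
    fix k assume k: "k \<in> d"
    then obtain u v where uv: "u \<le> v" "k = {u..v}" "Inf k = u" "Sup k = v" using division_cell[OF d] by metis
    then have ab': "a \<le> u" "v \<le> b" using division_ofD(2)[OF d k] by auto
    note mu = mm[OF ab'(1) uv(1) ab'(2)]
    have eq: "variation \<phi> (m a) (m v) = variation \<phi> (m a) (m u) + variation \<phi> (m u) (m v)"
      using variation_add mu by blast
    have f: "variation \<phi> (m a) (m v) < \<infinity>"
      using variation_mono[of "m a" "m a" "m v" "m b" \<phi>] mu fin by (auto intro: le_less_trans)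
    then have f1: "variation \<phi> (m a) (m u) < top" "variation \<phi> (m u) (m v) < top" using eq by auto
    have "enn2real (ennreal (norm (\<phi> (m v) - \<phi> (m u)))) \<le> enn2real (variation \<phi> (m u) (m v))"
      using jump_le_variation[OF mu(2)] f1 by (intro enn2real_mono) auto
    also have "\<dots> = G v - G u" unfolding G_def eq using f1 by (simp add: enn2real_plus)
    finally show "norm (\<phi> (m (Sup k)) - \<phi> (m (Inf k))) \<le> G (Sup k) - G (Inf k)" using uv by simp
  qed
  also have "\<dots> = G b - G a" by (rule division_telescope[OF d ab])
  also have "\<dots> \<le> enn2real (variation \<phi> (m a) (m b))" by (simp add: G_def)
  finally show ?thesis .
qed

text \<open>The length is lower semicontinuous, hence an invariant of the Frechet class.\<close>

lemma frechet_variation: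
  assumes p: "(T\<^sub>1, \<phi>\<^sub>1) \<in> params D" "(T\<^sub>2, \<phi>\<^sub>2) \<in> params D'"
    and 0: "frechet_dist (T\<^sub>1, \<phi>\<^sub>1) (T\<^sub>2, \<phi>\<^sub>2) = 0" and fin: "variation \<phi>\<^sub>1 0 T\<^sub>1 < \<infinity>"
  shows "variation \<phi>\<^sub>2 0 T\<^sub>2 \<le> variation \<phi>\<^sub>1 0 T\<^sub>1"
  unfolding variation_def[of \<phi>\<^sub>2]
proof (rule SUP_least)
  have T: "T\<^sub>1 > 0" "T\<^sub>2 > 0" using p by (auto simp: params_def)
  fix d assume "d \<in> {d. d division_of {0..T\<^sub>2}}"
  then have d: "d division_of {0..T\<^sub>2}" by simp
  define v where "v = enn2real (variation \<phi>\<^sub>1 0 T\<^sub>1)"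
  have "(\<Sum>k\<in>d. norm (\<phi>\<^sub>2 (Sup k) - \<phi>\<^sub>2 (Inf k))) \<le> v"
  proof (rule field_le_epsilon)
    fix e' :: real assume "e' > 0"
    define e where "e = e' / (2 * (card d + 1))"
    have e: "e > 0" using \<open>e' > 0\<close> by (simp add: e_def)
    obtain \<alpha> \<beta> where ab: "\<alpha> \<in> time_changes T\<^sub>1" "\<beta> \<in> time_changes T\<^sub>2"
      and dd: "\<And>s. s \<in> {0..1} \<Longrightarrow> dist (\<phi>\<^sub>1 (\<alpha> s)) (\<phi>\<^sub>2 (\<beta> s)) < e"
      using frechet_dist_zeroD[OF p 0 e] by blast
    have "\<exists>s. s \<in> {0..1} \<and> \<beta> s = t" if "t \<in> {0..T\<^sub>2}" for t
      using time_changesD(3)[OF ab(2)] that by (metis imageE)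
    then obtain s where s: "\<And>t. t \<in> {0..T\<^sub>2} \<Longrightarrow> s t \<in> {0..1} \<and> \<beta> (s t) = t" by metis
    \<comment> \<open>any right inverse of \<open>\<beta>\<close> is monotone\<close>
    have s_mono: "s t \<le> s t'" if "t \<in> {0..T\<^sub>2}" "t' \<in> {0..T\<^sub>2}" "t \<le> t'" for t t'
    proof (rule ccontr)
      assume "\<not> s t \<le> s t'"
      then have "\<beta> (s t') \<le> \<beta> (s t)" using s that by (intro mono_onD[OF time_changesD(2)[OF ab(2)]]) auto
      then have "t = t'" using s that by auto
      then show False using \<open>\<not> s t \<le> s t'\<close> by simp
    qed
    define m where "m t = \<alpha> (s t)" for t
    have m: "mono_on {0..T\<^sub>2} m"
      unfolding m_def using s s_mono by (intro mono_onI mono_onD[OF time_changesD(2)[OF ab(1)]]) auto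
    have mT: "m t \<in> {0..T\<^sub>1}" if "t \<in> {0..T\<^sub>2}" for t
      unfolding m_def using s[OF that] time_changesD(4)[OF ab(1)] by blast
    have m0: "0 \<le> m 0" "m 0 \<le> m T\<^sub>2" "m T\<^sub>2 \<le> T\<^sub>1"
      using mT[of 0] mT[of "T\<^sub>2"] mono_onD[OF m, of 0 "T\<^sub>2"] T by auto
    then have vm: "variation \<phi>\<^sub>1 (m 0) (m T\<^sub>2) \<le> variation \<phi>\<^sub>1 0 T\<^sub>1" by (rule variation_mono)
    have near: "dist (\<phi>\<^sub>1 (m t)) (\<phi>\<^sub>2 t) < e" if "t \<in> {0..T\<^sub>2}" for t
      using dd[of "s t"] s[OF that] by (simp add: m_def)
    have "(\<Sum>k\<in>d. norm (\<phi>\<^sub>2 (Sup k) - \<phi>\<^sub>2 (Inf k))) \<le> (\<Sum>k\<in>d. norm (\<phi>\<^sub>1 (m (Sup k)) - \<phi>\<^sub>1 (m (Inf k))) + 2 * e)"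
    proof (rule sum_mono)
      fix k assume k: "k \<in> d"
      then obtain u v where uv: "u \<le> v" "k = {u..v}" "Inf k = u" "Sup k = v" using division_cell[OF d] by metis
      then have "u \<in> {0..T\<^sub>2}" "v \<in> {0..T\<^sub>2}" using division_ofD(2)[OF d k] by auto
      then have "dist (\<phi>\<^sub>1 (m u)) (\<phi>\<^sub>2 u) < e" "dist (\<phi>\<^sub>1 (m v)) (\<phi>\<^sub>2 v) < e" using near by auto
      moreover have "dist (\<phi>\<^sub>2 v) (\<phi>\<^sub>2 u) \<le> dist (\<phi>\<^sub>1 (m v)) (\<phi>\<^sub>2 v) + dist (\<phi>\<^sub>1 (m v)) (\<phi>\<^sub>1 (m u)) + dist (\<phi>\<^sub>1 (m u)) (\<phi>\<^sub>2 u)"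
        by (smt (verit) dist_triangle dist_commute)
      ultimately show "norm (\<phi>\<^sub>2 (Sup k) - \<phi>\<^sub>2 (Inf k)) \<le> norm (\<phi>\<^sub>1 (m (Sup k)) - \<phi>\<^sub>1 (m (Inf k))) + 2 * e"
        using uv by (simp add: dist_norm)
    qed
    also have "\<dots> = (\<Sum>k\<in>d. norm (\<phi>\<^sub>1 (m (Sup k)) - \<phi>\<^sub>1 (m (Inf k)))) + card d * (2 * e)" by (simp add: sum.distrib)
    also have "\<dots> \<le> v + e'"
    proof (rule add_mono)
      have "(\<Sum>k\<in>d. norm (\<phi>\<^sub>1 (m (Sup k)) - \<phi>\<^sub>1 (m (Inf k)))) \<le> enn2real (variation \<phi>\<^sub>1 (m 0) (m T\<^sub>2))"
        using vm fin T by (intro variation_reparam_le[OF d _ m]) (auto intro: le_less_trans)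
      also have "\<dots> \<le> v" unfolding v_def using vm fin by (intro enn2real_mono) auto
      finally show "(\<Sum>k\<in>d. norm (\<phi>\<^sub>1 (m (Sup k)) - \<phi>\<^sub>1 (m (Inf k)))) \<le> v" .
      show "card d * (2 * e) \<le> e'" using \<open>e' > 0\<close> by (simp add: e_def field_simps)
    qed
    finally show "(\<Sum>k\<in>d. norm (\<phi>\<^sub>2 (Sup k) - \<phi>\<^sub>2 (Inf k))) \<le> v + e'" .
  qed
  then have "ennreal (\<Sum>k\<in>d. norm (\<phi>\<^sub>2 (Sup k) - \<phi>\<^sub>2 (Inf k))) \<le> ennreal v" by (rule ennreal_leI)
  also have "\<dots> = variation \<phi>\<^sub>1 0 T\<^sub>1" using fin by (simp add: v_def)
  finally show "(\<Sum>k\<in>d. jump \<phi>\<^sub>2 k) \<le> variation \<phi>\<^sub>1 0 T\<^sub>1" by (simp add: jump_sum_real)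
qed

text \<open>A parameterization may be composed with a change of time that is not injective.  Since the
  changes of time in the Frechet distance are not injective either, they are first perturbed to
  homeomorphisms.\<close>

lemma frechet_reparam:
  assumes p: "(T\<^sub>0, \<phi>\<^sub>0) \<in> params D" "(T, \<phi>) \<in> params D'"
    and 0: "frechet_dist (T\<^sub>0, \<phi>\<^sub>0) (T, \<phi>) = 0" and g: "g \<in> time_changes T"
  shows "frechet_dist (T\<^sub>0, \<phi>\<^sub>0) (1, \<phi> \<circ> g) = 0" "(1, \<phi> \<circ> g) \<in> params D'"
proof -
  have T: "T\<^sub>0 > 0" "T > 0" and c\<phi>: "continuous_on {0..T} \<phi>" using p by (auto simp: params_def)
  note gD = time_changesD[OF g] and ge = time_change_ends[OF g T(2)]
  show p': "(1, \<phi> \<circ> g) \<in> params D'"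
    using p(2) gD unfolding params_def by (auto intro!: continuous_on_compose2[of "{0..T}" \<phi> _ g] simp: comp_def)
  show "frechet_dist (T\<^sub>0, \<phi>\<^sub>0) (1, \<phi> \<circ> g) = 0"
  proof (rule frechet_dist_zeroI[OF p(1) p'])
    fix e :: real assume e: "e > 0"
    then obtain \<alpha>0 \<alpha> where ab: "\<alpha>0 \<in> time_changes T\<^sub>0" "\<alpha> \<in> time_changes T"
      and d: "\<And>s. s \<in> {0..1} \<Longrightarrow> dist (\<phi>\<^sub>0 (\<alpha>0 s)) (\<phi> (\<alpha> s)) < e/2"
      using frechet_dist_zeroD[OF p 0 half_gt_zero[OF e]] by blast
    note aD = time_changesD[OF ab(2)] and ae = time_change_ends[OF ab(2) T(2)]
    have "uniformly_continuous_on {0..T} \<phi>" using c\<phi> by (rule compact_uniformly_continuous) simp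
    then obtain \<delta> where \<delta>: "\<delta> > 0" "\<And>x y. x \<in> {0..T} \<Longrightarrow> y \<in> {0..T} \<Longrightarrow> dist y x < \<delta> \<Longrightarrow> dist (\<phi> y) (\<phi> x) < e/2"
      using e unfolding uniformly_continuous_on_def by (metis half_gt_zero)
    \<comment> \<open>\<open>h\<close> is a homeomorphism so close to \<open>\<alpha>\<close> that \<open>\<phi> \<circ> h\<close> and \<open>\<phi> \<circ> \<alpha>\<close> differ by less than \<open>e/2\<close>\<close>
    define \<epsilon> where "\<epsilon> = min 1 (\<delta> / (2 * T))"
    have \<epsilon>: "\<epsilon> > 0" "\<epsilon> \<le> 1" "\<epsilon> * T < \<delta>"
    proof -
      have "\<epsilon> * T \<le> \<delta> / (2 * T) * T" using T by (intro mult_right_mono) (auto simp: \<epsilon>_def)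
      also have "\<dots> < \<delta>" using T \<delta> by simp
      finally show "\<epsilon> * T < \<delta>" .
    qed (use T \<delta> in \<open>auto simp: \<epsilon>_def\<close>)
    define h where "h s = (1 - \<epsilon>) * \<alpha> s + \<epsilon> * T * s" for s
    have hs: "h x < h y" if "x \<in> {0..1}" "y \<in> {0..1}" "x < y" for x y
    proof -
      have "(1 - \<epsilon>) * \<alpha> x \<le> (1 - \<epsilon>) * \<alpha> y" using \<epsilon> that by (intro mult_left_mono mono_onD[OF aD(2)]) auto
      moreover have "\<epsilon> * T * x < \<epsilon> * T * y" using \<epsilon> T that by (intro mult_strict_left_mono) auto
      ultimately show ?thesis by (simp add: h_def)
    qed
    have hc: "continuous_on {0..1} h" unfolding h_def by (intro continuous_intros aD(1))
    have "h \<in> time_changes T"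
      using hc hs ae by (intro time_changesI mono_onI) (auto simp: h_def less_eq_real_def algebra_simps)
    note hD = time_changesD[OF this] and he = time_change_ends[OF this T(2)]
    have near: "dist (\<alpha> s) (h s) < \<delta>" if "s \<in> {0..1}" for s
    proof -
      have "T * s \<le> T * 1" using that T by (intro mult_left_mono) auto
      then have "T * s \<in> {0..T}" using that T by auto
      moreover have "\<alpha> s - h s = \<epsilon> * (\<alpha> s - T * s)" by (simp add: h_def algebra_simps)
      ultimately have "\<bar>\<alpha> s - h s\<bar> \<le> \<epsilon> * T"
        using aD(4)[OF that] \<epsilon> by (auto simp: abs_mult intro!: mult_left_mono)
      then show ?thesis using \<epsilon> by (simp add: dist_real_def)
    qed
    have inj: "inj_on h {0..1}" using hs by (intro inj_onI) (metis linorder_neqE less_irrefl)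
    define i where "i = the_inv_into {0..1} h"
    have ih: "i (h s) = s" if "s \<in> {0..1}" for s unfolding i_def using inj that by (rule the_inv_into_f_f)
    have hi: "h (i t) = t" "i t \<in> {0..1}" if "t \<in> {0..T}" for t
      using that hD(3) ih by (metis imageE)+
    have ic: "continuous_on {0..T} i" using continuous_on_inv[OF hc, of i] ih hD(3) by simp
    have im: "i x \<le> i y" if "x \<in> {0..T}" "y \<in> {0..T}" "x \<le> y" for x y
    proof (rule ccontr)
      assume "\<not> i x \<le> i y"
      then have "h (i y) < h (i x)" using hi that by (intro hs) auto
      then show False using hi that by auto
    qed
    define B where "B s = i (g s)" for s
    have BD: "B s \<in> {0..1}" "h (B s) = g s" if "s \<in> {0..1}" for s
      using hi[OF gD(4)[OF that]] by (auto simp: B_def)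
    have B: "B \<in> time_changes 1"
    proof (rule time_changesI)
      show "continuous_on {0..1} B" unfolding B_def using gD by (intro continuous_on_compose2[OF ic]) auto
      show "mono_on {0..1} B" unfolding B_def using gD(4) by (intro mono_onI im mono_onD[OF gD(2)]) auto
      show "B 0 = 0" using ih[of 0] he by (simp add: B_def ge)
      show "B 1 = 1" using ih[of 1] he by (simp add: B_def ge)
    qed
    have "\<alpha>0 \<circ> B \<in> time_changes T\<^sub>0"
    proof (rule time_changesI)
      show "continuous_on {0..1} (\<alpha>0 \<circ> B)"
        using time_changesD[OF B] time_changesD[OF ab(1)] by (intro continuous_on_compose) auto
      show "mono_on {0..1} (\<alpha>0 \<circ> B)"
        using time_changesD(4)[OF B] by (auto intro!: mono_onI mono_onD[OF time_changesD(2)[OF ab(1)]] mono_onD[OF time_changesD(2)[OF B]])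
      show "(\<alpha>0 \<circ> B) 0 = 0" "(\<alpha>0 \<circ> B) 1 = T\<^sub>0"
        using time_change_ends[OF B] time_change_ends[OF ab(1) T(1)] by auto
    qed
    moreover have "(\<lambda>s. 1 * s) \<in> time_changes 1" by (rule scaling_time_change) simp
    moreover have "dist (\<phi>\<^sub>0 ((\<alpha>0 \<circ> B) s)) ((\<phi> \<circ> g) (1 * s)) \<le> e" if s: "s \<in> {0..1}" for s
    proof -
      have "dist (\<phi>\<^sub>0 (\<alpha>0 (B s))) (\<phi> (\<alpha> (B s))) < e/2" using d BD(1)[OF s] by blast
      moreover have "dist (\<phi> (\<alpha> (B s))) (\<phi> (h (B s))) < e/2"
        using near[OF BD(1)[OF s]] aD(4)[OF BD(1)[OF s]] hD(4)[OF BD(1)[OF s]] by (intro \<delta>(2)) auto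
      moreover have "dist (\<phi>\<^sub>0 (\<alpha>0 (B s))) (\<phi> (g s)) \<le> dist (\<phi>\<^sub>0 (\<alpha>0 (B s))) (\<phi> (\<alpha> (B s))) + dist (\<phi> (\<alpha> (B s))) (\<phi> (h (B s)))"
        using BD(2)[OF s] by (metis dist_triangle)
      ultimately show ?thesis by simp
    qed
    ultimately show "\<exists>\<alpha>\<in>time_changes T\<^sub>0. \<exists>\<beta>\<in>time_changes 1. \<forall>s\<in>{0..1}. dist (\<phi>\<^sub>0 (\<alpha> s)) ((\<phi> \<circ> g) (\<beta> s)) \<le> e"
      by blast
  qed
qed

section \<open>Curves and their parameterizations\<close>

lemma curve_class_params:
  assumes "\<gamma> \<in> curves D"
  obtains p where "p \<in> params D" "p \<in> \<gamma>" "\<gamma> = {q \<in> params D. frechet_dist p q = 0}"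
proof -
  obtain p where p: "p \<in> params D" "\<gamma> = {(p, q). p \<in> params D \<and> q \<in> params D \<and> frechet_dist p q = 0} `` {p}"
    using assms by (auto simp: curves_def elim: quotientE)
  then have \<gamma>: "\<gamma> = {q \<in> params D. frechet_dist p q = 0}" by auto
  have "frechet_dist p p = 0"
  proof (cases p)
    case (Pair T \<phi>)
    then have T: "(T, \<phi>) \<in> params D" "T > 0" using p by (auto simp: params_def)
    show ?thesis unfolding Pair
      by (rule frechet_dist_zeroI[OF T(1) T(1)]) (use scaling_time_change[OF T(2)] in force)
  qed
  then show ?thesis using that[of p] p \<gamma> by simp
qed

text \<open>An absolutely continuous path represents a curve that is both rectifiable and in the domain of
  the geometric actions.\<close>

lemma abs_continuous_path_curve:
  fixes \<phi> :: "real \<Rightarrow> 'a::euclidean_space"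
  assumes ac: "abs_continuous_on {0..1} \<phi>" and im: "\<phi> ` {0..1} \<subseteq> G" and GD: "G \<subseteq> D"
    and ends: "\<phi> 0 \<in> A\<^sub>1" "\<phi> 1 \<in> A\<^sub>2"
  obtains \<gamma> where "\<gamma> \<in> weak_curves D" "\<gamma> \<in> curves_from_to (rect_curves D) G A\<^sub>1 A\<^sub>2"
    "(1, \<phi>) \<in> \<gamma>" "\<phi> \<in> weak_params D"
proof -
  have p: "(1, \<phi>) \<in> params D" using abs_continuous_imp_continuous[OF ac] im GD by (auto simp: params_def)
  define \<gamma> where "\<gamma> = {q \<in> params D. frechet_dist (1, \<phi>) q = 0}"
  have \<gamma>': "\<gamma> = {(p, q). p \<in> params D \<and> q \<in> params D \<and> frechet_dist p q = 0} `` {(1, \<phi>)}"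
    using p by (auto simp: \<gamma>_def)
  have \<gamma>c: "\<gamma> \<in> curves D" unfolding curves_def \<gamma>' using p by (rule quotientI)
  have in\<gamma>: "(1, \<phi>) \<in> \<gamma>"
  proof -
    have "frechet_dist (1, \<phi>) (1, \<phi>) = 0"
      by (rule frechet_dist_zeroI[OF p p]) (use scaling_time_change[of 1] in force)
    then show ?thesis using p by (simp add: \<gamma>_def)
  qed
  have wp: "\<phi> \<in> weak_params D"
    unfolding weak_params_def using p
    by (auto intro!: exI[of _ "{}"] exI[of _ "1::real"] abs_continuous_on_subset[OF ac])
  have fin: "variation \<phi> 0 1 < \<infinity>" using ac by (rule variation_finite) simp
  have mem: "variation \<omega> 0 T < \<infinity> \<and> \<omega> ` {0..T} \<subseteq> G \<and> \<omega> 0 = \<phi> 0 \<and> \<omega> T = \<phi> 1" if "(T, \<omega>) \<in> \<gamma>" for T \<omega>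
  proof -
    have q: "(T, \<omega>) \<in> params D" "frechet_dist (1, \<phi>) (T, \<omega>) = 0" using that by (auto simp: \<gamma>_def)
    then show ?thesis
      using frechet_ends[OF p q] frechet_image[OF p q] frechet_variation[OF p q fin] fin im by (auto intro: le_less_trans)
  qed
  have "curve_length \<gamma> < \<infinity>"
  proof -
    have "(SOME p. p \<in> \<gamma>) \<in> \<gamma>" using in\<gamma> by (rule someI)
    then show ?thesis unfolding curve_length_def
      using mem by (cases "SOME p. p \<in> \<gamma>") (auto simp: param_length_eq_variation)
  qed
  then have "\<gamma> \<in> rect_curves D" using \<gamma>c by (simp add: rect_curves_def)
  then have "\<gamma> \<in> curves_from_to (rect_curves D) G A\<^sub>1 A\<^sub>2"
    unfolding curves_from_to_def curve_image_def using mem ends by fastforce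
  moreover have "\<gamma> \<in> weak_curves D" unfolding weak_curves_def using \<gamma>c wp in\<gamma> by auto
  ultimately show ?thesis using that in\<gamma> wp by blast
qed

text \<open>If \<open>s\<close> is strictly increasing and dominates the increments of \<open>\<phi>\<close>, its generalized inverse is a
  change of time that makes \<open>\<phi>\<close> Lipschitz.  The function \<open>s\<close> may jump; the generalized inverse is constant
  there.\<close>

lemma lipschitz_time_change:
  fixes \<phi> :: "real \<Rightarrow> 'a::euclidean_space"
  assumes T: "T > 0" and \<phi>: "continuous_on {0..T} \<phi>" and \<eta>: "\<eta> > 0"
    and s: "\<And>t t'. \<lbrakk>0 \<le> t; t \<le> t'; t' \<le> T\<rbrakk> \<Longrightarrow> norm (\<phi> t' - \<phi> t) \<le> s t' - s t"
    and s': "\<And>t t'. \<lbrakk>0 \<le> t; t \<le> t'; t' \<le> T\<rbrakk> \<Longrightarrow> \<eta> * (t' - t) \<le> s t' - s t"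
    and s0: "s 0 = 0"
  obtains g where "g \<in> time_changes T"
    "\<And>x y. \<lbrakk>x \<in> {0..1}; y \<in> {0..1}\<rbrakk> \<Longrightarrow> norm (\<phi> (g y) - \<phi> (g x)) \<le> s T * \<bar>y - x\<bar>"
proof -
  define \<Lambda> where "\<Lambda> = s T"
  have \<Lambda>: "\<Lambda> > 0" using s'[of 0 T] T \<eta> s0 by (simp add: \<Lambda>_def) (smt (verit) mult_pos_pos)
  define A where "A \<sigma> = {t \<in> {0..T}. s t \<le> \<sigma>}" for \<sigma>
  define G where "G \<sigma> = Sup (A \<sigma>)" for \<sigma>
  have bdd: "bdd_above (A \<sigma>)" for \<sigma> by (rule bdd_aboveI[of _ T]) (auto simp: A_def)
  have A0: "0 \<in> A \<sigma>" if "\<sigma> \<ge> 0" for \<sigma> using that T s0 by (auto simp: A_def)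
  have G_range: "0 \<le> G \<sigma>" "G \<sigma> \<le> T" if "\<sigma> \<ge> 0" for \<sigma>
  proof -
    show "0 \<le> G \<sigma>" unfolding G_def using A0[OF that] by (rule cSup_upper[OF _ bdd])
    show "G \<sigma> \<le> T" unfolding G_def using A0[OF that] by (intro cSup_least) (auto simp: A_def)
  qed
  have G_mono: "G \<sigma> \<le> G \<sigma>'" if "0 \<le> \<sigma>" "\<sigma> \<le> \<sigma>'" for \<sigma> \<sigma>'
    unfolding G_def using A0[OF that(1)] that by (intro cSup_subset_mono bdd) (auto simp: A_def)
  have above: "\<sigma> < s t" if "G \<sigma> < t" "t \<in> {0..T}" for \<sigma> t
  proof (rule ccontr)
    assume "\<not> \<sigma> < s t"
    then have "t \<in> A \<sigma>" using that by (auto simp: A_def)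
    then have "t \<le> G \<sigma>" unfolding G_def by (rule cSup_upper[OF _ bdd])
    then show False using that by simp
  qed
  have below: "s t \<le> \<sigma>" if "t < G \<sigma>" "t \<ge> 0" "\<sigma> \<ge> 0" for \<sigma> t
  proof -
    have "A \<sigma> \<noteq> {}" using A0[OF that(3)] by auto
    with \<open>t < G \<sigma>\<close> obtain t' where t': "t' \<in> A \<sigma>" "t < t'" unfolding G_def by (metis less_cSupD)
    then have "\<eta> * (t' - t) \<le> s t' - s t" using that by (intro s') (auto simp: A_def)
    moreover have "\<eta> * (t' - t) \<ge> 0" using \<eta> t' by auto
    ultimately show ?thesis using t' by (auto simp: A_def)
  qed
  have key: "norm (\<phi> (G \<sigma>') - \<phi> (G \<sigma>)) \<le> \<sigma>' - \<sigma> \<and> \<eta> * (G \<sigma>' - G \<sigma>) \<le> \<sigma>' - \<sigma>"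
    if \<sigma>: "0 \<le> \<sigma>" "\<sigma> \<le> \<sigma>'" for \<sigma> \<sigma>'
  proof (cases "G \<sigma> = G \<sigma>'")
    case True
    then show ?thesis using \<sigma> by simp
  next
    case False
    define t t' where "t = G \<sigma>" and "t' = G \<sigma>'"
    have tt: "0 \<le> t" "t < t'" "t' \<le> T"
      using False G_mono[OF \<sigma>] G_range[of \<sigma>] G_range[of \<sigma>'] \<sigma> by (auto simp: t_def t'_def)
    define u v where "u \<epsilon> = t + \<epsilon> * (t' - t)" and "v \<epsilon> = t' - \<epsilon> * (t' - t)" for \<epsilon> :: real
    have uv: "t < u \<epsilon> \<and> u \<epsilon> < v \<epsilon> \<and> v \<epsilon> < t'" if "\<epsilon> \<in> {0<..<1/2}" for \<epsilon>
    proof -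
      define w where "w = \<epsilon> * (t' - t)"
      have "0 < w" "w < 1/2 * (t' - t)" unfolding w_def using that tt by (auto intro: mult_strict_right_mono)
      then show ?thesis unfolding u_def v_def w_def[symmetric] by simp
    qed
    have est: "norm (\<phi> (v \<epsilon>) - \<phi> (u \<epsilon>)) \<le> \<sigma>' - \<sigma> \<and> \<eta> * (v \<epsilon> - u \<epsilon>) \<le> \<sigma>' - \<sigma>" if "\<epsilon> \<in> {0<..<1/2}" for \<epsilon>
    proof -
      have "\<sigma> < s (u \<epsilon>)" using uv[OF that] tt by (intro above) (auto simp: t_def)
      moreover have "s (v \<epsilon>) \<le> \<sigma>'" using uv[OF that] tt \<sigma> by (intro below) (auto simp: t'_def)
      moreover have "norm (\<phi> (v \<epsilon>) - \<phi> (u \<epsilon>)) \<le> s (v \<epsilon>) - s (u \<epsilon>)" using uv[OF that] tt by (intro s) auto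
      moreover have "\<eta> * (v \<epsilon> - u \<epsilon>) \<le> s (v \<epsilon>) - s (u \<epsilon>)" using uv[OF that] tt by (intro s') auto
      ultimately show ?thesis by (intro conjI) linarith+
    qed
    \<comment> \<open>the estimate at \<open>u \<epsilon>\<close> and \<open>v \<epsilon>\<close>, inside the interval, extends to its end points by continuity of \<open>\<phi>\<close>\<close>
    have ev: "eventually (\<lambda>\<epsilon>. \<epsilon> \<in> {0<..<1/2::real}) (at_right 0)"
      by (rule eventually_at_right_real) simp
    have cu: "(u \<longlongrightarrow> t) (at_right 0)" "(v \<longlongrightarrow> t') (at_right 0)"
      unfolding u_def v_def by (auto intro!: tendsto_eq_intros)
    have \<phi>u: "((\<lambda>\<epsilon>. \<phi> (u \<epsilon>)) \<longlongrightarrow> \<phi> t) (at_right 0)"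
      by (rule continuous_on_tendsto_compose[OF \<phi> cu(1)]) (use tt in auto, rule eventually_mono[OF ev], use uv tt in fastforce)
    have \<phi>v: "((\<lambda>\<epsilon>. \<phi> (v \<epsilon>)) \<longlongrightarrow> \<phi> t') (at_right 0)"
      by (rule continuous_on_tendsto_compose[OF \<phi> cu(2)]) (use tt in auto, rule eventually_mono[OF ev], use uv tt in fastforce)
    have "norm (\<phi> t' - \<phi> t) \<le> \<sigma>' - \<sigma>"
      by (rule tendsto_upperbound[OF tendsto_norm[OF tendsto_diff[OF \<phi>v \<phi>u]]])
         (auto intro!: eventually_mono[OF ev] simp: est)
    moreover have "\<eta> * (t' - t) \<le> \<sigma>' - \<sigma>"
      by (rule tendsto_upperbound[OF tendsto_mult_left[OF tendsto_diff[OF cu(2,1)]]])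
         (auto intro!: eventually_mono[OF ev] simp: est)
    ultimately show ?thesis by (simp add: t_def t'_def)
  qed
  define g where "g x = G (\<Lambda> * x)" for x
  have "continuous_on {0..1} g"
  proof (rule lipschitz_on_continuous_on[of "\<Lambda> / \<eta>"], rule lipschitz_onI)
    fix x y :: real assume "x \<in> {0..1}" "y \<in> {0..1}"
    then have *: "\<bar>g y - g x\<bar> \<le> \<Lambda> / \<eta> * (y - x)" if "x \<le> y" "x \<in> {0..1}" "y \<in> {0..1}" for x y
      using key[of "\<Lambda> * x" "\<Lambda> * y"] G_mono[of "\<Lambda> * x" "\<Lambda> * y"] \<eta> \<Lambda> that by (auto simp: g_def field_simps)
    show "dist (g x) (g y) \<le> \<Lambda> / \<eta> * dist x y"
      using *[of x y] *[of y x] \<open>x \<in> {0..1}\<close> \<open>y \<in> {0..1}\<close> by (cases "x \<le> y") (auto simp: dist_real_def abs_minus_commute)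
  qed (use \<Lambda> \<eta> in auto)
  moreover have "mono_on {0..1} g"
    unfolding g_def using \<Lambda> by (intro mono_onI G_mono) auto
  moreover have "g 0 = 0"
  proof -
    have "A 0 = {0}"
    proof -
      have "t = 0" if "t \<in> A 0" for t
      proof -
        have "\<eta> * (t - 0) \<le> s t - s 0" using that by (intro s') (auto simp: A_def)
        then have "\<eta> * t \<le> 0" using that s0 by (auto simp: A_def)
        then show ?thesis using that \<eta> by (auto simp: A_def mult_le_0_iff)
      qed
      then show ?thesis using A0[of 0] by auto
    qed
    then show ?thesis by (simp add: g_def G_def)
  qed
  moreover have "g 1 = T"
  proof -
    have "T \<in> A \<Lambda>" using T by (auto simp: A_def \<Lambda>_def)
    then have "T \<le> G \<Lambda>" unfolding G_def by (rule cSup_upper[OF _ bdd])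
    then show ?thesis using G_range[of \<Lambda>] \<Lambda> by (simp add: g_def)
  qed
  ultimately have "g \<in> time_changes T" by (rule time_changesI)
  moreover have "norm (\<phi> (g y) - \<phi> (g x)) \<le> s T * \<bar>y - x\<bar>" if "x \<in> {0..1}" "y \<in> {0..1}" for x y
  proof -
    have *: "norm (\<phi> (g y) - \<phi> (g x)) \<le> \<Lambda> * (y - x)" if "x \<le> y" "x \<in> {0..1}" "y \<in> {0..1}" for x y
      using key[of "\<Lambda> * x" "\<Lambda> * y"] \<Lambda> that by (auto simp: g_def right_diff_distrib)
    show ?thesis using *[of x y] *[of y x] that unfolding \<Lambda>_def
      by (cases "x \<le> y") (auto simp: norm_minus_commute)
  qed
  ultimately show ?thesis by (rule that)
qed

lemma rectifiable_lipschitz_param: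
  fixes \<gamma> :: "'a::euclidean_space curve"
  assumes \<gamma>: "\<gamma> \<in> curves D" and len: "curve_length \<gamma> \<le> ennreal l" and l: "0 \<le> l" "l < l'"
  obtains \<omega> where "(1, \<omega>) \<in> \<gamma>"
    "\<And>x y. \<lbrakk>x \<in> {0..1}; y \<in> {0..1}\<rbrakk> \<Longrightarrow> norm (\<omega> y - \<omega> x) \<le> l' * \<bar>y - x\<bar>"
proof -
  obtain p0 where p0: "p0 \<in> params D" "p0 \<in> \<gamma>" "\<gamma> = {q \<in> params D. frechet_dist p0 q = 0}"
    using curve_class_params[OF \<gamma>] .
  obtain T0 \<phi>0 where p0': "p0 = (T0, \<phi>0)" by (cases p0)
  obtain T \<phi> where T\<phi>: "(SOME p. p \<in> \<gamma>) = (T, \<phi>)" by (cases "SOME p. p \<in> \<gamma>")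
  have "(SOME p. p \<in> \<gamma>) \<in> \<gamma>" using p0(2) by (rule someI)
  then have in\<gamma>: "(T, \<phi>) \<in> \<gamma>" using T\<phi> by simp
  then have P: "(T, \<phi>) \<in> params D" "frechet_dist (T0, \<phi>0) (T, \<phi>) = 0" using p0(3) p0' by auto
  then have T: "T > 0" and c\<phi>: "continuous_on {0..T} \<phi>" by (auto simp: params_def)
  have var: "variation \<phi> 0 T \<le> ennreal l"
    using len by (simp add: curve_length_def T\<phi> param_length_eq_variation)
  have fin: "variation \<phi> t t' < top" if "0 \<le> t" "t \<le> t'" "t' \<le> T" for t t'
    using order_trans[OF variation_mono[of 0 t t' T \<phi>] var] that by (auto intro: le_less_trans)
  define V where "V t = enn2real (variation \<phi> 0 t)" for t
  have V: "V t' - V t = enn2real (variation \<phi> t t')" if "0 \<le> t" "t \<le> t'" "t' \<le> T" for t t'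
    using variation_add[of 0 t t' \<phi>] fin[of 0 t] fin[of t t'] that by (simp add: V_def enn2real_plus)
  have Vj: "norm (\<phi> t' - \<phi> t) \<le> V t' - V t" if "0 \<le> t" "t \<le> t'" "t' \<le> T" for t t'
  proof -
    have "enn2real (ennreal (norm (\<phi> t' - \<phi> t))) \<le> enn2real (variation \<phi> t t')"
      using jump_le_variation[OF that(2), of \<phi>] fin[OF that] by (intro enn2real_mono)
    then show ?thesis using V[OF that] by simp
  qed
  have V0: "V 0 = 0" using V[of 0 0] T by (simp add: V_def)
  have VT: "V T \<le> l" using enn2real_mono[OF var] l by (simp add: V_def)
  \<comment> \<open>the additional speed \<open>\<eta>\<close> makes \<open>s\<close> strictly increasing where \<open>\<phi>\<close> rests, and uses up the slack \<open>l' - l\<close>\<close>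
  define \<eta> where "\<eta> = (l' - l) / T"
  have \<eta>: "\<eta> > 0" using l T by (simp add: \<eta>_def)
  define s where "s t = (V t - V 0) + \<eta> * t" for t
  obtain g where g: "g \<in> time_changes T"
    "\<And>x y. \<lbrakk>x \<in> {0..1}; y \<in> {0..1}\<rbrakk> \<Longrightarrow> norm (\<phi> (g y) - \<phi> (g x)) \<le> s T * \<bar>y - x\<bar>"
  proof (rule lipschitz_time_change[OF T c\<phi> \<eta>, of s])
    fix t t' :: real assume t: "0 \<le> t" "t \<le> t'" "t' \<le> T"
    have "\<eta> * t \<le> \<eta> * t'" using \<eta> t by (intro mult_left_mono) auto
    then show "norm (\<phi> t' - \<phi> t) \<le> s t' - s t" using Vj[OF t] by (simp add: s_def)
    have "V t \<le> V t'" using Vj[OF t] norm_ge_zero[of "\<phi> t' - \<phi> t"] by linarith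
    then show "\<eta> * (t' - t) \<le> s t' - s t" by (simp add: s_def right_diff_distrib)
  qed (auto simp: s_def)
  have sT: "s T \<le> l'" using VT T V0 by (simp add: s_def \<eta>_def)
  show ?thesis
  proof (rule that[of "\<phi> \<circ> g"])
    show "(1, \<phi> \<circ> g) \<in> \<gamma>" using frechet_reparam[OF _ P g(1)] p0 p0' by simp
    fix x y :: real assume xy: "x \<in> {0..1}" "y \<in> {0..1}"
    have "norm (\<phi> (g y) - \<phi> (g x)) \<le> s T * \<bar>y - x\<bar>" using g(2) xy by blast
    also have "\<dots> \<le> l' * \<bar>y - x\<bar>" using sT by (intro mult_right_mono) auto
    finally show "norm ((\<phi> \<circ> g) y - (\<phi> \<circ> g) x) \<le> l' * \<bar>y - x\<bar>" by simp
  qed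
qed

section \<open>The action integral\<close>

text \<open>For functions that need not be measurable, \<open>\<integral>\<^sup>+\<close> is a lower integral.  It is still additive over
  disjoint measurable sets.\<close>

lemma nn_integral_Un_disjoint:
  assumes A [measurable]: "A \<in> sets M" and B [measurable]: "B \<in> sets M" and AB: "A \<inter> B = {}"
  shows "(\<integral>\<^sup>+x\<in>A \<union> B. f x \<partial>M) = (\<integral>\<^sup>+x\<in>A. f x \<partial>M) + (\<integral>\<^sup>+x\<in>B. f x \<partial>M)"
proof (rule antisym)
  show "(\<integral>\<^sup>+x\<in>A \<union> B. f x \<partial>M) \<le> (\<integral>\<^sup>+x\<in>A. f x \<partial>M) + (\<integral>\<^sup>+x\<in>B. f x \<partial>M)"
    unfolding nn_integral_def[of M "\<lambda>x. f x * indicator (A \<union> B) x"]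
  proof (rule SUP_least)
    fix g assume "g \<in> {g. simple_function M g \<and> g \<le> (\<lambda>x. f x * indicator (A \<union> B) x)}"
    then have g: "simple_function M g" and le: "\<And>x. g x \<le> f x * indicator (A \<union> B) x" by (auto simp: le_fun_def)
    have [measurable]: "g \<in> borel_measurable M" using g by (rule borel_measurable_simple_function)
    have geq: "g x = g x * indicator A x + g x * indicator B x" for x
      using le[of x] AB by (auto simp: indicator_def split: if_splits)
    have "integral\<^sup>S M g = (\<integral>\<^sup>+x. g x \<partial>M)" using g by (rule nn_integral_eq_simple_integral[symmetric])
    also have "\<dots> = (\<integral>\<^sup>+x. g x * indicator A x + g x * indicator B x \<partial>M)" using geq by simp
    also have "\<dots> = (\<integral>\<^sup>+x. g x * indicator A x \<partial>M) + (\<integral>\<^sup>+x. g x * indicator B x \<partial>M)"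
      by (rule nn_integral_add) measurable
    also have "\<dots> \<le> (\<integral>\<^sup>+x\<in>A. f x \<partial>M) + (\<integral>\<^sup>+x\<in>B. f x \<partial>M)"
    proof (intro add_mono nn_integral_mono)
      fix x
      show "g x * indicator A x \<le> f x * indicator A x" "g x * indicator B x \<le> f x * indicator B x"
        using le[of x] by (auto simp: indicator_def)
    qed
    finally show "integral\<^sup>S M g \<le> (\<integral>\<^sup>+x\<in>A. f x \<partial>M) + (\<integral>\<^sup>+x\<in>B. f x \<partial>M)" .
  qed
  let ?SA = "{g. simple_function M g \<and> g \<le> (\<lambda>x. f x * indicator A x)}"
  let ?SB = "{g. simple_function M g \<and> g \<le> (\<lambda>x. f x * indicator B x)}"
  have ne: "?SA \<noteq> {}" "?SB \<noteq> {}"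
    by (auto simp: le_fun_def intro!: exI[of _ "\<lambda>_. 0"])
  have *: "integral\<^sup>S M g1 + integral\<^sup>S M g2 \<le> (\<integral>\<^sup>+x\<in>A \<union> B. f x \<partial>M)" if "g1 \<in> ?SA" "g2 \<in> ?SB" for g1 g2
  proof -
    have g: "simple_function M g1" "simple_function M g2" using that by auto
    have le: "g1 x \<le> f x * indicator A x" "g2 x \<le> f x * indicator B x" for x
      using that by (auto simp: le_fun_def)
    have "integral\<^sup>S M g1 + integral\<^sup>S M g2 = (\<integral>\<^sup>+x. g1 x \<partial>M) + (\<integral>\<^sup>+x. g2 x \<partial>M)"
      using g by (simp add: nn_integral_eq_simple_integral)
    also have "\<dots> = (\<integral>\<^sup>+x. g1 x + g2 x \<partial>M)"
      using g by (intro nn_integral_add[symmetric]) (auto intro: borel_measurable_simple_function)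
    also have "\<dots> \<le> (\<integral>\<^sup>+x\<in>A \<union> B. f x \<partial>M)"
    proof (rule nn_integral_mono)
      fix x
      have "f x * indicator A x + f x * indicator B x = f x * indicator (A \<union> B) x"
        using AB by (auto simp: indicator_def)
      then show "g1 x + g2 x \<le> f x * indicator (A \<union> B) x" using add_mono[OF le(1)[of x] le(2)[of x]] by simp
    qed
    finally show ?thesis .
  qed
  show "(\<integral>\<^sup>+x\<in>A. f x \<partial>M) + (\<integral>\<^sup>+x\<in>B. f x \<partial>M) \<le> (\<integral>\<^sup>+x\<in>A \<union> B. f x \<partial>M)"
    unfolding nn_integral_def[of M "\<lambda>x. f x * indicator A x"] nn_integral_def[of M "\<lambda>x. f x * indicator B x"]
      ennreal_SUP_add_left[OF ne(1), symmetric] ennreal_SUP_add_right[OF ne(2)]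
    by (intro SUP_least *)
qed

text \<open>The geometric action of the part of a path that is parameterized by \<open>[a, b]\<close>.\<close>

definition action :: "('a::euclidean_space \<Rightarrow> 'a \<Rightarrow> real) \<Rightarrow> (real \<Rightarrow> 'a) \<Rightarrow> real \<Rightarrow> real \<Rightarrow> ennreal" where
  "action H \<phi> a b =
     (\<integral>\<^sup>+\<alpha>\<in>{a..b}. ennreal (local_action H (\<phi> \<alpha>) (vector_derivative \<phi> (at \<alpha>))) \<partial>lborel)"

lemma induces_action:
  assumes "induces D H S" "\<gamma> \<in> weak_curves D" "\<phi> \<in> weak_params D" "(1, \<phi>) \<in> \<gamma>"
  shows "S \<gamma> = action H \<phi> 0 1"
  using assms by (auto simp: induces_def action_def)

lemma action_combine:
  assumes "a \<le> b" "b \<le> c"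
  shows "action H \<phi> a c = action H \<phi> a b + action H \<phi> b c"
proof -
  let ?f = "\<lambda>\<alpha>. ennreal (local_action H (\<phi> \<alpha>) (vector_derivative \<phi> (at \<alpha>)))"
  have "{a..c} = {a..b} \<union> {b<..c}" using assms by auto
  then have "action H \<phi> a c = (\<integral>\<^sup>+\<alpha>\<in>{a..b} \<union> {b<..c}. ?f \<alpha> \<partial>lborel)" by (simp add: action_def)
  also have "\<dots> = action H \<phi> a b + (\<integral>\<^sup>+\<alpha>\<in>{b<..c}. ?f \<alpha> \<partial>lborel)"
    unfolding action_def by (rule nn_integral_Un_disjoint) auto
  also have "(\<integral>\<^sup>+\<alpha>\<in>{b<..c}. ?f \<alpha> \<partial>lborel) = action H \<phi> b c"
    unfolding action_def
  proof (rule nn_integral_cong_AE)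
    have "AE x in lborel. x \<notin> {b}" by (rule AE_not_negligible) simp
    then show "AE x in lborel. ?f x * indicator {b<..c} x = ?f x * indicator {b..c} x"
      by eventually_elim (auto simp: indicator_def)
  qed
  finally show ?thesis .
qed

lemma action_AE_mono:
  assumes "negligible N"
    and "\<And>t. \<lbrakk>t \<in> {a<..<b}; t \<notin> N\<rbrakk> \<Longrightarrow>
       ennreal (local_action H (\<phi> t) (vector_derivative \<phi> (at t))) \<le> \<Lambda> t"
  shows "action H \<phi> a b \<le> (\<integral>\<^sup>+t\<in>{a..b}. \<Lambda> t \<partial>lborel)"
  unfolding action_def
proof (rule nn_integral_mono_AE)
  have "AE t in lborel. t \<notin> N \<union> {a, b}" using assms(1) by (intro AE_not_negligible) auto
  then show "AE t in lborel. ennreal (local_action H (\<phi> t) (vector_derivative \<phi> (at t))) * indicator {a..b} t \<le> \<Lambda> t * indicator {a..b} t"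
    by eventually_elim (use assms(2) in \<open>auto simp: indicator_def\<close>)
qed

lemma action_le_const:
  assumes "negligible N" "a \<le> b" "0 \<le> c"
    and "\<And>t. \<lbrakk>t \<in> {a<..<b}; t \<notin> N\<rbrakk> \<Longrightarrow> local_action H (\<phi> t) (vector_derivative \<phi> (at t)) \<le> c"
  shows "action H \<phi> a b \<le> ennreal (c * (b - a))"
proof -
  have "action H \<phi> a b \<le> (\<integral>\<^sup>+t\<in>{a..b}. ennreal c \<partial>lborel)"
    using assms by (intro action_AE_mono[OF assms(1)] ennreal_leI) auto
  also have "\<dots> = ennreal (c * (b - a))"
    using assms by (simp add: nn_integral_cmult_indicator ennreal_mult)
  finally show ?thesis .
qed

lemma action_ge_const:
  assumes "a \<le> b" "0 \<le> c"
    and "\<And>t. t \<in> {a..b} \<Longrightarrow> c \<le> local_action H (\<phi> t) (vector_derivative \<phi> (at t))"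
  shows "ennreal (c * (b - a)) \<le> action H \<phi> a b"
proof -
  have "ennreal (c * (b - a)) = (\<integral>\<^sup>+t\<in>{a..b}. ennreal c \<partial>lborel)"
    using assms by (simp add: nn_integral_cmult_indicator ennreal_mult)
  also have "\<dots> \<le> action H \<phi> a b"
    unfolding action_def using assms(3) by (intro nn_integral_mono) (auto simp: indicator_def intro!: ennreal_leI)
  finally show ?thesis .
qed

lemma action_cong:
  assumes "\<And>t. t \<in> {a<..<b} \<Longrightarrow> \<phi> t = \<omega> t"
  shows "action H \<phi> a b = action H \<omega> a b"
  unfolding action_def
proof (rule nn_integral_cong_AE)
  have "AE t in lborel. t \<notin> {a, b}" by (rule AE_not_negligible) auto
  then show "AE t in lborel. ennreal (local_action H (\<phi> t) (vector_derivative \<phi> (at t))) * indicator {a..b} t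
      = ennreal (local_action H (\<omega> t) (vector_derivative \<omega> (at t))) * indicator {a..b} t"
  proof eventually_elim
    case (elim t)
    show ?case
    proof (cases "t \<in> {a..b}")
      case True
      then have t: "t \<in> {a<..<b}" using elim by auto
      have "eventually (\<lambda>s. s \<in> {a<..<b}) (nhds t)" using t by (intro eventually_nhds_in_open) auto
      then have "eventually (\<lambda>s. s \<in> UNIV \<longrightarrow> \<phi> s = \<omega> s) (nhds t)" by eventually_elim (simp add: assms)
      then have "vector_derivative \<phi> (at t) = vector_derivative \<omega> (at t)"
        by (rule vector_derivative_cong_eq) auto
      then show ?thesis using assms[OF t] by simp
    qed simp
  qed
qed

section \<open>Hamiltonians and local actions\<close>

text \<open>Taylor expansion of second order along the segment from 0 to \<open>\<theta>\<close>.\<close>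

lemma theta_taylor:
  fixes h :: "'a::euclidean_space \<Rightarrow> real"
  assumes 1: "\<And>\<theta>. GDERIV h \<theta> :> h' \<theta>" and 2: "\<And>\<theta>. (h' has_derivative blinfun_apply (h'' \<theta>)) (at \<theta>)"
  obtains s where "0 < s" "s < 1" "h \<theta> = h 0 + h' 0 \<bullet> \<theta> + (\<theta> \<bullet> blinfun_apply (h'' (s *\<^sub>R \<theta>)) \<theta>) / 2"
proof -
  define diff where "diff m s = (if m = 0 then h (s *\<^sub>R \<theta>) else if m = 1 then h' (s *\<^sub>R \<theta>) \<bullet> \<theta>
     else blinfun_apply (h'' (s *\<^sub>R \<theta>)) \<theta> \<bullet> \<theta>)" for m :: nat and s :: real
  have lin: "((\<lambda>s. s *\<^sub>R \<theta>) has_derivative (\<lambda>s. s *\<^sub>R \<theta>)) (at s)" for s by (auto intro!: derivative_eq_intros)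
  have d0: "((\<lambda>s. h (s *\<^sub>R \<theta>)) has_real_derivative h' (s *\<^sub>R \<theta>) \<bullet> \<theta>) (at s)" for s
  proof -
    have "(h has_derivative (\<lambda>k. k \<bullet> h' (s *\<^sub>R \<theta>))) (at (s *\<^sub>R \<theta>))" using 1 by (simp add: gderiv_def)
    from has_derivative_compose[OF lin this]
    show ?thesis by (simp add: has_field_derivative_def inner_commute mult.commute[of _ "_ \<bullet> _"])
  qed
  have d1: "((\<lambda>s. h' (s *\<^sub>R \<theta>) \<bullet> \<theta>) has_real_derivative blinfun_apply (h'' (s *\<^sub>R \<theta>)) \<theta> \<bullet> \<theta>) (at s)" for s
  proof -
    have "((\<lambda>s. h' (s *\<^sub>R \<theta>)) has_derivative (\<lambda>k. blinfun_apply (h'' (s *\<^sub>R \<theta>)) (k *\<^sub>R \<theta>))) (at s)"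
      using has_derivative_compose[OF lin 2[of "s *\<^sub>R \<theta>"]] .
    then have "((\<lambda>s. h' (s *\<^sub>R \<theta>) \<bullet> \<theta>) has_derivative (\<lambda>k. blinfun_apply (h'' (s *\<^sub>R \<theta>)) (k *\<^sub>R \<theta>) \<bullet> \<theta>)) (at s)"
      by (rule has_derivative_inner_left)
    then show ?thesis by (simp add: has_field_derivative_def blinfun.scaleR_right mult_commute_abs)
  qed
  have "\<exists>t::real. 0 < t \<and> t < 1 \<and> h (1 *\<^sub>R \<theta>) = (\<Sum>m<2. diff m 0 / fact m * 1 ^ m) + diff 2 t / fact 2 * 1 ^ 2"
  proof (rule Maclaurin)
    show "\<forall>m t. m < 2 \<and> 0 \<le> t \<and> t \<le> 1 \<longrightarrow> DERIV (diff m) t :> diff (Suc m) t"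
      using d0 d1 by (auto simp: diff_def[abs_def] less_2_cases_iff)
  qed (auto simp: diff_def[abs_def])
  then show ?thesis using that by (auto simp: diff_def numeral_2_eq_2 inner_commute)
qed

lemma theta_quadratic_lower:
  assumes td: "theta_derivs D H H' H''" and luc: "locally_uniformly_convex D H''" and K: "compact K" "K \<subseteq> D"
  obtains m where "m > 0" "\<And>x \<theta>. x \<in> K \<Longrightarrow> H x 0 + H' x 0 \<bullet> \<theta> + m * (norm \<theta>)\<^sup>2 \<le> H x \<theta>"
proof -
  obtain m where m: "m > 0" "\<And>x \<theta> \<xi>. x \<in> K \<Longrightarrow> m * (norm \<xi>)\<^sup>2 \<le> \<xi> \<bullet> blinfun_apply (H'' x \<theta>) \<xi>"
    using luc[unfolded locally_uniformly_convex_def, rule_format, of K] K by auto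
  show ?thesis
  proof (rule that[of "m/2"])
    fix x \<theta> assume x: "x \<in> K"
    then have "x \<in> D" using K by auto
    then have gd: "GDERIV (H x) \<theta> :> H' x \<theta>" "(H' x has_derivative blinfun_apply (H'' x \<theta>)) (at \<theta>)" for \<theta>
      using td by (auto simp: theta_derivs_def)
    obtain s where "H x \<theta> = H x 0 + H' x 0 \<bullet> \<theta> + (\<theta> \<bullet> blinfun_apply (H'' x (s *\<^sub>R \<theta>)) \<theta>) / 2"
      by (rule theta_taylor[OF gd, of \<theta>])
    then show "H x 0 + H' x 0 \<bullet> \<theta> + m/2 * (norm \<theta>)\<^sup>2 \<le> H x \<theta>" using m(2)[OF x, of \<theta> "s *\<^sub>R \<theta>"] by simp
  qed (use m in auto)
qed

lemma theta_quadratic_upper: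
  assumes td: "theta_derivs D H H' H''" and K: "compact K" "K \<subseteq> D"
  obtains M where "M > 0" "\<And>x \<theta>. \<lbrakk>x \<in> K; norm \<theta> \<le> 1\<rbrakk> \<Longrightarrow> H x \<theta> \<le> H x 0 + H' x 0 \<bullet> \<theta> + M * (norm \<theta>)\<^sup>2"
proof -
  have "continuous_on (K \<times> cball 0 1) (\<lambda>(x, \<theta>). H'' x \<theta>)"
    using td K(2) unfolding theta_derivs_def by (auto elim: continuous_on_subset)
  then have "compact ((\<lambda>(x, \<theta>). H'' x \<theta>) ` (K \<times> cball 0 1))"
    by (rule compact_continuous_image) (use K in \<open>auto intro: compact_Times\<close>)
  then obtain M where M: "M > 0" "\<And>z. z \<in> (\<lambda>(x, \<theta>). H'' x \<theta>) ` (K \<times> cball 0 1) \<Longrightarrow> norm z \<le> M"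
    using compact_imp_bounded bounded_pos by metis
  show ?thesis
  proof (rule that[of M])
    fix x \<theta> assume x: "x \<in> K" and \<theta>: "norm (\<theta>::'a) \<le> 1"
    then have "x \<in> D" using K by auto
    then have gd: "GDERIV (H x) \<theta> :> H' x \<theta>" "(H' x has_derivative blinfun_apply (H'' x \<theta>)) (at \<theta>)" for \<theta>
      using td by (auto simp: theta_derivs_def)
    obtain s where s: "0 < s" "s < 1" "H x \<theta> = H x 0 + H' x 0 \<bullet> \<theta> + (\<theta> \<bullet> blinfun_apply (H'' x (s *\<^sub>R \<theta>)) \<theta>) / 2"
      by (rule theta_taylor[OF gd, of \<theta>])
    have "norm (s *\<^sub>R \<theta>) \<le> 1 * 1" unfolding norm_scaleR using s \<theta> by (intro mult_mono) auto
    then have n: "norm (H'' x (s *\<^sub>R \<theta>)) \<le> M" using x by (intro M(2)) force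
    have "\<theta> \<bullet> blinfun_apply (H'' x (s *\<^sub>R \<theta>)) \<theta> \<le> norm \<theta> * norm (blinfun_apply (H'' x (s *\<^sub>R \<theta>)) \<theta>)"
      by (rule norm_cauchy_schwarz)
    also have "\<dots> \<le> norm \<theta> * (M * norm \<theta>)"
      using norm_blinfun[of "H'' x (s *\<^sub>R \<theta>)" \<theta>] mult_right_mono[OF n norm_ge_zero[of \<theta>]]
      by (intro mult_left_mono) auto
    also have "\<dots> = M * (norm \<theta>)\<^sup>2" by (simp add: power2_eq_square)
    finally have "(\<theta> \<bullet> blinfun_apply (H'' x (s *\<^sub>R \<theta>)) \<theta>) / 2 \<le> M * (norm \<theta>)\<^sup>2"
      using M(1) by (smt (verit) zero_le_power2 mult_nonneg_nonneg field_sum_of_halves)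
    then show "H x \<theta> \<le> H x 0 + H' x 0 \<bullet> \<theta> + M * (norm \<theta>)\<^sup>2" using s(3) by simp
  qed (rule M(1))
qed

lemma sublevel_bounded:
  fixes b \<theta> :: "'a::euclidean_space"
  assumes "h + b \<bullet> \<theta> + m * (norm \<theta>)\<^sup>2 \<le> 0" "m > 0"
  shows "norm \<theta> \<le> (norm b + \<bar>h\<bar>) / m + 1"
proof (cases "norm \<theta> \<le> 1")
  case True
  then show ?thesis using assms(2) by (smt (verit) norm_ge_zero divide_nonneg_pos)
next
  case False
  have "- (b \<bullet> \<theta>) \<le> norm b * norm \<theta>" using Cauchy_Schwarz_ineq2[of b \<theta>] by linarith
  moreover have "- h \<le> \<bar>h\<bar> * norm \<theta>" using False mult_left_mono[of 1 "norm \<theta>" "\<bar>h\<bar>"] by auto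
  ultimately have "m * norm \<theta> * norm \<theta> \<le> (norm b + \<bar>h\<bar>) * norm \<theta>"
    using assms(1) by (simp add: power2_eq_square algebra_simps)
  then have "m * norm \<theta> \<le> norm b + \<bar>h\<bar>" by (rule mult_right_le_imp_le) (use False in linarith)
  then show ?thesis using assms(2) by (simp add: field_simps)
qed

lemma local_action_upper:
  assumes "H x 0 \<le> 0" "\<And>\<theta>. H x \<theta> \<le> 0 \<Longrightarrow> y \<bullet> \<theta> \<le> c"
  shows "local_action H x y \<le> c"
  unfolding local_action_def by (rule cSup_least) (use assms in auto)

lemma local_action_lower:
  assumes low: "\<And>\<theta>. h + b \<bullet> \<theta> + m * (norm \<theta>)\<^sup>2 \<le> H x \<theta>" and m: "m > 0" and \<theta>: "H x \<theta> \<le> 0"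
  shows "y \<bullet> \<theta> \<le> local_action H x y"
  unfolding local_action_def
proof (rule cSup_upper)
  show "bdd_above {y \<bullet> \<theta> |\<theta>. H x \<theta> \<le> 0}"
  proof (rule bdd_aboveI)
    fix z assume "z \<in> {y \<bullet> \<theta> |\<theta>. H x \<theta> \<le> 0}"
    then obtain \<theta> where t: "z = y \<bullet> \<theta>" "H x \<theta> \<le> 0" by auto
    have "norm \<theta> \<le> (norm b + \<bar>h\<bar>) / m + 1" using low[of \<theta>] t m by (intro sublevel_bounded) auto
    then have "norm y * norm \<theta> \<le> norm y * ((norm b + \<bar>h\<bar>) / m + 1)" by (rule mult_left_mono) simp
    then show "z \<le> norm y * ((norm b + \<bar>h\<bar>) / m + 1)" using norm_cauchy_schwarz[of y \<theta>] t by linarith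
  qed
qed (use \<theta> in auto)

text \<open>A deviation \<open>v\<close> from the drift has at most quadratic cost, by the inequality
  \<open>v \<bullet> \<theta> \<le> m |\<theta>|\<^sup>2 + |v|\<^sup>2 / (4 m)\<close>.\<close>

lemma local_action_drift:
  fixes v b :: "'a::euclidean_space"
  assumes low: "\<And>\<theta>. b \<bullet> \<theta> + m * (norm \<theta>)\<^sup>2 \<le> H x \<theta>" and m: "m > 0" and H0: "H x 0 = 0" and k: "k \<ge> 0"
  shows "local_action H x (k *\<^sub>R (b + v)) \<le> k * ((norm v)\<^sup>2 / (4 * m))"
proof (rule local_action_upper)
  fix \<theta> assume "H x \<theta> \<le> 0"
  then have "b \<bullet> \<theta> + m * (norm \<theta>)\<^sup>2 \<le> 0" using low[of \<theta>] by linarith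
  moreover have "v \<bullet> \<theta> \<le> norm v * norm \<theta>" by (rule norm_cauchy_schwarz)
  moreover have "norm v * norm \<theta> \<le> m * (norm \<theta>)\<^sup>2 + (norm v)\<^sup>2 / (4 * m)"
  proof -
    have "0 \<le> (2 * m * norm \<theta> - norm v)\<^sup>2 / (4 * m)" using m by simp
    also have "\<dots> = m * (norm \<theta>)\<^sup>2 - norm v * norm \<theta> + (norm v)\<^sup>2 / (4 * m)"
      using m by (simp add: power2_eq_square field_simps)
    finally show ?thesis by linarith
  qed
  ultimately have "(b + v) \<bullet> \<theta> \<le> (norm v)\<^sup>2 / (4 * m)" by (simp add: inner_add_left)
  from mult_left_mono[OF this k] show "k *\<^sub>R (b + v) \<bullet> \<theta> \<le> k * ((norm v)\<^sup>2 / (4 * m))" by (simp only: inner_scaleR_left)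
qed (use H0 in simp)

lemma local_action_linear_bound:
  fixes y b :: "'a::euclidean_space"
  assumes low: "\<And>\<theta>. b \<bullet> \<theta> + m * (norm \<theta>)\<^sup>2 \<le> H x \<theta>" and m: "m > 0" and H0: "H x 0 = 0"
  shows "local_action H x y \<le> (norm b / m + 1) * norm y"
proof (rule local_action_upper)
  fix \<theta> assume "H x \<theta> \<le> 0"
  then have "0 + b \<bullet> \<theta> + m * (norm \<theta>)\<^sup>2 \<le> 0" using low[of \<theta>] by linarith
  from sublevel_bounded[OF this m] have "norm \<theta> \<le> norm b / m + 1" by simp
  then have "norm y * norm \<theta> \<le> norm y * (norm b / m + 1)" by (rule mult_left_mono) simp
  then show "y \<bullet> \<theta> \<le> (norm b / m + 1) * norm y" using norm_cauchy_schwarz[of y \<theta>] by (simp add: mult.commute)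
qed (use H0 in simp)

text \<open>\<open>H\<close> vanishes at \<open>\<theta> = 0\<close>, so the action of a short segment is small compared to its length if its
  direction is almost that of the drift of \<open>H\<close> at \<open>x0\<close>.  If \<open>F\<close> were negative at \<open>(x0, 0)\<close>, the action of
  short segments at \<open>x0\<close> would be bounded below by a multiple of their length.\<close>

lemma natural_drift_hamiltonian_vanishes:
  fixes D :: "'a::euclidean_space set"
  assumes D: "open D" and H: "hamiltonian_0_plus D H" "induces D H S"
    and F: "hamiltonian D F" "induces D F S" and x0: "x0 \<in> D"
  shows "F x0 0 = 0"
proof (rule ccontr)
  assume "F x0 0 \<noteq> 0"
  moreover have "F x0 0 \<le> 0" using F(1) x0 by (simp add: hamiltonian_def)
  ultimately have neg: "F x0 0 < 0" by simp
  obtain H' H'' where Hd: "theta_derivs D H H' H''" "locally_uniformly_convex D H''" and H0: "\<And>x. x \<in> D \<Longrightarrow> H x 0 = 0"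
    using H(1) by (auto simp: hamiltonian_0_plus_def)
  obtain F' F'' where Fd: "theta_derivs D F F' F''" "locally_uniformly_convex D F''"
    and Fc: "continuous_on (D \<times> UNIV) (\<lambda>(x, \<theta>). F x \<theta>)" and F0: "\<And>x. x \<in> D \<Longrightarrow> F x 0 \<le> 0"
    using F(1) by (auto simp: hamiltonian_def)
  have op: "open (D \<times> (UNIV::'a set))" using D by (simp add: open_Times)
  have "isCont (\<lambda>(x, \<theta>). F x \<theta>) (x0, 0)" using Fc op x0 by (simp add: continuous_on_eq_continuous_at)
  then obtain \<delta> where \<delta>': "\<delta> > 0" "\<And>z. dist z (x0, 0) < \<delta> \<Longrightarrow> dist (case z of (x, \<theta>) \<Rightarrow> F x \<theta>) (F x0 0) < - F x0 0"
    unfolding continuous_at_eps_delta using neg by (metis (mono_tags, lifting) case_prod_conv neg_0_less_iff_less)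
  have \<delta>: "\<delta> > 0" "\<And>x \<theta>. dist (x, \<theta>) (x0, 0) < \<delta> \<Longrightarrow> F x \<theta> < 0"
    using \<delta>' by (force simp: dist_real_def)+
  obtain \<rho>0 where \<rho>0: "\<rho>0 > 0" "cball x0 \<rho>0 \<subseteq> D" using D x0 open_contains_cball by blast
  define \<rho> where "\<rho> = min \<rho>0 (\<delta> / 4)"
  have \<rho>: "\<rho> > 0" "cball x0 \<rho> \<subseteq> D" using \<rho>0 \<delta> by (auto simp: \<rho>_def)
  have Fneg: "F x \<theta> \<le> 0" if "x \<in> cball x0 \<rho>" "norm \<theta> \<le> \<rho>" for x \<theta>
  proof -
    have "dist (x, \<theta>) (x0, 0) \<le> dist x x0 + dist \<theta> 0" by (simp add: dist_Pair_Pair sqrt_sum_squares_le_sum)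
    also have "\<dots> < \<delta>" using that \<delta>(1) by (simp add: \<rho>_def dist_commute)
    finally show ?thesis using \<delta>(2) by (meson less_imp_le)
  qed
  have K: "compact (cball x0 \<rho>)" by simp
  obtain mF where mF: "mF > 0" "\<And>x \<theta>. x \<in> cball x0 \<rho> \<Longrightarrow> F x 0 + F' x 0 \<bullet> \<theta> + mF * (norm \<theta>)\<^sup>2 \<le> F x \<theta>"
    using theta_quadratic_lower[OF Fd K \<rho>(2)] by blast
  obtain m where m: "m > 0" "\<And>x \<theta>. x \<in> cball x0 \<rho> \<Longrightarrow> H x 0 + H' x 0 \<bullet> \<theta> + m * (norm \<theta>)\<^sup>2 \<le> H x \<theta>"
    using theta_quadratic_lower[OF Hd K \<rho>(2)] by blast
  have lowF: "\<rho> * norm y \<le> local_action F x y" if x: "x \<in> cball x0 \<rho>" for x y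
  proof (cases "y = 0")
    case True
    then show ?thesis using local_action_lower[of "F x 0" "F' x 0" mF F x 0 0] mF x F0 \<rho> by auto
  next
    case False
    have "y \<bullet> ((\<rho> / norm y) *\<^sub>R y) \<le> local_action F x y"
      using False \<rho> by (intro local_action_lower[of "F x 0" "F' x 0" mF F x, OF mF(2)[OF x] mF(1)] Fneg[OF x]) auto
    then show ?thesis using False by (simp add: dot_square_norm power2_eq_square)
  qed
  define c where "c x = H' x 0" for x
  \<comment> \<open>with this \<open>a\<close>, deviations of size \<open>2 a\<close> cost \<open>(2 a)\<^sup>2 / (4 m)\<close>, which is half of \<open>\<rho> a\<close>\<close>
  define a where "a = m * \<rho> / 2"
  have a: "a > 0" using m \<rho> by (simp add: a_def)
  obtain e :: 'a where e: "norm e = 1" using vector_choose_size[of 1] by auto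
  \<comment> \<open>the direction \<open>y\<close> is not the drift itself, which may be 0\<close>
  define u where "u = (if c x0 = 0 then e else (1 / norm (c x0)) *\<^sub>R c x0)"
  define y where "y = c x0 + a *\<^sub>R u"
  have nu: "norm u = 1" using e by (auto simp: u_def)
  have ny: "a \<le> norm y"
  proof -
    have "y = (norm (c x0) + a) *\<^sub>R u" by (auto simp: y_def u_def algebra_simps)
    then show ?thesis using nu a by simp
  qed
  have cc: "isCont c x0"
  proof -
    have *: "continuous_on (D \<times> UNIV) (\<lambda>(x, \<theta>). H' x \<theta>)" using Hd(1) by (simp only: theta_derivs_def)
    have "continuous_on D (\<lambda>x. case (x, 0::'a) of (x, \<theta>) \<Rightarrow> H' x \<theta>)"
      by (rule continuous_on_compose2[OF *]) (auto intro!: continuous_intros)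
    then show ?thesis using D x0 by (simp add: continuous_on_eq_continuous_at c_def[abs_def])
  qed
  then obtain r0 where r0: "r0 > 0" "\<And>x. dist x x0 < r0 \<Longrightarrow> dist (c x) (c x0) < a"
    using a unfolding continuous_at_eps_delta by blast
  define r where "r = min \<rho> (r0 / 2)"
  have r: "r > 0" "r \<le> \<rho>" "r < r0" using r0 \<rho> by (auto simp: r_def)
  define h where "h = r / norm y"
  have ny0: "norm y > 0" using ny a by linarith
  then have h: "h > 0" using r by (simp add: h_def)
  define \<phi> where "\<phi> t = x0 + t *\<^sub>R (h *\<^sub>R y)" for t :: real
  have \<phi>r: "dist (\<phi> t) x0 \<le> r" if "t \<in> {0..1}" for t
  proof -
    have "dist (\<phi> t) x0 = t * r" using that ny0 r(1) by (simp add: \<phi>_def dist_norm h_def)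
    also have "\<dots> \<le> 1 * r" using that r by (intro mult_right_mono) auto
    finally show ?thesis by simp
  qed
  have \<phi>d: "vector_derivative \<phi> (at t) = h *\<^sub>R y" for t
    unfolding \<phi>_def by (rule vector_derivative_at) (auto intro!: derivative_eq_intros)
  have ac: "abs_continuous_on {0..1} \<phi>"
    by (rule lipschitz_abs_continuous[where C = "norm (h *\<^sub>R y)"])
       (simp add: \<phi>_def scaleR_diff_left[symmetric] del: scaleR_scaleR)
  have \<phi>\<rho>: "\<phi> t \<in> cball x0 \<rho>" if "t \<in> {0..1}" for t
    using order_trans[OF \<phi>r[OF that] r(2)] by (simp add: dist_commute)
  then have im: "\<phi> ` {0..1} \<subseteq> cball x0 \<rho>" by (rule image_subsetI)
  obtain \<gamma> where \<gamma>: "\<gamma> \<in> weak_curves D" "(1, \<phi>) \<in> \<gamma>" "\<phi> \<in> weak_params D"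
    by (rule abs_continuous_path_curve[OF ac im \<rho>(2) UNIV_I UNIV_I])
  have "ennreal (\<rho> * (h * a) * (1 - 0)) \<le> action F \<phi> 0 1"
  proof (rule action_ge_const)
    fix t :: real assume "t \<in> {0..1}"
    have "\<rho> * (h * a) \<le> \<rho> * norm (h *\<^sub>R y)" using \<rho> h ny by auto
    also have "\<dots> \<le> local_action F (\<phi> t) (h *\<^sub>R y)" using \<phi>\<rho> \<open>t \<in> {0..1}\<close> by (intro lowF)
    finally show "\<rho> * (h * a) \<le> local_action F (\<phi> t) (vector_derivative \<phi> (at t))" by (simp add: \<phi>d)
  qed (use \<rho> h a in auto)
  also have "action F \<phi> 0 1 = S \<gamma>" using induces_action[OF F(2) \<gamma>(1,3,2)] by simp
  also have "S \<gamma> = action H \<phi> 0 1" using induces_action[OF H(2) \<gamma>(1,3,2)] by simp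
  also have "\<dots> \<le> ennreal (h * ((2 * a)\<^sup>2 / (4 * m)) * (1 - 0))"
  proof (rule action_le_const[of "{}"])
    fix t :: real assume "t \<in> {0<..<1}"
    then have t: "\<phi> t \<in> cball x0 \<rho>" "dist (\<phi> t) x0 < r0" using \<phi>\<rho>[of t] \<phi>r[of t] r by auto
    then have "\<phi> t \<in> D" using \<rho> by auto
    define v where "v = a *\<^sub>R u + (c x0 - c (\<phi> t))"
    have "norm v \<le> norm (a *\<^sub>R u) + norm (c x0 - c (\<phi> t))" unfolding v_def by (rule norm_triangle_ineq)
    also have "\<dots> \<le> 2 * a" using nu a r0(2)[OF t(2)] by (simp add: dist_norm norm_minus_commute)
    finally have v: "norm v \<le> 2 * a" .
    have "local_action H (\<phi> t) (h *\<^sub>R (c (\<phi> t) + v)) \<le> h * ((norm v)\<^sup>2 / (4 * m))"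
      using m(2)[OF t(1)] H0[OF \<open>\<phi> t \<in> D\<close>] h m(1) by (intro local_action_drift) (auto simp: c_def)
    also have "c (\<phi> t) + v = y" by (simp add: v_def y_def)
    also have "h * ((norm v)\<^sup>2 / (4 * m)) \<le> h * ((2 * a)\<^sup>2 / (4 * m))"
      using v h m by (intro mult_left_mono divide_right_mono power_mono) auto
    finally show "local_action H (\<phi> t) (vector_derivative \<phi> (at t)) \<le> h * ((2 * a)\<^sup>2 / (4 * m))" by (simp add: \<phi>d)
  qed (use h m in auto)
  finally have "\<rho> * (h * a) \<le> h * ((2 * a)\<^sup>2 / (4 * m))" using h m a by simp
  also have "h * ((2 * a)\<^sup>2 / (4 * m)) = \<rho> * (h * a) / 2" using m by (simp add: a_def power2_eq_square field_simps)
  finally show False using \<rho> h a by simp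
qed

section \<open>Solutions of the drift equation and the limit cycle\<close>

lemma C1_on_compact_lipschitz:
  assumes b: "C1_on D b" and D: "open D" and K: "compact K" "K \<subseteq> D"
  obtains B where "B-lipschitz_on K b"
proof -
  obtain b' :: "'a \<Rightarrow> 'a \<Rightarrow>\<^sub>L 'a" where b': "\<And>x. x \<in> D \<Longrightarrow> (b has_derivative blinfun_apply (b' x)) (at x)" "continuous_on D b'"
    using b by (auto simp: C1_on_def)
  have "local_lipschitz (UNIV::real set) D (\<lambda>t. b)"
  proof (rule c1_implies_local_lipschitz[where f' = "\<lambda>(t, x). b' x"])
    show "continuous_on (UNIV \<times> D) (\<lambda>(t::real, x). b' x)"
      unfolding case_prod_beta by (rule continuous_on_compose2[OF b'(2)]) (auto intro!: continuous_intros)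
  qed (use b' D in auto)
  then have "local_lipschitz {0::real} K (\<lambda>t. b)" by (rule local_lipschitz_subset) (use K in auto)
  from local_lipschitz_compact_implies_lipschitz[OF this K(1)] that show ?thesis by auto
qed

text \<open>\<open>w\<close> is a solution of \<open>w' = b(w)\<close> that is defined for all times.\<close>

definition solves :: "('a::euclidean_space \<Rightarrow> 'a) \<Rightarrow> (real \<Rightarrow> 'a) \<Rightarrow> bool" where
  "solves b w \<longleftrightarrow> (\<forall>t. (w has_vector_derivative b (w t)) (at t))"

lemma solves_continuous: "solves b w \<Longrightarrow> continuous_on A w"
  unfolding solves_def by (meson continuous_at_imp_continuous_on has_vector_derivative_continuous)

lemma solves_shift: "solves b w \<Longrightarrow> solves b (\<lambda>t. w (s + t))"
  unfolding solves_def
proof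
  fix t assume "\<forall>t. (w has_vector_derivative b (w t)) (at t)"
  then have "(w has_vector_derivative b (w (s + t))) (at (s + t))" by blast
  then have "(w has_vector_derivative b (w (s + t))) (at (s + t) within range ((+) s))"
    by (rule has_vector_derivative_at_within)
  moreover have "((+) s has_vector_derivative 1) (at t)" by (auto intro!: derivative_eq_intros)
  ultimately have "(w \<circ> (+) s has_vector_derivative 1 *\<^sub>R b (w (s + t))) (at t)" by (intro vector_diff_chain_within)
  then show "((\<lambda>t. w (s + t)) has_vector_derivative b (w (s + t))) (at t)"
    by (simp add: o_def)
qed

text \<open>Uniqueness by a Gronwall argument: \<open>e\<^bsup>-2Bt\<^esup> |u - v|\<^sup>2\<close> is nonincreasing.\<close>

lemma solution_unique_forward:
  fixes u v :: "real \<Rightarrow> 'a::euclidean_space"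
  assumes lip: "\<And>K. compact K \<Longrightarrow> K \<subseteq> D \<Longrightarrow> \<exists>B. B-lipschitz_on K b"
    and u: "solves b u" "range u \<subseteq> D" and v: "solves b v" "range v \<subseteq> D" and 0: "u 0 = v 0" and T: "T \<ge> 0"
  shows "u T = v T"
proof -
  define K where "K = u ` {0..T} \<union> v ` {0..T}"
  have "compact K" unfolding K_def
    by (intro compact_Un compact_continuous_image solves_continuous[OF u(1)] solves_continuous[OF v(1)]) auto
  moreover have "K \<subseteq> D" using u v by (auto simp: K_def)
  ultimately obtain B where B: "B-lipschitz_on K b" using lip by blast
  define g where "g t = exp (-2 * B * t) * ((u t - v t) \<bullet> (u t - v t))" for t
  have "g T \<le> g 0"
  proof (rule DERIV_nonpos_imp_nonincreasing[OF T])
    fix t assume t: "0 \<le> t" "t \<le> T"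
    have du: "(u has_vector_derivative b (u t)) (at t)" "(v has_vector_derivative b (v t)) (at t)"
      using u v by (auto simp: solves_def)
    then have dw: "((\<lambda>t. u t - v t) has_vector_derivative (b (u t) - b (v t))) (at t)"
      by (rule has_vector_derivative_diff)
    have dd: "((\<lambda>t. (u t - v t) \<bullet> (u t - v t)) has_real_derivative 2 * ((u t - v t) \<bullet> (b (u t) - b (v t)))) (at t)"
    proof -
      have "((\<lambda>t. (u t - v t) \<bullet> (u t - v t)) has_derivative
          (\<lambda>h. (u t - v t) \<bullet> (h *\<^sub>R (b (u t) - b (v t))) + (h *\<^sub>R (b (u t) - b (v t))) \<bullet> (u t - v t))) (at t)"
        using dw unfolding has_vector_derivative_def by (intro has_derivative_inner)
      then show ?thesis
        by (simp add: has_field_derivative_def inner_commute algebra_simps mult_commute_abs cong: if_cong)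
           (auto simp: inner_commute algebra_simps elim!: has_derivative_eq_rhs intro!: ext)
    qed
    define D' where "D' = exp (-2 * B * t) * (2 * ((u t - v t) \<bullet> (b (u t) - b (v t)))) +
        (exp (-2 * B * t) * (-2 * B)) * ((u t - v t) \<bullet> (u t - v t))"
    have "(g has_real_derivative D') (at t)"
      unfolding g_def D'_def by (rule DERIV_cong[OF DERIV_mult[OF _ dd]]) (auto intro!: derivative_eq_intros)
    moreover have "D' \<le> 0"
    proof -
      have "(u t - v t) \<bullet> (b (u t) - b (v t)) \<le> norm (u t - v t) * norm (b (u t) - b (v t))"
        by (rule norm_cauchy_schwarz)
      also have "\<dots> \<le> norm (u t - v t) * (B * norm (u t - v t))"
        using lipschitz_onD[OF B, of "u t" "v t"] t by (intro mult_left_mono) (auto simp: K_def dist_norm)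
      also have "\<dots> = B * ((u t - v t) \<bullet> (u t - v t))" by (simp add: dot_square_norm power2_eq_square)
      finally have "exp (-2 * B * t) * ((u t - v t) \<bullet> (b (u t) - b (v t))) \<le> exp (-2 * B * t) * (B * ((u t - v t) \<bullet> (u t - v t)))"
        by (rule mult_left_mono) simp
      then show ?thesis by (simp add: D'_def algebra_simps)
    qed
    ultimately show "\<exists>y. (g has_real_derivative y) (at t) \<and> y \<le> 0" by blast
  qed
  then have "exp (-2 * B * T) * ((u T - v T) \<bullet> (u T - v T)) \<le> 0" using 0 by (simp add: g_def)
  then have "(u T - v T) \<bullet> (u T - v T) \<le> 0" by (simp add: mult_le_0_iff)
  then show ?thesis by (simp add: inner_gt_zero_iff[symmetric] not_less[symmetric] del: inner_gt_zero_iff) (metis inner_gt_zero_iff right_minus_eq not_less)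
qed

lemma solves_reverse: "solves b w \<Longrightarrow> solves (\<lambda>x. - b x) (\<lambda>t. w (- t))"
  unfolding solves_def
proof
  fix t :: real assume "\<forall>t. (w has_vector_derivative b (w t)) (at t)"
  then have "(w has_vector_derivative b (w (- t))) (at (- t) within range uminus)"
    by (auto intro: has_vector_derivative_at_within)
  moreover have "(uminus has_vector_derivative (- 1::real)) (at t)" by (auto intro!: derivative_eq_intros)
  ultimately have "(w \<circ> uminus has_vector_derivative - 1 *\<^sub>R b (w (- t))) (at t)" by (intro vector_diff_chain_within)
  then show "((\<lambda>t. w (- t)) has_vector_derivative - b (w (- t))) (at t)"
    by (simp add: o_def)
qed

lemma solution_unique:
  fixes u v :: "real \<Rightarrow> 'a::euclidean_space"
  assumes lip: "\<And>K. compact K \<Longrightarrow> K \<subseteq> D \<Longrightarrow> \<exists>B. B-lipschitz_on K b"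
    and u: "solves b u" "range u \<subseteq> D" and v: "solves b v" "range v \<subseteq> D" and 0: "u 0 = v 0"
  shows "u t = v t"
proof (cases "t \<ge> 0")
  case True
  then show ?thesis using solution_unique_forward[OF lip u v 0] by blast
next
  case False
  have "(\<lambda>t. u (- t)) (- t) = (\<lambda>t. v (- t)) (- t)"
  proof (rule solution_unique_forward[of D "\<lambda>x. - b x" "\<lambda>t. u (- t)" "\<lambda>t. v (- t)"])
    fix K assume "compact K" "K \<subseteq> D"
    then obtain B where "B-lipschitz_on K b" using lip by blast
    then have "B-lipschitz_on K (\<lambda>x. - b x)" by (simp add: lipschitz_on_def dist_minus)
    then show "\<exists>B. B-lipschitz_on K (\<lambda>x. - b x)" by blast
  qed (use u v 0 False solves_reverse in auto)
  then show ?thesis by simp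
qed

text \<open>By uniqueness, the solution that parameterizes the cycle is periodic, and it does not pass through
  an equilibrium because it would rest there.\<close>

lemma limit_cycle_orbit:
  fixes D :: "'a::euclidean_space set"
  assumes D: "open D" and b: "C1_on D b" and \<psi>: "flow_of D b \<psi>" and L: "limit_cycle b \<psi> L" "L \<subseteq> D"
  obtains T w where "T > 0" "solves b w" "\<And>t. w (t + T) = w t" "range w = L" "w ` {0..T} = L" "\<And>t. b (w t) \<noteq> 0"
proof -
  obtain x T where x: "x \<in> L" "T > 0" "b x \<noteq> 0" "L = \<psi> x ` {0..<T}" "\<psi> x T = x"
    using L(1) by (auto simp: limit_cycle_def)
  have xD: "x \<in> D" using x L by auto
  define w where "w = \<psi> x"
  have w: "solves b w" "range w \<subseteq> D" "w 0 = x" using \<psi> xD by (auto simp: flow_of_def solves_def w_def)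
  have lip: "\<exists>B. B-lipschitz_on K b" if "compact K" "K \<subseteq> D" for K
    using C1_on_compact_lipschitz[OF b D that] by blast
  have per: "w (t + T) = w t" for t
  proof -
    have "w (T + t) = w t"
      by (rule solution_unique[OF lip solves_shift[OF w(1)] _ w(1,2)]) (use w x in \<open>auto simp: w_def\<close>)
    then show ?thesis by (simp add: add.commute)
  qed
  have perz: "w (t + real_of_int k * T) = w t" for t k
  proof (induction k rule: int_induct[where k = 0])
    case (step1 i)
    then show ?case using per[of "t + real_of_int i * T"] by (simp add: algebra_simps)
  next
    case (step2 i)
    then show ?case using per[of "t + real_of_int (i - 1) * T"] by (simp add: algebra_simps)
  qed simp
  have red: "w t \<in> w ` {0..<T}" for t
  proof -
    define k where "k = \<lfloor>t / T\<rfloor>"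
    have "real_of_int k \<le> t / T" "t / T < real_of_int k + 1" by (auto simp: k_def)
    then have "t + real_of_int (- k) * T \<in> {0..<T}" using x(2) by (simp add: field_simps)
    moreover have "w t = w (t + real_of_int (- k) * T)" using perz by metis
    ultimately show ?thesis by blast
  qed
  have "w ` {0..<T} = L" using x(4) by (simp add: w_def)
  then have rng: "range w = L" using red by blast
  have "L \<subseteq> w ` {0..T}" using \<open>w ` {0..<T} = L\<close> by fastforce
  then have "w ` {0..T} = L" using rng by blast
  moreover have "b (w t) \<noteq> 0" for t
  proof
    assume 0: "b (w t) = 0"
    have eq: "solves b (\<lambda>_. w t)" using 0 by (auto simp: solves_def)
    have "w (t + s) = w t" for s
      using solution_unique[where u = "\<lambda>r. w (t + r)" and v = "\<lambda>_. w t" and t = s, OF lip solves_shift[OF w(1)] _ eq] w by auto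
    from this[of "- t"] have "w t = x" using w by simp
    then show False using 0 x by simp
  qed
  ultimately show ?thesis using that[of T w] x(2) w(1) per rng by blast
qed

text \<open>Any two points of the cycle are connected by the flow in a time \<open>s\<close> between one and two periods.\<close>

lemma limit_cycle_connect:
  assumes T: "T > 0" and w: "solves b w" and per: "\<And>t. w (t + T) = w t" and rng: "w ` {0..T} = L"
    and z: "z \<in> L" "z2 \<in> L"
  obtains v s where "solves b v" "v 0 = z" "v s = z2" "T \<le> s" "s \<le> 2 * T" "range v = range w"
proof -
  obtain t t2 where t: "t \<in> {0..T}" "w t = z" "t2 \<in> {0..T}" "w t2 = z2" using z unfolding rng[symmetric] by auto
  define k where "k = (if t2 \<ge> t then 1 else 2 :: real)"
  have "w (t2 + k * T) = w t2" using per[of t2] per[of "t2 + T"] by (auto simp: k_def algebra_simps)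
  moreover have "T \<le> t2 + k * T - t" "t2 + k * T - t \<le> 2 * T" using t by (auto simp: k_def)
  moreover have "range (\<lambda>r. w (t + r)) = range w"
  proof -
    have "w r = w (t + (r - t))" for r by simp
    then show ?thesis by (metis (mono_tags, lifting) image_subset_iff range_eqI subset_antisym)
  qed
  ultimately show ?thesis using t that[of "\<lambda>r. w (t + r)" "t2 + k * T - t"] solves_shift[OF w, of t] by auto
qed

text \<open>A periodic orbit without equilibria is a null set if the dimension is at least 2, and impossible
  in dimension 1, where the solution would have a vanishing derivative at its maximum.\<close>

lemma limit_cycle_empty_interior:
  fixes w :: "real \<Rightarrow> 'a::euclidean_space"
  assumes T: "T > 0" and w: "solves b w" and rng: "range w = w ` {0..T}" and nz: "\<And>t. b (w t) \<noteq> 0" and r: "r > 0"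
  shows "\<not> ball x r \<subseteq> range w"
proof (cases "DIM('a) = 1")
  case True
  then obtain e :: 'a where e: "Basis = {e}" by (metis card_1_singletonE)
  define f where "f t = w t \<bullet> e" for t
  have "continuous_on {0..T} f" unfolding f_def by (intro continuous_intros solves_continuous[OF w])
  from continuous_attains_sup[OF _ _ this] T obtain t where t: "t \<in> {0..T}" "\<And>s. s \<in> {0..T} \<Longrightarrow> f s \<le> f t"
    by auto
  have max: "f s \<le> f t" for s
  proof -
    have "w s \<in> w ` {0..T}" using rng by blast
    then obtain s' where "s' \<in> {0..T}" "w s = w s'" by auto
    then show ?thesis using t(2)[of s'] by (simp add: f_def)
  qed
  have "(w has_vector_derivative b (w t)) (at t)" using w by (simp add: solves_def)
  then have "((\<lambda>t. w t \<bullet> e) has_derivative (\<lambda>h. (h *\<^sub>R b (w t)) \<bullet> e)) (at t)"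
    unfolding has_vector_derivative_def by (rule has_derivative_inner_left)
  then have "(f has_real_derivative b (w t) \<bullet> e) (at t)"
    by (simp add: has_field_derivative_def f_def[abs_def] mult_commute_abs)
  then have "b (w t) \<bullet> e = 0" by (rule DERIV_local_max[of _ _ _ 1]) (use max in auto)
  then have "b (w t) = 0" using e by (metis euclidean_eq_iff inner_zero_left singletonD)
  then show ?thesis using nz by blast
next
  case False
  then have "DIM(real) < DIM('a)" using DIM_positive[where 'a = 'a] by (simp add: Suc_lessI)
  moreover have "w differentiable_on UNIV"
    using w unfolding differentiable_on_def solves_def has_vector_derivative_def differentiable_def by blast
  ultimately have "negligible (range w)" by (rule negligible_differentiable_image_lowdim)
  then show ?thesis using open_not_negligible[of "ball x r"] negligible_subset r by (metis ball_eq_empty not_less open_ball)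
qed

section \<open>A barrier near a point of the limit cycle\<close>

text \<open>Where \<open>b \<bullet> \<beta>\<close> is positive, a trajectory can be parameterized by its coordinate \<open>(x - z) \<bullet> \<beta>\<close>.  The
  resulting \<open>v\<close> satisfies \<open>v' \<bullet> \<beta> = 1\<close>.\<close>

lemma trajectory_as_graph:
  fixes w :: "real \<Rightarrow> 'a::euclidean_space"
  assumes w: "solves b w" "w 0 = z" and q: "q > 0" and \<rho>: "\<rho> > 0"
    and pos: "\<And>x. x \<in> cball z \<rho> \<Longrightarrow> q \<le> b x \<bullet> \<beta>" and Bm: "\<And>x. x \<in> cball z \<rho> \<Longrightarrow> norm (b x) \<le> Bm"
  obtains s1 v where "s1 > 0" "v 0 = z"
    "\<And>s. \<bar>s\<bar> < s1 \<Longrightarrow> v s \<in> cball z \<rho> \<and> v s \<in> range w \<and> norm (v s - z) \<le> Bm / q * \<bar>s\<bar>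
       \<and> (v has_vector_derivative (1 / (b (v s) \<bullet> \<beta>)) *\<^sub>R b (v s)) (at s)"
proof -
  have wd: "(w has_vector_derivative b (w t)) (at t)" for t using w by (simp add: solves_def)
  have "isCont w 0" using wd by (rule has_vector_derivative_continuous)
  then obtain t0 where t0: "t0 > 0" "\<And>t. dist t 0 < t0 \<Longrightarrow> dist (w t) (w 0) < \<rho>"
    using \<rho> unfolding continuous_at_eps_delta by blast
  define t1 where "t1 = t0 / 2"
  have t1: "t1 > 0" using t0 by (simp add: t1_def)
  have wc: "w t \<in> cball z \<rho>" if "\<bar>t\<bar> \<le> t1" for t
    using t0(2)[of t] that t0(1) w(2) by (simp add: t1_def dist_real_def dist_commute less_imp_le)
  define \<tau> where "\<tau> t = (w t - z) \<bullet> \<beta>" for t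
  have td: "(\<tau> has_real_derivative b (w t) \<bullet> \<beta>) (at t)" for t
  proof -
    have "((\<lambda>t. (w t - z) \<bullet> \<beta>) has_derivative (\<lambda>h. (h *\<^sub>R b (w t)) \<bullet> \<beta>)) (at t)"
      using wd[of t] unfolding has_vector_derivative_def
      by (intro has_derivative_inner_left) (auto intro!: derivative_eq_intros)
    then show ?thesis by (simp add: has_field_derivative_def \<tau>_def[abs_def] mult_commute_abs)
  qed
  have t00: "\<tau> 0 = 0" by (simp add: \<tau>_def w)
  have grow: "q * (t' - t) \<le> \<tau> t' - \<tau> t" if "- t1 \<le> t" "t \<le> t'" "t' \<le> t1" for t t'
  proof (cases "t = t'")
    case False
    then have "t < t'" using that by simp
    then obtain c where c: "t < c" "c < t'" "\<tau> t' - \<tau> t = (t' - t) * (b (w c) \<bullet> \<beta>)"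
      using MVT2[of t t' \<tau> "\<lambda>t. b (w t) \<bullet> \<beta>"] td by blast
    have "q \<le> b (w c) \<bullet> \<beta>" using c that by (intro pos wc) auto
    then have "(t' - t) * q \<le> (t' - t) * (b (w c) \<bullet> \<beta>)" using \<open>t < t'\<close> by (intro mult_left_mono) auto
    then show ?thesis using c by (simp add: mult.commute)
  qed simp
  define s1 where "s1 = q * t1"
  have s1: "s1 > 0" using q t1 by (simp add: s1_def)
  have ex: "\<exists>t. \<bar>t\<bar> \<le> t1 \<and> \<tau> t = s" if "\<bar>s\<bar> \<le> s1" for s
  proof -
    have "\<tau> (- t1) \<le> s" "s \<le> \<tau> t1" using grow[of "- t1" 0] grow[of 0 t1] t00 t1 that by (auto simp: s1_def)
    moreover have "continuous_on {- t1..t1} \<tau>" using td by (intro DERIV_continuous_on) (auto intro: has_field_derivative_at_within)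
    ultimately have "\<exists>t\<ge>- t1. t \<le> t1 \<and> \<tau> t = s" using t1 by (intro IVT') auto
    then obtain t where "- t1 \<le> t" "t \<le> t1" "\<tau> t = s" by blast
    then show ?thesis by (intro exI[of _ t]) auto
  qed
  define \<sigma> where "\<sigma> s = (SOME t. \<bar>t\<bar> \<le> t1 \<and> \<tau> t = s)" for s
  have \<sigma>: "\<bar>\<sigma> s\<bar> \<le> t1" "\<tau> (\<sigma> s) = s" if "\<bar>s\<bar> \<le> s1" for s
    using someI_ex[OF ex[OF that]] by (auto simp: \<sigma>_def)
  have \<sigma>lip: "\<bar>\<sigma> s' - \<sigma> s\<bar> \<le> \<bar>s' - s\<bar> / q" if "\<bar>s\<bar> \<le> s1" "\<bar>s'\<bar> \<le> s1" for s s'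
  proof -
    have "q * (\<sigma> s' - \<sigma> s) \<le> s' - s" if "\<sigma> s \<le> \<sigma> s'"
      using grow[of "\<sigma> s" "\<sigma> s'"] \<sigma>[OF \<open>\<bar>s\<bar> \<le> s1\<close>] \<sigma>[OF \<open>\<bar>s'\<bar> \<le> s1\<close>] that by auto
    moreover have "q * (\<sigma> s - \<sigma> s') \<le> s - s'" if "\<sigma> s' \<le> \<sigma> s"
      using grow[of "\<sigma> s'" "\<sigma> s"] \<sigma>[OF \<open>\<bar>s\<bar> \<le> s1\<close>] \<sigma>[OF \<open>\<bar>s'\<bar> \<le> s1\<close>] that by auto
    ultimately have "q * \<bar>\<sigma> s' - \<sigma> s\<bar> \<le> \<bar>s' - s\<bar>" by (cases "\<sigma> s \<le> \<sigma> s'") auto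
    then show ?thesis using q by (simp add: pos_le_divide_eq mult.commute)
  qed
  have \<sigma>0: "\<sigma> 0 = 0"
    using grow[of 0 "\<sigma> 0"] grow[of "\<sigma> 0" 0] \<sigma>[of 0] s1 t00 q t1 
    by (cases "\<sigma> 0 \<ge> 0") (auto simp: mult_le_0_iff zero_le_mult_iff)
  have \<sigma>d: "(\<sigma> has_real_derivative inverse (b (w (\<sigma> s)) \<bullet> \<beta>)) (at s)" if s: "\<bar>s\<bar> < s1" for s
  proof (rule DERIV_inverse_function[of \<tau> _ _ _ "- s1" s1])
    show "(\<tau> has_real_derivative b (w (\<sigma> s)) \<bullet> \<beta>) (at (\<sigma> s))" by (rule td)
    have "q \<le> b (w (\<sigma> s)) \<bullet> \<beta>" using \<sigma>(1)[of s] s by (intro pos wc) auto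
    then show "b (w (\<sigma> s)) \<bullet> \<beta> \<noteq> 0" using q by auto
    show "isCont \<sigma> s"
      unfolding continuous_at_eps_delta
    proof (intro allI impI)
      fix e :: real assume "e > 0"
      show "\<exists>d>0. \<forall>x'. dist x' s < d \<longrightarrow> dist (\<sigma> x') (\<sigma> s) < e"
      proof (intro exI[of _ "min (q * e) (s1 - \<bar>s\<bar>)"] conjI allI impI)
        fix x' assume x': "dist x' s < min (q * e) (s1 - \<bar>s\<bar>)"
        then have "\<bar>x'\<bar> \<le> s1" "\<bar>x' - s\<bar> < q * e" by (auto simp: dist_real_def)
        then have "\<bar>\<sigma> x' - \<sigma> s\<bar> \<le> \<bar>x' - s\<bar> / q" using \<sigma>lip[of s x'] s by auto
        also have "\<dots> < e" using \<open>\<bar>x' - s\<bar> < q * e\<close> q by (simp add: pos_divide_less_eq mult.commute)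
        finally show "dist (\<sigma> x') (\<sigma> s) < e" by (simp add: dist_real_def)
      qed (use \<open>e > 0\<close> q s in auto)
    qed
  qed (use s \<sigma> in auto)
  define v where "v s = w (\<sigma> s)" for s
  have wn: "norm (w t - z) \<le> Bm * \<bar>t\<bar>" if "\<bar>t\<bar> \<le> t1" for t
  proof -
    have "norm (w t - w 0) \<le> Bm * norm (t - 0)"
    proof (rule differentiable_bound[of "{- t1..t1}" w "\<lambda>t h. h *\<^sub>R b (w t)"])
      fix x assume x: "x \<in> {- t1..t1}"
      show "(w has_derivative (\<lambda>h. h *\<^sub>R b (w x))) (at x within {- t1..t1})"
        using wd[of x] unfolding has_vector_derivative_def by (rule has_derivative_at_withinI)
      have "norm (b (w x)) \<le> Bm" using x by (intro Bm wc) auto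
      moreover have "onorm (\<lambda>h::real. h *\<^sub>R b (w x)) \<le> norm (b (w x))"
        by (rule onorm_le) (simp add: mult.commute)
      ultimately show "onorm (\<lambda>h::real. h *\<^sub>R b (w x)) \<le> Bm" by linarith
    qed (use that t1 in auto)
    then show ?thesis using w by simp
  qed
  show ?thesis
  proof (rule that[OF s1, of v])
    show "v 0 = z" by (simp add: v_def \<sigma>0 w)
    fix s assume s: "\<bar>s\<bar> < s1"
    have Bm0: "Bm \<ge> 0" using Bm[of z] \<rho> norm_ge_zero order_trans by (metis centre_in_cball less_imp_le)
    have "norm (v s - z) \<le> Bm * \<bar>\<sigma> s\<bar>" unfolding v_def using \<sigma>(1)[of s] s by (intro wn) auto
    also have "\<dots> \<le> Bm * (\<bar>s\<bar> / q)" using \<sigma>lip[of 0 s] \<sigma>0 s s1 Bm0 by (intro mult_left_mono) auto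
    finally have 1: "norm (v s - z) \<le> Bm / q * \<bar>s\<bar>" by simp
    have 2: "v s \<in> cball z \<rho>" unfolding v_def using \<sigma>(1)[of s] s by (intro wc) auto
    have "(w \<circ> \<sigma> has_vector_derivative inverse (b (w (\<sigma> s)) \<bullet> \<beta>) *\<^sub>R b (w (\<sigma> s))) (at s)"
      using \<sigma>d[OF s] wd by (intro vector_diff_chain_at) (auto simp: has_real_derivative_iff_has_vector_derivative)
    then have 3: "(v has_vector_derivative (1 / (b (v s) \<bullet> \<beta>)) *\<^sub>R b (v s)) (at s)"
      by (simp add: v_def[abs_def] o_def inverse_eq_divide)
    show "v s \<in> cball z \<rho> \<and> v s \<in> range w \<and> norm (v s - z) \<le> Bm / q * \<bar>s\<bar>
       \<and> (v has_vector_derivative (1 / (b (v s) \<bullet> \<beta>)) *\<^sub>R b (v s)) (at s)"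
      using 1 2 3 by (auto simp: v_def)
  qed
qed

text \<open>Let \<open>\<beta> = b z\<close> and \<open>s x = (x - z) \<bullet> \<beta>\<close>, and let \<open>v\<close> be the trajectory parameterized by this
  coordinate.  With \<open>\<omega> x = x - v (s x)\<close>, the barrier is \<open>f x = - \<kappa> |\<omega> x|\<^sup>2 / (a - s x)\<close>; it solves
  \<open>b \<bullet> \<nabla>f + M |\<nabla>f|\<^sup>2 \<le> 0\<close> for small \<open>a\<close>: along the flow the factor \<open>-1/(a - s)\<close> decreases at a rate of
  order \<open>1/a\<^sup>2\<close>, whereas \<open>|\<omega>|\<^sup>2\<close> changes at a rate of order \<open>|\<omega>|\<^sup>2\<close>, and for small \<open>\<kappa>\<close> the quadratic term is
  dominated as well.  The constant \<open>\<kappa>\<close> does not depend on the scale \<open>a\<close>.\<close>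

lemma barrier:
  fixes w :: "real \<Rightarrow> 'a::euclidean_space"
  assumes w: "solves b w" "w 0 = z" and bz: "b z \<noteq> 0" and \<rho>: "\<rho> > 0" and B: "B-lipschitz_on (cball z \<rho>) b" and M: "M > 0"
  obtains \<kappa> a0 where "\<kappa> > 0" "a0 > 0"
    "\<And>a. \<lbrakk>0 < a; a < a0\<rbrakk> \<Longrightarrow> \<exists>f \<theta> r. 0 < r \<and> r \<le> \<rho> \<and> f z = 0 \<and>
       (\<forall>x\<in>cball z r. (f has_derivative (\<lambda>y. y \<bullet> \<theta> x)) (at x) \<and> b x \<bullet> \<theta> x + M * (norm (\<theta> x))\<^sup>2 \<le> 0 \<and>
          norm (\<theta> x) \<le> 1 \<and> f x \<le> - (\<kappa> / a) * (infdist x (range w))\<^sup>2)"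
proof -
  define \<beta> where "\<beta> = b z"
  define n where "n = norm \<beta>"
  have n: "n > 0" using bz by (simp add: n_def \<beta>_def)
  define q where "q = n\<^sup>2 / 2"
  have q: "q > 0" using n by (simp add: q_def)
  have B0: "B \<ge> 0" using B by (rule lipschitz_on_nonneg)
  \<comment> \<open>on this smaller ball \<open>b\<close> differs from \<open>b z\<close> by at most half of its size\<close>
  define \<rho>1 where "\<rho>1 = min \<rho> (n / (2 * (B + 1)))"
  have \<rho>1: "\<rho>1 > 0" "\<rho>1 \<le> \<rho>" "B * \<rho>1 \<le> n / 2"
  proof -
    have "B * \<rho>1 \<le> (B + 1) * (n / (2 * (B + 1)))" using B0 n \<rho> by (intro mult_mono) (auto simp: \<rho>1_def)
    also have "\<dots> = n / 2"
    proof -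
      have "B + 1 \<noteq> 0" using B0 by simp
      then show ?thesis by (simp add: divide_simps)
    qed
    finally show "B * \<rho>1 \<le> n / 2" .
  qed (use \<rho> n B0 in \<open>auto simp: \<rho>1_def\<close>)
  have lip: "norm (b x - b y) \<le> B * norm (x - y)" if "x \<in> cball z \<rho>1" "y \<in> cball z \<rho>1" for x y
    using lipschitz_onD[OF B, of x y] that \<rho>1 by (auto simp: dist_norm)
  have near: "norm (b x - \<beta>) \<le> n / 2" if "x \<in> cball z \<rho>1" for x
  proof -
    have "norm (b x - \<beta>) \<le> B * norm (x - z)" unfolding \<beta>_def using that \<rho>1 by (intro lip) auto
    also have "\<dots> \<le> B * \<rho>1" using that B0 by (intro mult_left_mono) (auto simp: dist_norm norm_minus_commute)
    finally show ?thesis using \<rho>1 by linarith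
  qed
  have pos: "q \<le> b x \<bullet> \<beta>" if "x \<in> cball z \<rho>1" for x
  proof -
    have "\<bar>(b x - \<beta>) \<bullet> \<beta>\<bar> \<le> norm (b x - \<beta>) * norm \<beta>" by (rule Cauchy_Schwarz_ineq2)
    also have "\<dots> \<le> n / 2 * n" unfolding n_def[symmetric] using near[OF that] n by (intro mult_right_mono) auto
    finally have "\<bar>b x \<bullet> \<beta> - n\<^sup>2\<bar> \<le> n\<^sup>2 / 2" by (simp add: inner_diff_left dot_square_norm n_def power2_eq_square)
    then show ?thesis unfolding q_def by linarith
  qed
  define Bm where "Bm = 2 * n"
  have Bm: "norm (b x) \<le> Bm" if "x \<in> cball z \<rho>1" for x
    using near[OF that] norm_triangle_ineq2[of "b x" \<beta>] n unfolding Bm_def n_def by linarith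
  obtain s1 v where s1: "s1 > 0" and v0: "v 0 = z" and v: "\<And>s. \<bar>s\<bar> < s1 \<Longrightarrow> v s \<in> cball z \<rho>1 \<and> v s \<in> range w \<and> norm (v s - z) \<le> Bm / q * \<bar>s\<bar>
       \<and> (v has_vector_derivative (1 / (b (v s) \<bullet> \<beta>)) *\<^sub>R b (v s)) (at s)"
    by (rule trajectory_as_graph[OF w q \<rho>1(1) pos Bm]; (assumption | (rule that; (assumption | simp))))
  define U where "U = Bm / q"
  have U: "U > 0" using n q by (simp add: U_def Bm_def)
  define W where "W = 1 / (2 * n) + U / 2"
  have W: "W > 0" using n U by (auto simp: W_def intro!: add_pos_pos)
  define B1 where "B1 = B * (1 + U * n)"
  have B1: "B1 \<ge> 0" using B0 U n by (simp add: B1_def)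
  define E where "E = 4 * (1 + U * n) + 4 * W * n"
  have E: "E > 0" using U n W by (auto simp: E_def intro!: add_pos_pos)
  \<comment> \<open>the first bound ensures that the gradient has norm at most 1, the second controls the quadratic term\<close>
  define k where "k = min (1 / (E * W)) (q / (9 * M * E\<^sup>2))"
  have k: "k > 0" "k * E * W \<le> 1" "M * (k * E\<^sup>2) \<le> q / 9"
  proof -
    show "k > 0" using E W q M by (simp add: k_def)
    have "k \<le> 1 / (E * W)" by (simp add: k_def)
    then show "k * E * W \<le> 1" using E W by (simp add: field_simps)
    have "k \<le> q / (9 * M * E\<^sup>2)" by (simp add: k_def)
    then show "M * (k * E\<^sup>2) \<le> q / 9" using E M by (simp add: field_simps)
  qed
  define a0 where "a0 = min s1 (min (2 * n * \<rho>1) (q / (36 * (B1 + 1))))"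
  have a0: "a0 > 0" using s1 n \<rho>1 q B1 by (simp add: a0_def)
  show ?thesis
  proof (rule that[of "2 * k / 3" a0])
    show "2 * k / 3 > 0" using k by simp
    show "a0 > 0" by (rule a0)
    fix a assume a: "0 < a" "a < a0"
    then have a1: "a < s1" "a < 2 * n * \<rho>1" "a < q / (36 * (B1 + 1))" by (auto simp: a0_def)
    have a3: "4 * B1 * a \<le> q / 9"
    proof -
      define c where "c = (B1 + 1) * a"
      have "36 * c < q" using a1(3) B1 by (simp add: c_def field_simps)
      moreover have "B1 * a \<le> c" unfolding c_def using a by (intro mult_right_mono) auto
      ultimately have "36 * (B1 * a) \<le> q" by linarith
      then show ?thesis by simp
    qed
    define r where "r = a / (2 * n)"
    have r: "r > 0" "r \<le> \<rho>1" using a a1(2) n by (auto simp: r_def field_simps)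
    define s where "s x = (x - z) \<bullet> \<beta>" for x
    define \<omega> where "\<omega> x = x - v (s x)" for x
    define v' where "v' x = (1 / (b (v (s x)) \<bullet> \<beta>)) *\<^sub>R b (v (s x))" for x
    define f where "f x = - k * (\<omega> x \<bullet> \<omega> x) / (a - s x)" for x
    \<comment> \<open>the gradient of \<open>f\<close>\<close>
    define \<theta> where "\<theta> x = - (2 * k / (a - s x)) *\<^sub>R (\<omega> x - (\<omega> x \<bullet> v' x) *\<^sub>R \<beta>) - (k * (\<omega> x \<bullet> \<omega> x) / (a - s x)\<^sup>2) *\<^sub>R \<beta>" for x
    have main: "(f has_derivative (\<lambda>y. y \<bullet> \<theta> x)) (at x) \<and> b x \<bullet> \<theta> x + M * (norm (\<theta> x))\<^sup>2 \<le> 0 \<and>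
          norm (\<theta> x) \<le> 1 \<and> f x \<le> - (2 * k / 3 / a) * (infdist x (range w))\<^sup>2" if x: "x \<in> cball z r" for x
    proof -
      have xz: "norm (x - z) \<le> r" using x by (simp add: dist_norm norm_minus_commute)
      have x1: "x \<in> cball z \<rho>1" using x r by auto
      have sx: "\<bar>s x\<bar> \<le> a / 2"
      proof -
        have "\<bar>s x\<bar> \<le> norm (x - z) * n" unfolding s_def n_def by (rule Cauchy_Schwarz_ineq2)
        also have "\<dots> \<le> r * n" using xz n by (intro mult_right_mono) auto
        finally show ?thesis using n by (simp add: r_def)
      qed
      then have s1x: "\<bar>s x\<bar> < s1" using a a1 by linarith
      note vx = v[OF s1x]
      define d where "d = a - s x"
      have d: "a / 2 \<le> d" "d \<le> 3 * a / 2" "d > 0" using sx a unfolding d_def by linarith+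
      define N where "N = norm (\<omega> x)"
      have N0: "N \<ge> 0" by (simp add: N_def)
      have NW: "N \<le> W * a"
      proof -
        have "N \<le> norm (x - z) + norm (v (s x) - z)"
          unfolding N_def \<omega>_def by (metis norm_triangle_ineq4 diff_diff_eq2 diff_add_cancel add_diff_cancel diff_diff_add)
        also have "\<dots> \<le> r + U * (a / 2)"
        proof (rule add_mono[OF xz])
          have "norm (v (s x) - z) \<le> U * \<bar>s x\<bar>" using vx by (simp add: U_def)
          also have "\<dots> \<le> U * (a / 2)" using sx U by (intro mult_left_mono) auto
          finally show "norm (v (s x) - z) \<le> U * (a / 2)" .
        qed
        also have "\<dots> = W * a" by (simp add: W_def r_def algebra_simps)
        finally show ?thesis .
      qed
      have vpos: "q \<le> b (v (s x)) \<bullet> \<beta>" using vx by (intro pos) auto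
      have nv: "norm (v' x) \<le> U"
      proof -
        have "norm (v' x) = norm (b (v (s x))) / (b (v (s x)) \<bullet> \<beta>)" using vpos q by (simp add: v'_def)
        also have "\<dots> \<le> Bm / q" using vpos q vx Bm n by (intro frac_le) (auto simp: Bm_def)
        finally show ?thesis by (simp add: U_def)
      qed
      have vb: "(b (v (s x)) \<bullet> \<beta>) *\<^sub>R v' x = b (v (s x))" using vpos q by (simp add: v'_def)
      have der_s: "(s has_derivative (\<lambda>y. y \<bullet> \<beta>)) (at x)"
        unfolding s_def by (auto intro!: derivative_eq_intros)
      have der_\<omega>: "(\<omega> has_derivative (\<lambda>y. y - (y \<bullet> \<beta>) *\<^sub>R v' x)) (at x)"
      proof -
        have "(v has_derivative (\<lambda>h. h *\<^sub>R v' x)) (at (s x))"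
          using vx by (simp add: v'_def has_vector_derivative_def)
        from has_derivative_compose[OF der_s this] show ?thesis
          unfolding \<omega>_def by (auto intro!: derivative_eq_intros)
      qed
      have der: "(f has_derivative (\<lambda>y. y \<bullet> \<theta> x)) (at x)"
      proof -
        have "((\<lambda>x. \<omega> x \<bullet> \<omega> x) has_derivative (\<lambda>y. \<omega> x \<bullet> (y - (y \<bullet> \<beta>) *\<^sub>R v' x) + (y - (y \<bullet> \<beta>) *\<^sub>R v' x) \<bullet> \<omega> x)) (at x)"
          using der_\<omega> by (intro has_derivative_inner)
        then have 1: "((\<lambda>x. - k * (\<omega> x \<bullet> \<omega> x)) has_derivative (\<lambda>y. - k * (2 * (y \<bullet> (\<omega> x - (\<omega> x \<bullet> v' x) *\<^sub>R \<beta>))))) (at x)"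
          by (intro has_derivative_eq_rhs[OF has_derivative_mult_right]) (auto simp: inner_diff_left inner_diff_right inner_commute algebra_simps)
        have 2: "((\<lambda>x. a - s x) has_derivative (\<lambda>y. - (y \<bullet> \<beta>))) (at x)"
          using der_s by (auto intro!: derivative_eq_intros)
        have dne: "a - s x \<noteq> 0" using d by (simp add: d_def)
        show ?thesis unfolding f_def
        proof (rule has_derivative_eq_rhs[OF has_derivative_divide'[OF 1 2 dne]], rule ext)
          fix y
          show "(- k * (2 * (y \<bullet> (\<omega> x - (\<omega> x \<bullet> v' x) *\<^sub>R \<beta>))) * (a - s x) - - k * (\<omega> x \<bullet> \<omega> x) * - (y \<bullet> \<beta>)) / ((a - s x) * (a - s x)) = y \<bullet> \<theta> x"
          proof -
            define \<xi> where "\<xi> = \<omega> x - (\<omega> x \<bullet> v' x) *\<^sub>R \<beta>"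
            have alg: "(- k * (2 * X) * D - - k * Q * - Y) / (D * D) = - (2 * k / D) * X - k * Q / D\<^sup>2 * Y"
              if "D \<noteq> 0" for X Q Y D :: real
              using that by (simp add: field_simps power2_eq_square)
            have "y \<bullet> \<theta> x = - (2 * k / (a - s x)) * (y \<bullet> \<xi>) - k * (\<omega> x \<bullet> \<omega> x) / (a - s x)\<^sup>2 * (y \<bullet> \<beta>)"
              unfolding \<theta>_def \<xi>_def[symmetric] by (simp only: inner_diff_right inner_scaleR_right)
            then show ?thesis unfolding \<xi>_def[symmetric] using alg[OF dne] by simp
          qed
        qed
      qed
      have N2: "\<omega> x \<bullet> \<omega> x = N\<^sup>2" by (simp add: N_def dot_square_norm)
      have n\<theta>: "norm (\<theta> x) \<le> k * E * N / a"
      proof -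
        have t1: "norm (\<omega> x - (\<omega> x \<bullet> v' x) *\<^sub>R \<beta>) \<le> N * (1 + U * n)"
        proof -
          have "\<bar>\<omega> x \<bullet> v' x\<bar> \<le> N * U"
            using Cauchy_Schwarz_ineq2[of "\<omega> x" "v' x"] mult_left_mono[OF nv N0] by (simp add: N_def)
          then have "\<bar>\<omega> x \<bullet> v' x\<bar> * n \<le> N * U * n" using n by (intro mult_right_mono) auto
          moreover have "norm (\<omega> x - (\<omega> x \<bullet> v' x) *\<^sub>R \<beta>) \<le> N + \<bar>\<omega> x \<bullet> v' x\<bar> * n"
            using norm_triangle_ineq4[of "\<omega> x" "(\<omega> x \<bullet> v' x) *\<^sub>R \<beta>"] by (simp add: N_def n_def)
          ultimately show ?thesis by (simp add: algebra_simps)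
        qed
        have id: "1 / d \<le> 2 / a" using d a by (simp add: field_simps)
        have "norm (\<theta> x) \<le> 2 * k / d * norm (\<omega> x - (\<omega> x \<bullet> v' x) *\<^sub>R \<beta>) + k * N\<^sup>2 / d\<^sup>2 * n"
          unfolding \<theta>_def d_def[symmetric] N2
          using norm_triangle_ineq4[of "- (2 * k / d) *\<^sub>R (\<omega> x - (\<omega> x \<bullet> v' x) *\<^sub>R \<beta>)" "(k * N\<^sup>2 / d\<^sup>2) *\<^sub>R \<beta>"] k d
          by (simp add: n_def)
        also have "\<dots> \<le> 2 * k * (2 / a) * (N * (1 + U * n)) + k * (N * (W * a)) * (2 / a)\<^sup>2 * n"
        proof (rule add_mono)
          show "2 * k / d * norm (\<omega> x - (\<omega> x \<bullet> v' x) *\<^sub>R \<beta>) \<le> 2 * k * (2 / a) * (N * (1 + U * n))"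
          proof (rule mult_mono)
            show "2 * k / d \<le> 2 * k * (2 / a)" using mult_left_mono[OF id, of "2 * k"] k by simp
          qed (use t1 k a in auto)
          have "k * N\<^sup>2 / d\<^sup>2 = k * (N * N) * (1 / d)\<^sup>2" by (simp add: power2_eq_square)
          also have "\<dots> \<le> k * (N * (W * a)) * (2 / a)\<^sup>2"
            using k N0 NW id d by (intro mult_mono power_mono mult_left_mono) auto
          finally show "k * N\<^sup>2 / d\<^sup>2 * n \<le> k * (N * (W * a)) * (2 / a)\<^sup>2 * n" using n by (intro mult_right_mono) auto
        qed
        also have "\<dots> = k * E * N / a" using a by (simp add: E_def field_simps power2_eq_square)
        finally show ?thesis .
      qed
      have le1: "norm (\<theta> x) \<le> 1"
      proof -
        have "k * E * N / a \<le> k * E * (W * a) / a" using NW k E a by (intro divide_right_mono mult_left_mono) auto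
        also have "\<dots> = k * E * W" using a by simp
        finally show ?thesis using n\<theta> k by linarith
      qed
      have sub: "b x \<bullet> \<theta> x + M * (norm (\<theta> x))\<^sup>2 \<le> 0"
      proof -
        \<comment> \<open>\<open>e\<close> is the derivative of \<open>\<omega>\<close> along the flow; it vanishes on the trajectory\<close>
        define e where "e = b x - b (v (s x)) - (b x \<bullet> \<beta> - b (v (s x)) \<bullet> \<beta>) *\<^sub>R v' x"
        have e: "e = b x - (b x \<bullet> \<beta>) *\<^sub>R v' x" unfolding e_def scaleR_diff_left vb by simp
        have L1: "norm (b x - b (v (s x))) \<le> B * N" unfolding N_def \<omega>_def using x1 vx by (intro lip) auto
        have ne: "norm e \<le> B1 * N"
        proof -
          have "\<bar>b x \<bullet> \<beta> - b (v (s x)) \<bullet> \<beta>\<bar> \<le> norm (b x - b (v (s x))) * n"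
            unfolding inner_diff_left[symmetric] n_def by (rule Cauchy_Schwarz_ineq2)
          also have "\<dots> \<le> B * N * n" using L1 n by (intro mult_right_mono) auto
          finally have "\<bar>b x \<bullet> \<beta> - b (v (s x)) \<bullet> \<beta>\<bar> * norm (v' x) \<le> B * N * n * U"
            using nv B0 N0 n by (intro mult_mono) auto
          moreover have "norm e \<le> norm (b x - b (v (s x))) + \<bar>b x \<bullet> \<beta> - b (v (s x)) \<bullet> \<beta>\<bar> * norm (v' x)"
            unfolding e_def using norm_triangle_ineq4[of "b x - b (v (s x))" "(b x \<bullet> \<beta> - b (v (s x)) \<bullet> \<beta>) *\<^sub>R v' x"] by simp
          ultimately show ?thesis using L1 by (simp add: B1_def algebra_simps)
        qed
        have "\<bar>\<omega> x \<bullet> e\<bar> \<le> N * norm e" unfolding N_def by (rule Cauchy_Schwarz_ineq2)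
        also have "\<dots> \<le> N * (B1 * N)" using ne N0 by (intro mult_left_mono)
        finally have we: "\<bar>\<omega> x \<bullet> e\<bar> \<le> B1 * N\<^sup>2" by (simp add: power2_eq_square algebra_simps)
        have "b x \<bullet> \<theta> x = - (2 * k / d) * (\<omega> x \<bullet> e) - k * N\<^sup>2 / d\<^sup>2 * (b x \<bullet> \<beta>)"
          unfolding \<theta>_def d_def[symmetric] N2 e by (simp add: inner_diff_right inner_commute algebra_simps)
        also have "\<dots> \<le> 4 * k / a * (B1 * N\<^sup>2) - k * N\<^sup>2 * (4 / (9 * a\<^sup>2)) * q"
        proof (rule diff_mono)
          have "2 * k / d * (- (\<omega> x \<bullet> e)) \<le> 2 * k / d * \<bar>\<omega> x \<bullet> e\<bar>"
            using k d by (intro mult_left_mono) auto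
          then have "- (2 * k / d) * (\<omega> x \<bullet> e) \<le> 2 * k / d * \<bar>\<omega> x \<bullet> e\<bar>"
            by (simp only: mult_minus_left mult_minus_right)
          also have "\<dots> \<le> 4 * k / a * (B1 * N\<^sup>2)"
            using we k d a by (intro mult_mono) (auto simp: field_simps)
          finally show "- (2 * k / d) * (\<omega> x \<bullet> e) \<le> 4 * k / a * (B1 * N\<^sup>2)" .
          have "k * N\<^sup>2 * (4 / (9 * a\<^sup>2)) * q \<le> k * N\<^sup>2 * (1 / d\<^sup>2) * (b x \<bullet> \<beta>)"
          proof (intro mult_mono)
            have "d\<^sup>2 \<le> (3 * a / 2)\<^sup>2" using d by (intro power_mono) auto
            then have "1 / (3 * a / 2)\<^sup>2 \<le> 1 / d\<^sup>2" using d by (intro frac_le) auto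
            then show "4 / (9 * a\<^sup>2) \<le> 1 / d\<^sup>2" by (simp add: power2_eq_square)
          qed (use k pos[OF x1] q in auto)
          then show "k * N\<^sup>2 * (4 / (9 * a\<^sup>2)) * q \<le> k * N\<^sup>2 / d\<^sup>2 * (b x \<bullet> \<beta>)" by simp
        qed
        also have "\<dots> = k * N\<^sup>2 / a\<^sup>2 * (4 * B1 * a - 4 * q / 9)" using a by (simp add: field_simps power2_eq_square)
        also have "\<dots> \<le> k * N\<^sup>2 / a\<^sup>2 * (- (q / 9))" using a3 k q by (intro mult_left_mono) auto
        finally have b\<theta>: "b x \<bullet> \<theta> x \<le> - (k * N\<^sup>2 / a\<^sup>2 * (q / 9))" by simp
        have "M * (norm (\<theta> x))\<^sup>2 \<le> M * (k * E * N / a)\<^sup>2" using n\<theta> M by (intro mult_left_mono power_mono) auto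
        also have "\<dots> = k * N\<^sup>2 / a\<^sup>2 * (M * (k * E\<^sup>2))" by (simp add: power2_eq_square)
        also have "\<dots> \<le> k * N\<^sup>2 / a\<^sup>2 * (q / 9)" using k by (intro mult_left_mono) auto
        finally show ?thesis using b\<theta> by linarith
      qed
      have up: "f x \<le> - (2 * k / 3 / a) * (infdist x (range w))\<^sup>2"
      proof -
        have "infdist x (range w) \<le> dist x (v (s x))" using vx by (intro infdist_le) auto
        then have "(infdist x (range w))\<^sup>2 \<le> N\<^sup>2" by (intro power_mono) (auto simp: N_def \<omega>_def dist_norm infdist_nonneg)
        then have "2 * k / 3 / a * (infdist x (range w))\<^sup>2 \<le> 2 * k / 3 / a * N\<^sup>2" using k a by (intro mult_left_mono) auto
        also have "\<dots> \<le> k * N\<^sup>2 / d"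
        proof -
          have "2 / (3 * a) \<le> 1 / d" using d a by (simp add: field_simps)
          then have "k * N\<^sup>2 * (2 / (3 * a)) \<le> k * N\<^sup>2 * (1 / d)" using k by (intro mult_left_mono) auto
          then show ?thesis by (simp add: mult.commute mult.left_commute)
        qed
        finally show ?thesis by (simp add: f_def N2 d_def)
      qed
      show ?thesis using der sub le1 up by blast
    qed
    have "f z = 0" by (simp add: f_def \<omega>_def s_def v0)
    then show "\<exists>f \<theta> r. 0 < r \<and> r \<le> \<rho> \<and> f z = 0 \<and>
       (\<forall>x\<in>cball z r. (f has_derivative (\<lambda>y. y \<bullet> \<theta> x)) (at x) \<and> b x \<bullet> \<theta> x + M * (norm (\<theta> x))\<^sup>2 \<le> 0 \<and>
          norm (\<theta> x) \<le> 1 \<and> f x \<le> - (2 * k / 3 / a) * (infdist x (range w))\<^sup>2)"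
      using main r \<rho>1 by (intro exI[of _ f] exI[of _ \<theta>] exI[of _ r]) auto
  qed
qed

section \<open>Hamiltonians with a natural drift\<close>

text \<open>\<open>H\<close> vanishes at \<open>\<theta> = 0\<close> and differs from its linearization \<open>b x \<bullet> \<theta>\<close> there by a
  quantity that is comparable to \<open>|\<theta>|\<^sup>2\<close>, locally uniformly in \<open>x\<close>.  The upper bound is required
  for \<open>|\<theta>| \<le> 1\<close> only.\<close>

definition drift_hamiltonian :: "'a::euclidean_space set \<Rightarrow> ('a \<Rightarrow> 'a) \<Rightarrow> ('a \<Rightarrow> 'a \<Rightarrow> real) \<Rightarrow> bool" where
  "drift_hamiltonian D b H \<longleftrightarrow>
     (\<forall>x\<in>D. H x 0 = 0) \<and>
     (\<forall>K. compact K \<and> K \<subseteq> D \<longrightarrow> (\<exists>m>0. \<forall>x\<in>K. \<forall>\<theta>. b x \<bullet> \<theta> + m * (norm \<theta>)\<^sup>2 \<le> H x \<theta>)) \<and>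
     (\<forall>K. compact K \<and> K \<subseteq> D \<longrightarrow>
        (\<exists>M>0. \<forall>x\<in>K. \<forall>\<theta>. norm \<theta> \<le> 1 \<longrightarrow> H x \<theta> \<le> b x \<bullet> \<theta> + M * (norm \<theta>)\<^sup>2))"

lemma drift_hamiltonianD:
  assumes "drift_hamiltonian D b H"
  shows "\<And>x. x \<in> D \<Longrightarrow> H x 0 = 0"
    "\<And>K. \<lbrakk>compact K; K \<subseteq> D\<rbrakk> \<Longrightarrow> \<exists>m>0. \<forall>x\<in>K. \<forall>\<theta>. b x \<bullet> \<theta> + m * (norm \<theta>)\<^sup>2 \<le> H x \<theta>"
    "\<And>K. \<lbrakk>compact K; K \<subseteq> D\<rbrakk> \<Longrightarrow> \<exists>M>0. \<forall>x\<in>K. \<forall>\<theta>. norm \<theta> \<le> 1 \<longrightarrow> H x \<theta> \<le> b x \<bullet> \<theta> + M * (norm \<theta>)\<^sup>2"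
  using assms unfolding drift_hamiltonian_def by auto

lemma gderiv_unique:
  assumes "GDERIV f x :> u" "GDERIV f x :> v" shows "u = v"
proof -
  have "(\<lambda>h. h \<bullet> u) = (\<lambda>h. h \<bullet> v)"
    using assms unfolding gderiv_def by (rule has_derivative_unique)
  then have "\<forall>h. h \<bullet> u = h \<bullet> v" by (simp add: fun_eq_iff)
  then show ?thesis by (simp only: vector_eq_ldot)
qed

lemma natural_drift_hamiltonian:
  assumes D: "open D" and S: "S \<in> actions_0_plus D" and b: "natural_drift D S b"
  obtains H where "drift_hamiltonian D b H" "induces D H S"
proof -
  obtain H0 where H0: "hamiltonian_0_plus D H0" "induces D H0 S" using S by (auto simp: actions_0_plus_def)
  obtain H where H: "hamiltonian D H" "induces D H S" and bH: "\<And>x. x \<in> D \<Longrightarrow> GDERIV (H x) 0 :> b x"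
    using b by (auto simp: natural_drift_def)
  obtain H' H'' where Hd: "theta_derivs D H H' H''" "locally_uniformly_convex D H''" using H(1) by (auto simp: hamiltonian_def)
  have b': "H' x 0 = b x" if "x \<in> D" for x
    using Hd(1) bH[OF that] that by (intro gderiv_unique[of "H x" 0]) (auto simp: theta_derivs_def)
  have z: "H x 0 = 0" if "x \<in> D" for x
    using natural_drift_hamiltonian_vanishes[OF D H0 H that] .
  have "drift_hamiltonian D b H"
    unfolding drift_hamiltonian_def
  proof (intro conjI allI impI ballI z)
    fix K assume K: "compact K \<and> K \<subseteq> D"
    then have KD: "\<And>x. x \<in> K \<Longrightarrow> x \<in> D" by auto
    obtain m where m: "m > 0" "\<And>x \<theta>. x \<in> K \<Longrightarrow> H x 0 + H' x 0 \<bullet> \<theta> + m * (norm \<theta>)\<^sup>2 \<le> H x \<theta>"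
      by (rule theta_quadratic_lower[OF Hd conjunct1[OF K] conjunct2[OF K]]) (rule that; assumption)
    then show "\<exists>m>0. \<forall>x\<in>K. \<forall>\<theta>. b x \<bullet> \<theta> + m * (norm \<theta>)\<^sup>2 \<le> H x \<theta>"
      using b' z KD by (intro exI[of _ m]) force
    obtain M where M: "M > 0" "\<And>x \<theta>. \<lbrakk>x \<in> K; norm \<theta> \<le> 1\<rbrakk> \<Longrightarrow> H x \<theta> \<le> H x 0 + H' x 0 \<bullet> \<theta> + M * (norm \<theta>)\<^sup>2"
      by (rule theta_quadratic_upper[OF Hd(1) conjunct1[OF K] conjunct2[OF K]]) (rule that; assumption)
    then show "\<exists>M>0. \<forall>x\<in>K. \<forall>\<theta>. norm \<theta> \<le> 1 \<longrightarrow> H x \<theta> \<le> b x \<bullet> \<theta> + M * (norm \<theta>)\<^sup>2"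
      using b' z KD by (intro exI[of _ M]) force
  qed
  then show ?thesis using that H(2) by blast
qed

section \<open>A lower bound for the action near the limit cycle\<close>

text \<open>The increment of \<open>f\<close> is a lower bound for the action if \<open>y \<bullet> \<nabla>f x\<close> is at most the local action at
  \<open>(x, y)\<close>.  The path need not be absolutely continuous up to its end point; there the estimate is
  extended by continuity.\<close>

lemma action_ge_potential:
  fixes \<phi> :: "real \<Rightarrow> 'a::euclidean_space"
  assumes der: "\<And>x. x \<in> cball z r \<Longrightarrow> (f has_derivative (\<lambda>y. y \<bullet> \<theta> x)) (at x)"
    and \<theta>1: "\<And>x. x \<in> cball z r \<Longrightarrow> norm (\<theta> x) \<le> 1"
    and la: "\<And>x y. x \<in> cball z r \<Longrightarrow> y \<bullet> \<theta> x \<le> local_action H x y"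
    and cont: "continuous_on {a..c} \<phi>" and ac: "\<And>c'. \<lbrakk>a \<le> c'; c' < c\<rbrakk> \<Longrightarrow> abs_continuous_on {a..c'} \<phi>"
    and im: "\<phi> ` {a..c} \<subseteq> cball z r" and a: "a < c"
  shows "ennreal (f (\<phi> c) - f (\<phi> a)) \<le> action H \<phi> a c"
proof -
  have flip: "norm (f x - f y) \<le> 1 * norm (x - y)" if "x \<in> cball z r" "y \<in> cball z r" for x y
  proof (rule differentiable_bound[of "cball z r" f "\<lambda>x y. y \<bullet> \<theta> x"])
    fix x assume x: "x \<in> cball z r"
    show "(f has_derivative (\<lambda>y. y \<bullet> \<theta> x)) (at x within cball z r)" using der[OF x] by (rule has_derivative_at_withinI)
    show "onorm (\<lambda>y. y \<bullet> \<theta> x) \<le> 1"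
    proof (rule onorm_le)
      fix y
      have "\<bar>y \<bullet> \<theta> x\<bar> \<le> norm y * norm (\<theta> x)" by (rule Cauchy_Schwarz_ineq2)
      also have "\<dots> \<le> norm y * 1" using \<theta>1[OF x] by (intro mult_left_mono) auto
      finally show "norm (y \<bullet> \<theta> x) \<le> 1 * norm y" by simp
    qed
  qed (use that in auto)
  have part: "ennreal (f (\<phi> c') - f (\<phi> a)) \<le> action H \<phi> a c" if c': "a \<le> c'" "c' < c" for c'
  proof -
    have im': "\<phi> t \<in> cball z r" if "t \<in> {a..c'}" for t using that c' by (intro subsetD[OF im] imageI) auto
    have "abs_continuous_on {a..c'} (\<lambda>t. f (\<phi> t))"
      by (rule abs_continuous_on_bound[OF ac[OF c'], of _ 1]) (use flip im' in auto)
    moreover obtain N where N: "negligible N" "\<And>t. \<lbrakk>t \<in> {a<..<c'}; t \<notin> N\<rbrakk> \<Longrightarrow> (\<phi> has_vector_derivative vector_derivative \<phi> (at t)) (at t)"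
      by (rule abs_continuous_differentiable_ae[OF ac[OF c'] c'(1)]) (rule that; assumption)
    moreover have "ennreal X \<le> ennreal (local_action H (\<phi> t) (vector_derivative \<phi> (at t)))"
      if t: "t \<in> {a<..<c'}" "t \<notin> N" "((\<lambda>t. f (\<phi> t)) has_real_derivative X) (at t)" for t X
    proof -
      have \<phi>t: "\<phi> t \<in> cball z r" using t by (intro im') auto
      have "(\<phi> has_derivative (\<lambda>h. h *\<^sub>R vector_derivative \<phi> (at t))) (at t)"
        using N(2)[OF t(1,2)] by (simp add: has_vector_derivative_def)
      from has_derivative_compose[OF this der[OF \<phi>t]]
      have "((\<lambda>t. f (\<phi> t)) has_real_derivative vector_derivative \<phi> (at t) \<bullet> \<theta> (\<phi> t)) (at t)"
        by (simp add: has_field_derivative_def mult_commute_abs)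
      then have "X = vector_derivative \<phi> (at t) \<bullet> \<theta> (\<phi> t)" using t(3) DERIV_unique by blast
      then show ?thesis using la[OF \<phi>t] by (simp add: ennreal_leI)
    qed
    ultimately have "ennreal (f (\<phi> c') - f (\<phi> a)) \<le> action H \<phi> a c'"
      unfolding action_def using c'(1) by (intro abs_continuous_integral_bound)
    also have "\<dots> \<le> action H \<phi> a c" using action_combine[of a c' c H \<phi>] c' by simp
    finally show ?thesis .
  qed
  have lim: "((\<lambda>t. ennreal (f (\<phi> t) - f (\<phi> a))) \<longlongrightarrow> ennreal (f (\<phi> c) - f (\<phi> a))) (at_left c)"
  proof (intro tendsto_ennrealI tendsto_diff tendsto_const)
    have "continuous_on {a..c} (\<lambda>t. f (\<phi> t))"
    proof (rule continuous_on_compose2[OF _ cont im])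
      show "continuous_on (cball z r) f"
        using der by (intro has_derivative_continuous_on) (rule has_derivative_at_withinI)
    qed
    then show "((\<lambda>t. f (\<phi> t)) \<longlongrightarrow> f (\<phi> c)) (at_left c)"
      by (rule continuous_on_Icc_at_leftD[where f = "\<lambda>t. f (\<phi> t)", OF _ a])
  qed
  show ?thesis
  proof (rule tendsto_upperbound[OF lim])
    have "eventually (\<lambda>t. t \<in> {a<..<c}) (at_left c)" using a by (rule eventually_at_left_real)
    then show "eventually (\<lambda>t. ennreal (f (\<phi> t) - f (\<phi> a)) \<le> action H \<phi> a c) (at_left c)"
      by eventually_elim (rule part; simp)
  qed simp
qed

section \<open>Absolutely continuous connections of bounded action\<close>

text \<open>There is an absolutely continuous path in \<open>G\<close> from \<open>x\<close> to \<open>y\<close>, parameterized by \<open>[a, b]\<close>, whose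
  action is at most \<open>C\<close>.\<close>

definition reach :: "('a::euclidean_space \<Rightarrow> 'a \<Rightarrow> real) \<Rightarrow> 'a set \<Rightarrow> real \<Rightarrow> real \<Rightarrow> 'a \<Rightarrow> 'a \<Rightarrow> ennreal \<Rightarrow> bool" where
  "reach H G a b x y C \<longleftrightarrow> (\<exists>\<omega>. abs_continuous_on {a..b} \<omega> \<and> \<omega> ` {a..b} \<subseteq> G \<and> \<omega> a = x \<and> \<omega> b = y \<and> action H \<omega> a b \<le> C)"

text \<open>At most one cell of a division contains \<open>b\<close> in its interior.\<close>

lemma abs_continuous_join:
  fixes \<phi> :: "real \<Rightarrow> 'a::euclidean_space"
  assumes 1: "abs_continuous_on {a..b} \<phi>" and 2: "abs_continuous_on {b..c} \<phi>" and ab: "a \<le> b" "b \<le> c"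
  shows "abs_continuous_on {a..c} \<phi>"
proof (rule abs_continuous_onI_le)
  fix e :: real assume e: "e > 0"
  define e4 where "e4 = e / 4"
  have e4: "e4 > 0" using e by (simp add: e4_def)
  obtain d1 where d1: "d1 > 0" "\<And>d. \<lbrakk>d division_of \<Union>d; \<Union>d \<subseteq> {a..b}; (\<Sum>k\<in>d. Sup k - Inf k) < d1\<rbrakk>
       \<Longrightarrow> (\<Sum>k\<in>d. norm (\<phi> (Sup k) - \<phi> (Inf k))) < e4"
    using 1[unfolded abs_continuous_on_def, rule_format, of e4] e4 by auto
  obtain d2 where d2: "d2 > 0" "\<And>d. \<lbrakk>d division_of \<Union>d; \<Union>d \<subseteq> {b..c}; (\<Sum>k\<in>d. Sup k - Inf k) < d2\<rbrakk>
       \<Longrightarrow> (\<Sum>k\<in>d. norm (\<phi> (Sup k) - \<phi> (Inf k))) < e4"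
    using 2[unfolded abs_continuous_on_def, rule_format, of e4] e4 by auto
  obtain d3 where d3: "d3 > 0" "\<And>s t. \<lbrakk>s \<in> {a..b}; t \<in> {a..b}; \<bar>t - s\<bar> < d3\<rbrakk> \<Longrightarrow> norm (\<phi> t - \<phi> s) < e4"
    by (rule abs_continuous_pair[OF 1 e4]) (rule that; assumption)
  obtain d4 where d4: "d4 > 0" "\<And>s t. \<lbrakk>s \<in> {b..c}; t \<in> {b..c}; \<bar>t - s\<bar> < d4\<rbrakk> \<Longrightarrow> norm (\<phi> t - \<phi> s) < e4"
    by (rule abs_continuous_pair[OF 2 e4]) (rule that; assumption)
  define \<delta> where "\<delta> = min (min d1 d2) (min d3 d4)"
  show "\<exists>\<delta>>0. \<forall>d. d division_of \<Union>d \<and> \<Union>d \<subseteq> {a..c} \<and> (\<Sum>k\<in>d. Sup k - Inf k) < \<delta> \<longrightarrow>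
        (\<Sum>k\<in>d. norm (\<phi> (Sup k) - \<phi> (Inf k))) \<le> e"
  proof (intro exI[of _ \<delta>] conjI allI impI)
    show "\<delta> > 0" using d1 d2 d3 d4 by (simp add: \<delta>_def)
    fix d assume "d division_of \<Union>d \<and> \<Union>d \<subseteq> {a..c} \<and> (\<Sum>k\<in>d. Sup k - Inf k) < \<delta>"
    then have d: "d division_of \<Union>d" "\<Union>d \<subseteq> {a..c}" "(\<Sum>k\<in>d. Sup k - Inf k) < \<delta>" by auto
    have fin: "finite d" using d(1) by (rule division_of_finite)
    have cell: "\<exists>u v. u \<le> v \<and> k = {u..v} \<and> Inf k = u \<and> Sup k = v \<and> a \<le> u \<and> v \<le> c" if k: "k \<in> d" for k
    proof -
      obtain u v where uv: "u \<le> v" "k = {u..v}" "Inf k = u" "Sup k = v" using division_cell[OF d(1) k] .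
      then have "u \<in> {a..c}" "v \<in> {a..c}" using d(2) k by (auto simp: subset_eq)
      then show ?thesis using uv by auto
    qed
    have nn: "0 \<le> Sup k - Inf k" if "k \<in> d" for k using cell[OF that] by auto
    have len: "(\<Sum>k\<in>d'. Sup k - Inf k) < \<delta>" if "d' \<subseteq> d" for d'
      using sum_mono2[OF fin that, of "\<lambda>k. Sup k - Inf k"] nn d(3) by force
    define dL where "dL = {k \<in> d. Sup k \<le> b}"
    define dR where "dR = {k \<in> d. b \<le> Inf k}"
    define dS where "dS = {k \<in> d. Inf k < b \<and> b < Sup k}"
    let ?j = "\<lambda>k. norm (\<phi> (Sup k) - \<phi> (Inf k))"
    have sub: "d' division_of \<Union>d'" if "d' \<subseteq> d" for d' using division_of_subset[OF d(1) that] .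
    have L: "sum ?j dL < e4"
    proof (rule d1(2))
      show "dL division_of \<Union>dL" by (rule sub) (auto simp: dL_def)
      show "\<Union>dL \<subseteq> {a..b}"
      proof (rule Union_least)
        fix k assume k: "k \<in> dL"
        then obtain u v where "k = {u..v}" "Inf k = u" "Sup k = v" "a \<le> u" "v \<le> c" using cell[of k] by (auto simp: dL_def)
        then show "k \<subseteq> {a..b}" using k by (simp add: dL_def)
      qed
      show "(\<Sum>k\<in>dL. Sup k - Inf k) < d1" using len[of dL] by (auto simp: dL_def \<delta>_def)
    qed
    have R: "sum ?j dR < e4"
    proof (rule d2(2))
      show "dR division_of \<Union>dR" by (rule sub) (auto simp: dR_def)
      show "\<Union>dR \<subseteq> {b..c}"
      proof (rule Union_least)
        fix k assume k: "k \<in> dR"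
        then obtain u v where "k = {u..v}" "Inf k = u" "Sup k = v" "a \<le> u" "v \<le> c" using cell[of k] by (auto simp: dR_def)
        then show "k \<subseteq> {b..c}" using k by (simp add: dR_def)
      qed
      show "(\<Sum>k\<in>dR. Sup k - Inf k) < d2" using len[of dR] by (auto simp: dR_def \<delta>_def)
    qed
    have Sk: "?j k \<le> 2 * e4" if k: "k \<in> dS" for k
    proof -
      have kd: "k \<in> d" using k by (simp add: dS_def)
      obtain u v where uv: "k = {u..v}" "Inf k = u" "Sup k = v" "a \<le> u" "v \<le> c" using cell[OF kd] by blast
      have "u < b" "b < v" using k uv by (auto simp: dS_def)
      have "v - u < \<delta>" using len[of "{k}"] kd uv by auto
      then have vu: "v - u < d3" "v - u < d4" by (auto simp: \<delta>_def)
      have "norm (\<phi> b - \<phi> u) < e4" using vu \<open>u < b\<close> \<open>b < v\<close> uv ab by (intro d3(2)) auto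
      moreover have "norm (\<phi> v - \<phi> b) < e4" using vu \<open>u < b\<close> \<open>b < v\<close> uv ab by (intro d4(2)) auto
      moreover have "norm (\<phi> v - \<phi> u) \<le> norm (\<phi> v - \<phi> b) + norm (\<phi> b - \<phi> u)"
        by (metis norm_triangle_ineq diff_add_cancel add_diff_eq)
      ultimately show ?thesis using uv by simp
    qed
    have S: "sum ?j dS \<le> 2 * e4"
    proof (cases "dS = {}")
      case True
      then show ?thesis using e4 by simp
    next
      case False
      then obtain k where k: "k \<in> dS" by auto
      have "l = k" if l: "l \<in> dS" for l
      proof (rule ccontr)
        assume "l \<noteq> k"
        then have "interior l \<inter> interior k = {}" using division_ofD(5)[OF d(1)] k l by (auto simp: dS_def)
        moreover have "b \<in> interior j" if "j \<in> dS" for j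
        proof -
          have "j \<in> d" using that by (simp add: dS_def)
          then obtain u v where "j = {u..v}" "Inf j = u" "Sup j = v" using cell by blast
          then show ?thesis using that by (auto simp: dS_def interior_atLeastAtMost_real)
        qed
        ultimately show False using k l by blast
      qed
      then have "dS = {k}" using k by blast
      then show ?thesis using Sk[OF k] by simp
    qed
    have "d \<subseteq> dL \<union> (dR \<union> dS)" by (auto simp: dL_def dR_def dS_def)
    moreover have "finite dL" "finite dR" "finite dS" using fin by (auto simp: dL_def dR_def dS_def)
    ultimately have "sum ?j d \<le> sum ?j (dL \<union> (dR \<union> dS))" by (intro sum_mono2) auto
    also have "\<dots> \<le> sum ?j dL + sum ?j (dR \<union> dS)"
      using \<open>finite dL\<close> \<open>finite dR\<close> \<open>finite dS\<close> by (subst sum_Un) (auto intro: sum_nonneg)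
    also have "sum ?j (dR \<union> dS) \<le> sum ?j dR + sum ?j dS"
      using \<open>finite dR\<close> \<open>finite dS\<close> by (subst sum_Un) (auto intro: sum_nonneg)
    finally show "sum ?j d \<le> e" using L R S by (simp add: e4_def)
  qed
qed

lemma abs_continuous_on_cong:
  assumes "\<And>t. t \<in> {a..b} \<Longrightarrow> \<phi> t = \<omega> t" "abs_continuous_on {a..b} \<phi>"
  shows "abs_continuous_on {a..b} \<omega>"
  by (rule abs_continuous_on_bound[OF assms(2), of _ 1]) (simp add: assms(1)[symmetric])

lemma abs_continuous_local:
  fixes \<phi> :: "real \<Rightarrow> 'a::euclidean_space"
  assumes ab: "a \<le> b" and loc: "\<And>x. x \<in> {a..b} \<Longrightarrow> \<exists>\<delta>>0. abs_continuous_on ({a..b} \<inter> {x - \<delta>..x + \<delta>}) \<phi>"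
  shows "abs_continuous_on {a..b} \<phi>"
proof -
  have "a \<le> a \<and> b \<le> b \<longrightarrow> abs_continuous_on {a..b} \<phi>"
  proof (rule Bolzano[OF ab, where P = "\<lambda>c d. a \<le> c \<and> d \<le> b \<longrightarrow> abs_continuous_on {c..d} \<phi>"])
    fix c d e
    assume "a \<le> c \<and> d \<le> b \<longrightarrow> abs_continuous_on {c..d} \<phi>" "a \<le> d \<and> e \<le> b \<longrightarrow> abs_continuous_on {d..e} \<phi>"
      and "c \<le> d" "d \<le> e"
    then show "a \<le> c \<and> e \<le> b \<longrightarrow> abs_continuous_on {c..e} \<phi>" by (auto intro: abs_continuous_join[of c d \<phi> e])
  next
    fix x assume "a \<le> x" "x \<le> b"
    then obtain \<delta> where \<delta>: "\<delta> > 0" "abs_continuous_on ({a..b} \<inter> {x - \<delta>..x + \<delta>}) \<phi>" using loc[of x] by auto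
    show "\<exists>r>0. \<forall>c d. c \<le> x \<and> x \<le> d \<and> d - c < r \<longrightarrow> a \<le> c \<and> d \<le> b \<longrightarrow> abs_continuous_on {c..d} \<phi>"
    proof (intro exI[of _ \<delta>] conjI allI impI)
      fix c d assume "c \<le> x \<and> x \<le> d \<and> d - c < \<delta>" "a \<le> c \<and> d \<le> b"
      then show "abs_continuous_on {c..d} \<phi>" by (intro abs_continuous_on_subset[OF \<delta>(2)]) auto
    qed (rule \<delta>(1))
  qed
  then show ?thesis by simp
qed

lemma reach_trans:
  assumes 1: "reach H G a b x y C" and 2: "reach H G b c y z C'" and ab: "a \<le> b" "b \<le> c"
  shows "reach H G a c x z (C + C')"
proof -
  obtain \<phi> where \<phi>: "abs_continuous_on {a..b} \<phi>" "\<phi> ` {a..b} \<subseteq> G" "\<phi> a = x" "\<phi> b = y" "action H \<phi> a b \<le> C"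
    using 1 by (auto simp: reach_def)
  obtain \<omega> where \<omega>: "abs_continuous_on {b..c} \<omega>" "\<omega> ` {b..c} \<subseteq> G" "\<omega> b = y" "\<omega> c = z" "action H \<omega> b c \<le> C'"
    using 2 by (auto simp: reach_def)
  define j where "j t = (if t \<le> b then \<phi> t else \<omega> t)" for t
  have jL: "j t = \<phi> t" if "t \<le> b" for t using that by (simp add: j_def)
  have jR: "j t = \<omega> t" if "b \<le> t" for t using that \<phi>(4) \<omega>(3) by (cases "t = b") (auto simp: j_def)
  have "abs_continuous_on {a..b} j" by (rule abs_continuous_on_cong[OF _ \<phi>(1)]) (simp add: jL)
  moreover have "abs_continuous_on {b..c} j" by (rule abs_continuous_on_cong[OF _ \<omega>(1)]) (simp add: jR)
  ultimately have "abs_continuous_on {a..c} j" using ab by (rule abs_continuous_join)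
  moreover have "j ` {a..c} \<subseteq> G"
  proof (rule image_subsetI)
    fix t assume t: "t \<in> {a..c}"
    show "j t \<in> G"
    proof (cases "t \<le> b")
      case True
      then show ?thesis using t \<phi>(2) jL by (auto simp: image_subset_iff)
    next
      case False
      then show ?thesis using t \<omega>(2) jR by (auto simp: image_subset_iff)
    qed
  qed
  moreover have "j a = x" "j c = z" using jL[of a] jR[of c] ab \<phi> \<omega> by auto
  moreover have "action H j a c \<le> C + C'"
  proof -
    have "action H j a c = action H j a b + action H j b c" by (rule action_combine[OF ab])
    also have "action H j a b = action H \<phi> a b" by (rule action_cong) (simp add: jL)
    also have "action H j b c = action H \<omega> b c" by (rule action_cong) (simp add: jR)
    finally show ?thesis using \<phi>(5) \<omega>(5) by (simp add: add_mono)
  qed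
  ultimately show ?thesis by (auto simp: reach_def)
qed

lemma reach_mono:
  assumes "reach H G a b x y C" "C \<le> C'" shows "reach H G a b x y C'"
proof -
  obtain \<omega> where "abs_continuous_on {a..b} \<omega>" "\<omega> ` {a..b} \<subseteq> G" "\<omega> a = x" "\<omega> b = y" "action H \<omega> a b \<le> C"
    using assms(1) by (auto simp: reach_def)
  moreover from this(5) have "action H \<omega> a b \<le> C'" using assms(2) by (rule order_trans)
  ultimately show ?thesis unfolding reach_def by (intro exI[of _ \<omega>]) simp
qed

lemma reach_refl: "x \<in> G \<Longrightarrow> reach H G a a x x 0"
  unfolding reach_def
proof (intro exI[of _ "\<lambda>_. x"] conjI)
  show "abs_continuous_on {a..a} (\<lambda>_. x)" by (rule lipschitz_abs_continuous[of _ _ _ 0]) simp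
  show "action H (\<lambda>_. x) a a \<le> 0" using action_le_const[of "{}" a a 0 H "\<lambda>_. x"] by simp
qed auto

lemma reach_path: "abs_continuous_on {a..b} \<phi> \<Longrightarrow> \<phi> ` {a..b} \<subseteq> G \<Longrightarrow> reach H G a b (\<phi> a) (\<phi> b) (action H \<phi> a b)"
  by (auto simp: reach_def)

lemma lipschitz_derivative_bound:
  fixes \<phi> :: "real \<Rightarrow> 'a::euclidean_space"
  assumes lip: "\<And>s t. \<lbrakk>s \<in> {a..b}; t \<in> {a..b}\<rbrakk> \<Longrightarrow> norm (\<phi> t - \<phi> s) \<le> \<Lambda> * \<bar>t - s\<bar>"
    and t: "t \<in> {a<..<b}" and d: "(\<phi> has_vector_derivative D) (at t)"
  shows "norm D \<le> \<Lambda>"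
proof (rule field_le_epsilon)
  fix e :: real assume e: "e > 0"
  have "(\<phi> has_derivative (\<lambda>h. h *\<^sub>R D)) (at t)" using d by (simp add: has_vector_derivative_def)
  then obtain \<delta> where \<delta>: "\<delta> > 0" "\<And>y. norm (y - t) < \<delta> \<Longrightarrow> norm (\<phi> y - \<phi> t - (y - t) *\<^sub>R D) \<le> e * norm (y - t)"
    using e unfolding has_derivative_at_alt by blast
  define h where "h = min (\<delta> / 2) (b - t)"
  have h: "h > 0" "h < \<delta>" "t + h \<in> {a..b}" using \<delta> t by (auto simp: h_def)
  have "norm (h *\<^sub>R D) \<le> norm (\<phi> (t + h) - \<phi> t) + norm (\<phi> (t + h) - \<phi> t - h *\<^sub>R D)"
    using norm_triangle_ineq4[of "\<phi> (t + h) - \<phi> t" "\<phi> (t + h) - \<phi> t - h *\<^sub>R D"] by simp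
  also have "\<dots> \<le> \<Lambda> * h + e * h"
    using lip[of t "t + h"] \<delta>(2)[of "t + h"] h t by (intro add_mono) auto
  finally have "h * norm D \<le> h * (\<Lambda> + e)" using h by (simp add: algebra_simps)
  then show "norm D \<le> \<Lambda> + e" using h by simp
qed

lemma reach_lipschitz:
  fixes \<phi> :: "real \<Rightarrow> 'a::euclidean_space"
  assumes lip: "\<And>s t. \<lbrakk>s \<in> {a..b}; t \<in> {a..b}\<rbrakk> \<Longrightarrow> norm (\<phi> t - \<phi> s) \<le> \<Lambda> * \<bar>t - s\<bar>"
    and ab: "a \<le> b" and im: "\<phi> ` {a..b} \<subseteq> G"
    and la: "\<And>t y. t \<in> {a..b} \<Longrightarrow> local_action H (\<phi> t) y \<le> C * norm y" and C: "C \<ge> 0" and \<Lambda>: "\<Lambda> \<ge> 0"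
  shows "reach H G a b (\<phi> a) (\<phi> b) (ennreal (C * \<Lambda> * (b - a)))"
proof -
  have ac: "abs_continuous_on {a..b} \<phi>" using lip by (rule lipschitz_abs_continuous)
  obtain N where N: "negligible N" "\<And>t. \<lbrakk>t \<in> {a<..<b}; t \<notin> N\<rbrakk> \<Longrightarrow> (\<phi> has_vector_derivative vector_derivative \<phi> (at t)) (at t)"
    by (rule abs_continuous_differentiable_ae[OF ac ab]) (rule that; assumption)
  have "action H \<phi> a b \<le> ennreal (C * \<Lambda> * (b - a))"
  proof (rule action_le_const[OF N(1) ab])
    fix t assume t: "t \<in> {a<..<b}" "t \<notin> N"
    have "norm (vector_derivative \<phi> (at t)) \<le> \<Lambda>" by (rule lipschitz_derivative_bound[OF lip t(1) N(2)[OF t]])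
    then have "C * norm (vector_derivative \<phi> (at t)) \<le> C * \<Lambda>" using C by (rule mult_left_mono)
    then show "local_action H (\<phi> t) (vector_derivative \<phi> (at t)) \<le> C * \<Lambda>"
      using la[of t "vector_derivative \<phi> (at t)"] t by auto
  qed (use C \<Lambda> in auto)
  then show ?thesis using ac im by (auto simp: reach_def)
qed

lemma local_action_linear_bound_compact:
  fixes D :: "'a::euclidean_space set"
  assumes H: "drift_hamiltonian D b H" and b: "continuous_on D b" and K: "compact K" "K \<subseteq> D"
  obtains C where "C > 0" "\<And>x y. x \<in> K \<Longrightarrow> local_action H x y \<le> C * norm y"
proof -
  obtain m where m: "m > 0" "\<forall>x\<in>K. \<forall>\<theta>. b x \<bullet> \<theta> + m * (norm \<theta>)\<^sup>2 \<le> H x \<theta>"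
    using drift_hamiltonianD(2)[OF H K] by blast
  have "compact (b ` K)" using K b by (intro compact_continuous_image) (auto elim: continuous_on_subset)
  then obtain Bm where Bm: "Bm > 0" "\<forall>y\<in>b ` K. norm y \<le> Bm" using compact_imp_bounded bounded_pos by metis
  show ?thesis
  proof (rule that[of "Bm / m + 1"])
    show "Bm / m + 1 > 0" using Bm m by (simp add: add_pos_pos)
    fix x y assume x: "x \<in> K"
    have "local_action H x y \<le> (norm (b x) / m + 1) * norm y"
      using x m K drift_hamiltonianD(1)[OF H] by (intro local_action_linear_bound) auto
    also have "\<dots> \<le> (Bm / m + 1) * norm y"
      using Bm x m by (intro mult_right_mono add_right_mono divide_right_mono) auto
    finally show "local_action H x y \<le> (Bm / m + 1) * norm y" .
  qed
qed

text \<open>Nearby points of \<open>G\<close> are connected in both directions by short rectifiable curves, which have small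
  action by the linear bound for the local action.\<close>

lemma reach_nearby:
  fixes D :: "'a::euclidean_space set"
  assumes D: "open D" and GD: "G \<subseteq> D" and lrc: "locally_rect_connected D G"
    and H: "drift_hamiltonian D b H" and b: "continuous_on D b" and x: "x \<in> G" and \<nu>: "\<nu> > 0"
  obtains r where "r > 0" "\<And>w c d. \<lbrakk>w \<in> cball x r \<inter> G; c < d\<rbrakk> \<Longrightarrow>
     reach H G c d x w (ennreal \<nu>) \<and> reach H G c d w x (ennreal \<nu>)"
proof -
  obtain \<rho> where \<rho>: "\<rho> > 0" "cball x \<rho> \<subseteq> D" using D x GD open_contains_cball by (meson subsetD)
  obtain C where C: "C > 0" "\<And>p y. p \<in> cball x \<rho> \<Longrightarrow> local_action H p y \<le> C * norm y"
    by (rule local_action_linear_bound_compact[OF H b compact_cball \<rho>(2)]) (rule that; assumption)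
  define l where "l = min \<rho> (\<nu> / C)"
  have l: "l > 0" "l \<le> \<rho>" "C * l \<le> \<nu>"
  proof -
    have "C * l \<le> C * (\<nu> / C)" using C by (intro mult_left_mono) (auto simp: l_def)
    then show "C * l \<le> \<nu>" using C by simp
  qed (use \<rho> \<nu> C in \<open>auto simp: l_def\<close>)
  obtain r where r: "r > 0" "\<And>w. w \<in> cball x r \<inter> G \<Longrightarrow>
      \<exists>\<gamma>\<in>curves_from_to (rect_curves D) G {x} {w}. curve_length \<gamma> \<le> ennreal (l / 2)"
    using lrc[unfolded locally_rect_connected_def, rule_format, OF x, of "l / 2"] l by auto
  show ?thesis
  proof (rule that[OF r(1)])
    fix w and c d :: real assume w: "w \<in> cball x r \<inter> G" and cd: "c < d"
    obtain \<gamma> where \<gamma>: "\<gamma> \<in> curves_from_to (rect_curves D) G {x} {w}" "curve_length \<gamma> \<le> ennreal (l / 2)"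
      using r(2)[OF w] by blast
    then have \<gamma>c: "\<gamma> \<in> curves D" by (auto simp: curves_from_to_def rect_curves_def)
    obtain \<omega> where \<omega>: "(1, \<omega>) \<in> \<gamma>" and lip: "\<And>s t. \<lbrakk>s \<in> {0..1}; t \<in> {0..1}\<rbrakk> \<Longrightarrow> norm (\<omega> t - \<omega> s) \<le> l * \<bar>t - s\<bar>"
      by (rule rectifiable_lipschitz_param[OF \<gamma>c \<gamma>(2), of l]; (use l in simp; fail | (rule that; assumption)))
    have ends: "\<omega> 0 = x" "\<omega> 1 = w" and im: "\<And>t. t \<in> {0..1} \<Longrightarrow> \<omega> t \<in> G"
      using \<gamma>(1) \<omega> unfolding curves_from_to_def curve_image_def by fastforce+
    have near: "\<omega> t \<in> cball x \<rho>" if t: "t \<in> {0..1}" for t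
    proof -
      have "norm (\<omega> t - \<omega> 0) \<le> l * \<bar>t - 0\<bar>" using t by (intro lip) auto
      also have "\<dots> \<le> l * 1" using t l by (intro mult_left_mono) auto
      finally show ?thesis using l ends by (simp add: dist_norm norm_minus_commute)
    qed
    have gen: "reach H G c d (\<omega> (g c)) (\<omega> (g d)) (ennreal \<nu>)"
      if g: "\<And>t. t \<in> {c..d} \<Longrightarrow> g t \<in> {0..1}" "\<And>s t. \<bar>g t - g s\<bar> = \<bar>t - s\<bar> / (d - c)" for g
    proof -
      have "reach H G c d ((\<lambda>t. \<omega> (g t)) c) ((\<lambda>t. \<omega> (g t)) d) (ennreal (C * (l / (d - c)) * (d - c)))"
      proof (rule reach_lipschitz)
        fix s t assume "s \<in> {c..d}" "t \<in> {c..d}"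
        then show "norm (\<omega> (g t) - \<omega> (g s)) \<le> l / (d - c) * \<bar>t - s\<bar>"
          using lip[of "g s" "g t"] g by simp
      next
        show "(\<lambda>t. \<omega> (g t)) ` {c..d} \<subseteq> G" using im g(1) by auto
        show "local_action H (\<omega> (g t)) y \<le> C * norm y" if "t \<in> {c..d}" for t y
          using C(2) near g(1) that by blast
      qed (use cd C l in auto)
      then show ?thesis by (rule reach_mono) (use cd l in \<open>auto intro!: ennreal_leI\<close>)
    qed
    have 1: "reach H G c d (\<omega> ((c - c) / (d - c))) (\<omega> ((d - c) / (d - c))) (ennreal \<nu>)"
      by (rule gen[of "\<lambda>t. (t - c) / (d - c)"])
         (use cd in \<open>auto simp: diff_divide_distrib[symmetric] abs_divide\<close>)
    have 2: "reach H G c d (\<omega> ((d - c) / (d - c))) (\<omega> ((d - d) / (d - c))) (ennreal \<nu>)"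
      by (rule gen[of "\<lambda>t. (d - t) / (d - c)"])
         (use cd in \<open>auto simp: diff_divide_distrib[symmetric] abs_divide abs_minus_commute\<close>)
    show "reach H G c d x w (ennreal \<nu>) \<and> reach H G c d w x (ennreal \<nu>)"
      using 1 2 cd ends by simp
  qed
qed

text \<open>A point at distance \<open>\<delta>\<close> from the limit cycle is joined to any point of the cycle at cost
  \<open>O(\<delta>\<^sup>2)\<close>: the path follows the trajectory through the closest point of the cycle for a time between one and
  two periods, while its deviation from that trajectory decreases linearly to 0.\<close>

lemma reach_limit_cycle:
  fixes D :: "'a::euclidean_space set"
  assumes D: "open D" and b: "C1_on D b" and H: "drift_hamiltonian D b H"
    and T: "T > 0" and w: "solves b w" and per: "\<And>t. w (t + T) = w t" and rng: "w ` {0..T} = L" "range w = L"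
    and LG: "L \<subseteq> interior G" and GD: "G \<subseteq> D"
  obtains C \<rho> where "C > 0" "\<rho> > 0"
    "\<And>p z c d. \<lbrakk>infdist p L \<le> \<rho>; z \<in> L; c < d\<rbrakk> \<Longrightarrow> reach H G c d p z (ennreal (C * (infdist p L)\<^sup>2))"
proof -
  have cL: "compact L" unfolding rng(1)[symmetric] by (intro compact_continuous_image solves_continuous[OF w]) auto
  have neL: "L \<noteq> {}" using rng(2) by auto
  obtain \<rho> where \<rho>: "\<rho> > 0" "(\<Union>x\<in>L. cball x \<rho>) \<subseteq> interior G"
    by (rule compact_subset_open_imp_cball_epsilon_subset[OF cL open_interior LG])
  define K where "K = {x. infdist x L \<le> \<rho>}"
  have cK: "compact K" unfolding K_def by (rule compact_infdist_le[OF neL cL \<rho>(1)])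
  have nearest: "\<exists>y\<in>L. infdist x L = dist x y" for x
    using infdist_attains_inf[OF compact_imp_closed[OF cL] neL] by blast
  have KG: "K \<subseteq> G"
  proof
    fix x assume "x \<in> K"
    then obtain y where "y \<in> L" "dist x y \<le> \<rho>" using nearest[of x] by (auto simp: K_def)
    then have "x \<in> (\<Union>x\<in>L. cball x \<rho>)" by (auto simp: dist_commute)
    then show "x \<in> G" using \<rho>(2) interior_subset by blast
  qed
  then have KD: "K \<subseteq> D" using GD by blast
  have LK: "L \<subseteq> K" using \<rho>(1) by (auto simp: K_def)
  obtain B where B: "B-lipschitz_on K b" by (rule C1_on_compact_lipschitz[OF b D cK KD])
  have B0: "B \<ge> 0" using B by (rule lipschitz_on_nonneg)
  obtain m where m: "m > 0" "\<forall>x\<in>K. \<forall>\<theta>. b x \<bullet> \<theta> + m * (norm \<theta>)\<^sup>2 \<le> H x \<theta>"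
    using drift_hamiltonianD(2)[OF H cK KD] by blast
  have "compact (b ` K)" using cK lipschitz_on_continuous_on[OF B] by (intro compact_continuous_image)
  then obtain Bm where Bm: "Bm > 0" "\<forall>y\<in>b ` K. norm y \<le> Bm" using compact_imp_bounded bounded_pos by metis
  define C where "C = 2 * T * ((B + 1 / T)\<^sup>2 / (4 * m))"
  show ?thesis
  proof (rule that[of C \<rho>])
    show "C > 0" using T B0 m by (auto simp: C_def intro!: mult_pos_pos divide_pos_pos zero_less_power add_nonneg_pos)
    show "\<rho> > 0" by (rule \<rho>(1))
    fix p z and c d :: real assume p: "infdist p L \<le> \<rho>" and z: "z \<in> L" and cd: "c < d"
    define \<delta> where "\<delta> = infdist p L"
    have \<delta>: "0 \<le> \<delta>" "\<delta> \<le> \<rho>" using p by (auto simp: \<delta>_def infdist_nonneg)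
    obtain z' where z': "z' \<in> L" "dist p z' = \<delta>" using nearest[of p] by (auto simp: \<delta>_def)
    obtain v s where v: "solves b v" "v 0 = z'" "v s = z" "T \<le> s" "s \<le> 2 * T" "range v = range w"
      by (rule limit_cycle_connect[OF T w per rng(1) z'(1) z])
    have vK: "v t \<in> K" for t using v(6) rng(2) LK by blast
    have s: "s > 0" using v T by linarith
    \<comment> \<open>\<open>v\<close> runs from the closest point \<open>z'\<close> to \<open>z\<close> in the time \<open>s\<close>, and \<open>k\<close> rescales \<open>[0, s]\<close> to \<open>[c, d]\<close>\<close>
    define k where "k = s / (d - c)"
    have k: "k > 0" using s cd by (simp add: k_def)
    define q where "q t = v (k * (t - c)) + (1 - (t - c) / (d - c)) *\<^sub>R (p - z')" for t
    have qd: "(q has_vector_derivative k *\<^sub>R (b (v (k * (t - c))) - (1 / s) *\<^sub>R (p - z'))) (at t)" for t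
    proof -
      have "((\<lambda>t. k * (t - c)) has_vector_derivative k) (at t)"
        by (auto intro!: derivative_eq_intros)
      moreover have "(v has_vector_derivative b (v (k * (t - c)))) (at (k * (t - c)))" using v(1) by (simp add: solves_def)
      ultimately have 1: "(v \<circ> (\<lambda>t. k * (t - c)) has_vector_derivative k *\<^sub>R b (v (k * (t - c)))) (at t)"
        by (rule vector_diff_chain_at)
      have "((\<lambda>t. 1 - (t - c) / (d - c)) has_real_derivative - (1 / (d - c))) (at t)"
        using cd by (auto intro!: derivative_eq_intros)
      then have 2: "((\<lambda>t. (1 - (t - c) / (d - c)) *\<^sub>R (p - z')) has_vector_derivative - (1 / (d - c)) *\<^sub>R (p - z')) (at t)"
        using has_vector_derivative_scaleR[OF _ has_vector_derivative_const, of _ _ t UNIV "p - z'"] by force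
      have "k * (1 / s) = 1 / (d - c)" using s by (simp add: k_def)
      then have eq: "k *\<^sub>R b (v (k * (t - c))) + - (1 / (d - c)) *\<^sub>R (p - z') = k *\<^sub>R (b (v (k * (t - c))) - (1 / s) *\<^sub>R (p - z'))"
        by (simp add: scaleR_diff_right)
      have "q = (\<lambda>t. (v \<circ> (\<lambda>t. k * (t - c))) t + (1 - (t - c) / (d - c)) *\<^sub>R (p - z'))" by (simp add: q_def fun_eq_iff)
      then show ?thesis using has_vector_derivative_add[OF 1 2] unfolding eq by simp
    qed
    have qv: "norm (q t - v (k * (t - c))) \<le> \<delta>" if t: "t \<in> {c..d}" for t
    proof -
      have "0 \<le> (t - c) / (d - c)" "(t - c) / (d - c) \<le> 1" using t cd by auto
      then have "\<bar>1 - (t - c) / (d - c)\<bar> \<le> 1" by linarith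
      then have "\<bar>1 - (t - c) / (d - c)\<bar> * \<delta> \<le> 1 * \<delta>" using \<delta> by (intro mult_right_mono)
      then show ?thesis using z' by (simp add: q_def dist_norm)
    qed
    have qK: "q t \<in> K" if t: "t \<in> {c..d}" for t
    proof -
      have "v (k * (t - c)) \<in> L" using v(6) rng(2) by blast
      then have "infdist (q t) L \<le> dist (q t) (v (k * (t - c)))" by (rule infdist_le)
      then show ?thesis using qv[OF t] \<delta> by (simp add: K_def dist_norm)
    qed
    have ac: "abs_continuous_on {c..d} q"
    proof (rule lipschitz_abs_continuous)
      fix x y assume xy: "x \<in> {c..d}" "y \<in> {c..d}"
      have "norm (q y - q x) \<le> k * (Bm + 1 / s * \<delta>) * norm (y - x)"
      proof (rule differentiable_bound[of "{c..d}" q "\<lambda>t h. h *\<^sub>R (k *\<^sub>R (b (v (k * (t - c))) - (1 / s) *\<^sub>R (p - z')))"])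
        fix t assume "t \<in> {c..d}"
        show "(q has_derivative (\<lambda>h. h *\<^sub>R (k *\<^sub>R (b (v (k * (t - c))) - (1 / s) *\<^sub>R (p - z'))))) (at t within {c..d})"
          using qd[of t] unfolding has_vector_derivative_def by (rule has_derivative_at_withinI)
        have "norm (b (v (k * (t - c))) - (1 / s) *\<^sub>R (p - z')) \<le> norm (b (v (k * (t - c)))) + norm ((1 / s) *\<^sub>R (p - z'))"
          by (rule norm_triangle_ineq4)
        also have "\<dots> \<le> Bm + 1 / s * \<delta>" using Bm(2) vK[of "k * (t - c)"] z' s by (intro add_mono) (auto simp: dist_norm)
        finally have "k * norm (b (v (k * (t - c))) - (1 / s) *\<^sub>R (p - z')) \<le> k * (Bm + 1 / s * \<delta>)"
          using k by (intro mult_left_mono) auto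
        then have n: "norm (k *\<^sub>R (b (v (k * (t - c))) - (1 / s) *\<^sub>R (p - z'))) \<le> k * (Bm + 1 / s * \<delta>)"
          using k by simp
        show "onorm (\<lambda>h. h *\<^sub>R (k *\<^sub>R (b (v (k * (t - c))) - (1 / s) *\<^sub>R (p - z')))) \<le> k * (Bm + 1 / s * \<delta>)"
        proof (rule onorm_le)
          fix h :: real
          show "norm (h *\<^sub>R (k *\<^sub>R (b (v (k * (t - c))) - (1 / s) *\<^sub>R (p - z')))) \<le> k * (Bm + 1 / s * \<delta>) * norm h"
            using mult_left_mono[OF n, of "\<bar>h\<bar>"] unfolding norm_scaleR[of h] by (simp add: mult.commute)
        qed
      qed (use xy in auto)
      then show "norm (q y - q x) \<le> k * (Bm + 1 / s * \<delta>) * \<bar>y - x\<bar>" by simp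
    qed
    have "action H q c d \<le> ennreal (k * (((B + 1 / T) * \<delta>)\<^sup>2 / (4 * m)) * (d - c))"
    proof (rule action_le_const[of "{}"])
      fix t assume t: "t \<in> {c<..<d}"
      define u where "u = b (v (k * (t - c))) - b (q t) - (1 / s) *\<^sub>R (p - z')"
      have "norm u \<le> norm (b (v (k * (t - c))) - b (q t)) + norm ((1 / s) *\<^sub>R (p - z'))" unfolding u_def by (rule norm_triangle_ineq4)
      also have "\<dots> \<le> B * \<delta> + 1 / T * \<delta>"
      proof (rule add_mono)
        have "norm (b (v (k * (t - c))) - b (q t)) \<le> B * norm (v (k * (t - c)) - q t)"
          using lipschitz_onD[OF B vK, of "q t"] qK[of t] t by (simp add: dist_norm)
        also have "\<dots> \<le> B * \<delta>" using qv[of t] t B0 by (intro mult_left_mono) (auto simp: norm_minus_commute)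
        finally show "norm (b (v (k * (t - c))) - b (q t)) \<le> B * \<delta>" .
        have "1 / s * \<delta> \<le> 1 / T * \<delta>" using v(4) T \<delta> by (intro mult_right_mono frac_le) auto
        then show "norm ((1 / s) *\<^sub>R (p - z')) \<le> 1 / T * \<delta>" using s z' by (simp add: dist_norm)
      qed
      finally have u: "norm u \<le> (B + 1 / T) * \<delta>" by (simp add: algebra_simps)
      have "local_action H (q t) (k *\<^sub>R (b (q t) + u)) \<le> k * ((norm u)\<^sup>2 / (4 * m))"
        using qK[of t] t m KD drift_hamiltonianD(1)[OF H] k by (intro local_action_drift) auto
      also have "\<dots> \<le> k * (((B + 1 / T) * \<delta>)\<^sup>2 / (4 * m))"
        using u k m by (intro mult_left_mono divide_right_mono power_mono) auto
      also have "k *\<^sub>R (b (q t) + u) = vector_derivative q (at t)"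
        using vector_derivative_at[OF qd[of t]] by (simp add: u_def)
      finally show "local_action H (q t) (vector_derivative q (at t)) \<le> k * (((B + 1 / T) * \<delta>)\<^sup>2 / (4 * m))" .
    qed (use cd k m in auto)
    also have "\<dots> \<le> ennreal (C * (infdist p L)\<^sup>2)"
    proof (rule ennreal_leI)
      have "k * (((B + 1 / T) * \<delta>)\<^sup>2 / (4 * m)) * (d - c) = s * (((B + 1 / T) * \<delta>)\<^sup>2 / (4 * m))"
        using cd by (simp add: k_def)
      also have "\<dots> \<le> 2 * T * (((B + 1 / T) * \<delta>)\<^sup>2 / (4 * m))" using v(5) m by (intro mult_right_mono) auto
      also have "\<dots> = C * \<delta>\<^sup>2" by (simp add: C_def power_mult_distrib)
      finally show "k * (((B + 1 / T) * \<delta>)\<^sup>2 / (4 * m)) * (d - c) \<le> C * (infdist p L)\<^sup>2" by (simp add: \<delta>_def)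
    qed
    finally have act: "action H q c d \<le> ennreal (C * (infdist p L)\<^sup>2)" .
    have "q c = p" "q d = z" using v cd by (auto simp: q_def k_def)
    moreover have "q ` {c..d} \<subseteq> G" using qK KG by blast
    ultimately show "reach H G c d p z (ennreal (C * (infdist p L)\<^sup>2))" using ac act by (auto simp: reach_def)
  qed
qed

text \<open>A path that is absolutely continuous away from finitely many times can be made absolutely
  continuous at arbitrarily small cost, by replacing it near these times by short rectifiable
  connections.\<close>

lemma reach_approx:
  fixes D :: "'a::euclidean_space set"
  assumes D: "open D" and GD: "G \<subseteq> D" and lrc: "locally_rect_connected D G"
    and H: "drift_hamiltonian D b H" and b: "continuous_on D b"
    and cont: "continuous_on {a..c} \<phi>" and im: "\<phi> ` {a..c} \<subseteq> G" and ac: "a \<le> c" and F: "finite F"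
    and loc: "\<And>x. x \<in> {a..c} - F \<Longrightarrow> \<exists>\<delta>>0. abs_continuous_on ({a..c} \<inter> {x - \<delta>..x + \<delta>}) \<phi>"
    and \<epsilon>: "\<epsilon> > 0"
  shows "reach H G a c (\<phi> a) (\<phi> c) (action H \<phi> a c + ennreal \<epsilon>)"
proof -
  let ?R = "\<lambda>u v e. reach H G u v (\<phi> u) (\<phi> v) (action H \<phi> u v + ennreal e)"
  have join: "?R u w e" if "?R u v (e/2)" "?R v w (e/2)" "u \<le> v" "v \<le> w" "e > 0" for u v w e
  proof -
    have "action H \<phi> u v + ennreal (e/2) + (action H \<phi> v w + ennreal (e/2)) = action H \<phi> u w + (ennreal (e/2) + ennreal (e/2))"
      using that by (simp add: action_combine[of u v w] ac_simps)
    also have "ennreal (e/2) + ennreal (e/2) = ennreal e" using that by (simp flip: ennreal_plus)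
    finally show ?thesis using reach_trans[OF that(1-4)] by simp
  qed
  have acs: "abs_continuous_on {u..v} \<phi>" if h: "a \<le> u" "u \<le> v" "v \<le> c" "F \<inter> {u..v} = {}" for u v
  proof (rule abs_continuous_local)
    fix x assume x: "x \<in> {u..v}"
    then have "x \<in> {a..c} - F" using h by auto
    from loc[OF this] obtain \<delta> where "\<delta> > 0" "abs_continuous_on ({a..c} \<inter> {x - \<delta>..x + \<delta>}) \<phi>" by blast
    moreover from this(2) have "abs_continuous_on ({u..v} \<inter> {x - \<delta>..x + \<delta>}) \<phi>"
      by (rule abs_continuous_on_subset) (use h in auto)
    ultimately show "\<exists>\<delta>>0. abs_continuous_on ({u..v} \<inter> {x - \<delta>..x + \<delta>}) \<phi>" by blast
  qed (use h in auto)
  have path: "reach H G u v (\<phi> u) (\<phi> v) (action H \<phi> u v)" if "a \<le> u" "u \<le> v" "v \<le> c" "F \<inter> {u..v} = {}" for u v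
    using that im by (intro reach_path acs) auto
  have "a \<le> a \<and> c \<le> c \<longrightarrow> (\<forall>e>0. ?R a c e)"
  proof (rule Bolzano[OF ac, where P = "\<lambda>u v. a \<le> u \<and> v \<le> c \<longrightarrow> (\<forall>e>0. ?R u v e)"])
    fix u v w
    assume 1: "a \<le> u \<and> v \<le> c \<longrightarrow> (\<forall>e>0. ?R u v e)" and 2: "a \<le> v \<and> w \<le> c \<longrightarrow> (\<forall>e>0. ?R v w e)"
      and uvw: "u \<le> v" "v \<le> w"
    show "a \<le> u \<and> w \<le> c \<longrightarrow> (\<forall>e>0. ?R u w e)"
    proof (intro impI allI)
      fix e :: real assume "a \<le> u \<and> w \<le> c" "0 < e"
      then have "?R u v (e/2)" "?R v w (e/2)" using 1 2 uvw by auto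
      then show "?R u w e" using uvw \<open>0 < e\<close> by (rule join)
    qed
  next
    fix x assume x: "a \<le> x" "x \<le> c"
    have xG: "\<phi> x \<in> G" using im x by auto
    obtain \<delta> where \<delta>: "\<delta> > 0" "\<And>y. \<lbrakk>y \<in> F; y \<noteq> x\<rbrakk> \<Longrightarrow> \<delta> \<le> dist x y" using finite_set_avoid[OF F, of x] by auto
    have free: "F \<inter> {u..v} = {}" if "x \<notin> {u..v}" "x - \<delta> < u" "v < x + \<delta>" for u v
    proof -
      have False if "y \<in> F" "y \<in> {u..v}" for y
      proof -
        have "y \<noteq> x" using that \<open>x \<notin> {u..v}\<close> by auto
        then have "\<delta> \<le> \<bar>x - y\<bar>" using \<delta>(2)[OF that(1)] by (simp add: dist_real_def)
        then show False using that \<open>x - \<delta> < u\<close> \<open>v < x + \<delta>\<close> by auto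
      qed
      then show ?thesis by blast
    qed
    have near: "\<exists>\<eta>>0. \<forall>t. t \<in> {a..c} \<and> \<bar>t - x\<bar> < \<eta> \<longrightarrow> \<phi> t \<in> cball (\<phi> x) r \<inter> G" if r0: "r > 0" for r
    proof -
      obtain \<eta> where "\<eta> > 0" "\<And>t. t \<in> {a..c} \<Longrightarrow> dist t x < \<eta> \<Longrightarrow> dist (\<phi> t) (\<phi> x) < r"
        using cont[unfolded continuous_on_iff, rule_format, of x r] x r0 by auto
      then show ?thesis using im by (intro exI[of _ \<eta>]) (auto simp: dist_real_def dist_commute less_imp_le)
    qed
    have left: "?R u x e" if u: "a \<le> u" "u \<le> x" "x - u < \<delta>" and e: "e > 0" for u e
    proof (cases "u = x")
      case True
      then show ?thesis using reach_refl[OF xG, of H x] by (auto intro: reach_mono)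
    next
      case False
      obtain r where r: "r > 0" "\<And>w c d. \<lbrakk>w \<in> cball (\<phi> x) r \<inter> G; c < d\<rbrakk> \<Longrightarrow>
          reach H G c d (\<phi> x) w (ennreal e) \<and> reach H G c d w (\<phi> x) (ennreal e)"
        by (rule reach_nearby[OF D GD lrc H b xG e]) (rule that; assumption)
      obtain \<eta> where \<eta>: "\<eta> > 0" "\<And>t. t \<in> {a..c} \<Longrightarrow> \<bar>t - x\<bar> < \<eta> \<Longrightarrow> \<phi> t \<in> cball (\<phi> x) r \<inter> G" using near[OF r(1)] by blast
      define v where "v = max u (x - \<eta> / 2)"
      have v: "u \<le> v" "v < x" "\<bar>v - x\<bar> < \<eta>" using False u \<eta>(1) by (auto simp: v_def)
      have "reach H G u v (\<phi> u) (\<phi> v) (action H \<phi> u v)" using u v x by (intro path free) auto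
      moreover have "reach H G v x (\<phi> v) (\<phi> x) (ennreal e)" using r(2)[of "\<phi> v" v x] \<eta>(2)[of v] v u x by auto
      ultimately have "reach H G u x (\<phi> u) (\<phi> x) (action H \<phi> u v + ennreal e)" by (rule reach_trans) (use v in auto)
      moreover have "action H \<phi> u v \<le> action H \<phi> u x" using action_combine[of u v x H \<phi>] v by simp
      ultimately show ?thesis by (auto intro: reach_mono add_right_mono)
    qed
    have right: "?R x u e" if u: "u \<le> c" "x \<le> u" "u - x < \<delta>" and e: "e > 0" for u e
    proof (cases "u = x")
      case True
      then show ?thesis using reach_refl[OF xG, of H x] by (auto intro: reach_mono)
    next
      case False
      obtain r where r: "r > 0" "\<And>w c d. \<lbrakk>w \<in> cball (\<phi> x) r \<inter> G; c < d\<rbrakk> \<Longrightarrow>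
          reach H G c d (\<phi> x) w (ennreal e) \<and> reach H G c d w (\<phi> x) (ennreal e)"
        by (rule reach_nearby[OF D GD lrc H b xG e]) (rule that; assumption)
      obtain \<eta> where \<eta>: "\<eta> > 0" "\<And>t. t \<in> {a..c} \<Longrightarrow> \<bar>t - x\<bar> < \<eta> \<Longrightarrow> \<phi> t \<in> cball (\<phi> x) r \<inter> G" using near[OF r(1)] by blast
      define v where "v = min u (x + \<eta> / 2)"
      have v: "v \<le> u" "x < v" "\<bar>v - x\<bar> < \<eta>" using False u \<eta>(1) by (auto simp: v_def)
      have "reach H G v u (\<phi> v) (\<phi> u) (action H \<phi> v u)" using u v x by (intro path free) auto
      moreover have "reach H G x v (\<phi> x) (\<phi> v) (ennreal e)" using r(2)[of "\<phi> v" x v] \<eta>(2)[of v] v u x by auto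
      ultimately have "reach H G x u (\<phi> x) (\<phi> u) (ennreal e + action H \<phi> v u)" using v by (intro reach_trans[of H G x v _ "\<phi> v"]) auto
      moreover have "action H \<phi> v u \<le> action H \<phi> x u" using action_combine[of x v u H \<phi>] v by simp
      ultimately show ?thesis by (auto intro: reach_mono add_left_mono simp: add.commute)
    qed
    show "\<exists>d>0. \<forall>u v. u \<le> x \<and> x \<le> v \<and> v - u < d \<longrightarrow> a \<le> u \<and> v \<le> c \<longrightarrow> (\<forall>e>0. ?R u v e)"
    proof (intro exI[of _ \<delta>] conjI allI impI)
      fix u v and e :: real assume "u \<le> x \<and> x \<le> v \<and> v - u < \<delta>" "a \<le> u \<and> v \<le> c" "e > 0"
      then show "?R u v e" by (intro join[of u x e v] left right) auto
    qed (rule \<delta>(1))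
  qed
  then show ?thesis using \<epsilon> by simp
qed

text \<open>A continuous path can be replaced by finitely many short rectifiable connections.\<close>

lemma reach_finite:
  fixes D :: "'a::euclidean_space set"
  assumes D: "open D" and GD: "G \<subseteq> D" and lrc: "locally_rect_connected D G"
    and H: "drift_hamiltonian D b H" and b: "continuous_on D b"
    and cont: "continuous_on {a..c} \<phi>" and im: "\<phi> ` {a..c} \<subseteq> G" and ac: "a \<le> c"
  shows "\<exists>C<top. reach H G a c (\<phi> a) (\<phi> c) C"
proof -
  let ?P = "\<lambda>u v. \<exists>C<top. reach H G u v (\<phi> u) (\<phi> v) C"
  have join: "?P u w" if P: "?P u v" "?P v w" and uvw: "u \<le> v" "v \<le> w" for u v w
  proof -
    obtain C C' where "C < top" "reach H G u v (\<phi> u) (\<phi> v) C" "C' < top" "reach H G v w (\<phi> v) (\<phi> w) C'" using P by blast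
    then show ?thesis using uvw by (intro exI[of _ "C + C'"]) (auto intro: reach_trans)
  qed
  have "a \<le> a \<and> c \<le> c \<longrightarrow> ?P a c"
  proof (rule Bolzano[OF ac, where P = "\<lambda>u v. a \<le> u \<and> v \<le> c \<longrightarrow> ?P u v"])
    fix u v w
    assume 1: "a \<le> u \<and> v \<le> c \<longrightarrow> ?P u v" and 2: "a \<le> v \<and> w \<le> c \<longrightarrow> ?P v w" and uvw: "u \<le> v" "v \<le> w"
    show "a \<le> u \<and> w \<le> c \<longrightarrow> ?P u w"
    proof
      assume "a \<le> u \<and> w \<le> c"
      then have "?P u v" "?P v w" using 1 2 uvw by auto
      then show "?P u w" using uvw by (rule join)
    qed
  next
    fix x assume x: "a \<le> x" "x \<le> c"
    have xG: "\<phi> x \<in> G" using im x by auto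
    obtain r where r: "r > 0" "\<And>w c d. \<lbrakk>w \<in> cball (\<phi> x) r \<inter> G; c < d\<rbrakk> \<Longrightarrow>
        reach H G c d (\<phi> x) w (ennreal 1) \<and> reach H G c d w (\<phi> x) (ennreal 1)"
      by (rule reach_nearby[OF D GD lrc H b xG zero_less_one]) (rule that; assumption)
    obtain \<eta> where \<eta>: "\<eta> > 0" "\<And>t. t \<in> {a..c} \<Longrightarrow> dist t x < \<eta> \<Longrightarrow> dist (\<phi> t) (\<phi> x) < r"
      using cont[unfolded continuous_on_iff, rule_format, of x r] x r(1) by auto
    have near: "\<phi> t \<in> cball (\<phi> x) r \<inter> G" if "t \<in> {a..c}" "\<bar>t - x\<bar> < \<eta>" for t
      using \<eta>(2)[of t] that im by (auto simp: dist_real_def dist_commute less_imp_le)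
    have self: "?P x x" using reach_refl[OF xG, of H x] by (intro exI[of _ 0]) simp
    have left: "?P u x" if "a \<le> u" "u \<le> x" "x - u < \<eta>" for u
      using self r(2)[OF near[of u], of u x] that x by (cases "u = x") (auto intro!: exI[of _ 1])
    have right: "?P x u" if "u \<le> c" "x \<le> u" "u - x < \<eta>" for u
      using self r(2)[OF near[of u], of x u] that x by (cases "u = x") (auto intro!: exI[of _ 1])
    show "\<exists>d>0. \<forall>u v. u \<le> x \<and> x \<le> v \<and> v - u < d \<longrightarrow> a \<le> u \<and> v \<le> c \<longrightarrow> ?P u v"
    proof (intro exI[of _ \<eta>] conjI allI impI)
      fix u v assume uv: "u \<le> x \<and> x \<le> v \<and> v - u < \<eta>" "a \<le> u \<and> v \<le> c"
      then have "?P u x" "?P x v" by (auto intro!: left right)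
      then show "?P u v" by (rule join) (use uv in auto)
    qed (rule \<eta>(1))
  qed
  then show ?thesis by simp
qed

section \<open>Minimizers that end on the limit cycle\<close>

lemma reach_min_value:
  assumes r: "reach H G 0 1 x y C" and xy: "x \<in> A\<^sub>1" "y \<in> A\<^sub>2" and GD: "G \<subseteq> D" and S: "induces D H S"
  shows "min_value D G S A\<^sub>1 A\<^sub>2 \<le> C"
proof -
  obtain \<phi> where \<phi>: "abs_continuous_on {0..1} \<phi>" "\<phi> ` {0..1} \<subseteq> G" "\<phi> 0 \<in> A\<^sub>1" "\<phi> 1 \<in> A\<^sub>2" "action H \<phi> 0 1 \<le> C"
    using r xy by (auto simp: reach_def)
  obtain \<gamma> where \<gamma>: "\<gamma> \<in> weak_curves D" "\<gamma> \<in> curves_from_to (rect_curves D) G A\<^sub>1 A\<^sub>2" "(1, \<phi>) \<in> \<gamma>" "\<phi> \<in> weak_params D"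
    by (rule abs_continuous_path_curve[OF \<phi>(1,2) GD \<phi>(3,4)])
  have "min_value D G S A\<^sub>1 A\<^sub>2 \<le> S \<gamma>" unfolding min_value_def using \<gamma>(2) by (rule INF_lower)
  also have "S \<gamma> = action H \<phi> 0 1" using S \<gamma> by (intro induces_action) auto
  finally show ?thesis using \<phi>(5) by simp
qed

lemma rect_curves_subset_weak_curves: "rect_curves D \<subseteq> weak_curves D"
proof
  fix \<gamma> :: "'a::euclidean_space curve" assume "\<gamma> \<in> rect_curves D"
  then have \<gamma>: "\<gamma> \<in> curves D" "curve_length \<gamma> < top" by (auto simp: rect_curves_def)
  define l where "l = enn2real (curve_length \<gamma>)"
  have l: "curve_length \<gamma> \<le> ennreal l" "0 \<le> l" "l < l + 1" using \<gamma>(2) by (auto simp: l_def)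
  obtain \<omega> where \<omega>: "(1, \<omega>) \<in> \<gamma>" "\<And>x y. \<lbrakk>x \<in> {0..1}; y \<in> {0..1}\<rbrakk> \<Longrightarrow> norm (\<omega> y - \<omega> x) \<le> (l + 1) * \<bar>y - x\<bar>"
    by (rule rectifiable_lipschitz_param[OF \<gamma>(1) l]) (rule that; assumption)
  have "(1, \<omega>) \<in> params D" using \<omega>(1) curve_class_params[OF \<gamma>(1)] by (metis (no_types, lifting) mem_Collect_eq)
  moreover have "abs_continuous_on {0..1} \<omega>" using \<omega>(2) by (rule lipschitz_abs_continuous)
  ultimately have "\<omega> \<in> weak_params D"
    unfolding weak_params_def by (auto intro!: exI[of _ "{}"] exI[of _ "1::real"] abs_continuous_on_subset[of "{0..1}" \<omega>])
  then show "\<gamma> \<in> weak_curves D" using \<gamma>(1) \<omega>(1) by (auto simp: weak_curves_def)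
qed

lemma strong_minimizer_imp_weak: "strong_minimizer D G S A\<^sub>1 A\<^sub>2 \<gamma> \<Longrightarrow> weak_minimizer D G S A\<^sub>1 A\<^sub>2 \<gamma>"
  using rect_curves_subset_weak_curves[of D]
  by (auto simp: strong_minimizer_def weak_minimizer_def curves_from_to_def)

text \<open>The competitor follows the given path almost until it meets the cycle, and then goes around the
  cycle to the given end point.\<close>

lemma no_weak_minimizer:
  fixes D Dt L :: "'a::euclidean_space set"
  assumes D: "open D" and GD: "Dt \<subseteq> D" and lrc: "locally_rect_connected D Dt"
    and S: "S \<in> actions_0_plus D" and drift: "natural_drift D S b" and flow: "flow_of D b \<psi>"
    and LG: "L \<subseteq> interior Dt" and L: "limit_cycle b \<psi> L" and A: "A\<^sub>1 \<subseteq> Dt - L" "A\<^sub>2 \<subseteq> L"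
  shows "\<not> weak_minimizer D Dt S A\<^sub>1 A\<^sub>2 \<gamma>"
proof
  assume min: "weak_minimizer D Dt S A\<^sub>1 A\<^sub>2 \<gamma>"
  obtain H where H: "drift_hamiltonian D b H" and SH: "induces D H S" by (rule natural_drift_hamiltonian[OF D S drift])
  have b: "C1_on D b" using drift by (simp add: natural_drift_def)
  then have bc: "continuous_on D b"
    unfolding C1_on_def by (meson has_derivative_continuous continuous_at_imp_continuous_on)
  have LD: "L \<subseteq> D" using LG GD interior_subset by blast
  obtain T w where T: "T > 0" and w: "solves b w" and per: "\<And>t. w (t + T) = w t"
    and rng: "range w = L" "w ` {0..T} = L" and nz: "\<And>t. b (w t) \<noteq> 0"
    by (rule limit_cycle_orbit[OF D b flow L LD]) (rule that; assumption)
  have cL: "closed L" unfolding rng(2)[symmetric]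
    by (intro compact_imp_closed compact_continuous_image solves_continuous[OF w]) auto
  have neL: "L \<noteq> {}" using rng by auto
  have \<gamma>: "\<gamma> \<in> weak_curves D" "curve_image \<gamma> \<subseteq> Dt" "\<And>T \<phi>. (T, \<phi>) \<in> \<gamma> \<Longrightarrow> \<phi> 0 \<in> A\<^sub>1 \<and> \<phi> T \<in> A\<^sub>2"
    and S\<gamma>: "S \<gamma> = min_value D Dt S A\<^sub>1 A\<^sub>2"
    using min by (auto simp: weak_minimizer_def curves_from_to_def)
  obtain \<phi> where \<phi>: "\<phi> \<in> weak_params D" "(1, \<phi>) \<in> \<gamma>" using \<gamma>(1) by (auto simp: weak_curves_def)
  have cont: "continuous_on {0..1} \<phi>" using \<phi>(1) by (auto simp: weak_params_def params_def)
  obtain F where F: "finite F" "F \<subseteq> {0..1}"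
    "\<And>x. x \<in> {0..1} - F \<Longrightarrow> \<exists>\<delta>>0. abs_continuous_on ({0..1} \<inter> {x - \<delta>..x + \<delta>}) \<phi>"
    using \<phi>(1) by (auto simp: weak_params_def)
  have im: "\<phi> ` {0..1} \<subseteq> Dt" using \<gamma>(2) \<phi>(2) unfolding curve_image_def by fastforce
  have \<phi>0: "\<phi> 0 \<in> A\<^sub>1" "\<phi> 0 \<notin> L" and \<phi>1: "\<phi> 1 \<in> A\<^sub>2" "\<phi> 1 \<in> L" using \<gamma>(3)[OF \<phi>(2)] A by auto
  have act: "action H \<phi> 0 1 = min_value D Dt S A\<^sub>1 A\<^sub>2" using induces_action[OF SH \<gamma>(1) \<phi>] S\<gamma> by simp
  have fin: "action H \<phi> 0 1 < top"
  proof -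
    obtain C where "C < top" "reach H Dt 0 1 (\<phi> 0) (\<phi> 1) C"
      using reach_finite[OF D GD lrc H bc cont im] by auto
    then show ?thesis using reach_min_value[OF _ \<phi>0(1) \<phi>1(1) GD SH, of C] act by (auto intro: le_less_trans)
  qed
  \<comment> \<open>the first time at which the path meets the cycle\<close>
  define Z where "Z = {0..1} \<inter> \<phi> -` L"
  have "closed Z" unfolding Z_def by (rule continuous_closed_preimage[OF cont _ cL]) simp
  then have "compact ({0..1} \<inter> Z)" by (intro compact_Int_closed) auto
  then have "compact Z" by (simp add: Z_def Int_assoc[symmetric])
  moreover have "1 \<in> Z" using \<phi>1 by (simp add: Z_def)
  ultimately obtain e where e: "e \<in> Z" "\<And>t. t \<in> Z \<Longrightarrow> e \<le> t" using compact_attains_inf[of Z] by blast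
  have e01: "0 < e" "e \<le> 1" and eL: "\<phi> e \<in> L" using e(1) \<phi>0 by (auto simp: Z_def less_eq_real_def)
  have before: "\<phi> t \<notin> L" if "0 \<le> t" "t < e" for t using e(2)[of t] that e01 by (auto simp: Z_def)
  define z where "z = \<phi> e"
  have zD: "z \<in> D" using eL LD by (auto simp: z_def)
  obtain v where v: "solves b v" "v 0 = z" "range v = L"
  proof -
    have "z \<in> L" using eL by (simp add: z_def)
    from limit_cycle_connect[OF T w per rng(2) this this] show ?thesis using that rng(1) by metis
  qed
  have bz: "b z \<noteq> 0" using nz eL rng(1) unfolding z_def by (metis imageE)
  obtain \<rho> where \<rho>: "\<rho> > 0" "cball z \<rho> \<subseteq> D" using D zD open_contains_cball by blast
  obtain B where B: "B-lipschitz_on (cball z \<rho>) b" by (rule C1_on_compact_lipschitz[OF b D compact_cball \<rho>(2)])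
  obtain M where M: "M > 0" "\<forall>x\<in>cball z \<rho>. \<forall>\<theta>. norm \<theta> \<le> 1 \<longrightarrow> H x \<theta> \<le> b x \<bullet> \<theta> + M * (norm \<theta>)\<^sup>2"
    using drift_hamiltonianD(3)[OF H compact_cball \<rho>(2)] by blast
  obtain m where m: "m > 0" "\<forall>x\<in>cball z \<rho>. \<forall>\<theta>. b x \<bullet> \<theta> + m * (norm \<theta>)\<^sup>2 \<le> H x \<theta>"
    using drift_hamiltonianD(2)[OF H compact_cball \<rho>(2)] by blast
  obtain \<kappa> a0 where \<kappa>: "\<kappa> > 0" "a0 > 0"
    "\<And>a. \<lbrakk>0 < a; a < a0\<rbrakk> \<Longrightarrow> \<exists>f \<theta> r. 0 < r \<and> r \<le> \<rho> \<and> f z = 0 \<and>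
       (\<forall>x\<in>cball z r. (f has_derivative (\<lambda>y. y \<bullet> \<theta> x)) (at x) \<and> b x \<bullet> \<theta> x + M * (norm (\<theta> x))\<^sup>2 \<le> 0 \<and>
          norm (\<theta> x) \<le> 1 \<and> f x \<le> - (\<kappa> / a) * (infdist x (range v))\<^sup>2)"
    by (rule barrier[OF v(1,2) bz \<rho>(1) B M(1)]) (rule that; assumption)
  obtain C \<rho>' where C: "C > 0" "\<rho>' > 0"
    "\<And>p z c d. \<lbrakk>infdist p L \<le> \<rho>'; z \<in> L; c < d\<rbrakk> \<Longrightarrow> reach H Dt c d p z (ennreal (C * (infdist p L)\<^sup>2))"
    by (rule reach_limit_cycle[OF D b H T w per rng(2,1) LG GD]; (assumption | (rule that; assumption)))
  \<comment> \<open>at this scale the barrier forces a cost that exceeds the one of going around the cycle\<close>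
  define a where "a = min (a0 / 2) (\<kappa> / (2 * C))"
  have a: "0 < a" "a < a0" "C < \<kappa> / a"
  proof -
    show "0 < a" "a < a0" using \<kappa> C by (auto simp: a_def)
    have "C * a \<le> C * (\<kappa> / (2 * C))" using C by (intro mult_left_mono) (auto simp: a_def)
    also have "\<dots> < \<kappa>" using C \<kappa> by simp
    finally show "C < \<kappa> / a" using \<open>0 < a\<close> by (simp add: field_simps)
  qed
  obtain f \<theta> r where r: "0 < r" "r \<le> \<rho>" and fz: "f z = 0"
    and f_all: "\<forall>x\<in>cball z r. (f has_derivative (\<lambda>y. y \<bullet> \<theta> x)) (at x) \<and> b x \<bullet> \<theta> x + M * (norm (\<theta> x))\<^sup>2 \<le> 0 \<and>
          norm (\<theta> x) \<le> 1 \<and> f x \<le> - (\<kappa> / a) * (infdist x L)\<^sup>2"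
    using \<kappa>(3)[OF a(1,2)] unfolding v(3) by (elim exE conjE) (rule that)
  have f: "(f has_derivative (\<lambda>y. y \<bullet> \<theta> x)) (at x)" "b x \<bullet> \<theta> x + M * (norm (\<theta> x))\<^sup>2 \<le> 0"
    "norm (\<theta> x) \<le> 1" "f x \<le> - (\<kappa> / a) * (infdist x L)\<^sup>2" if "x \<in> cball z r" for x
    using bspec[OF f_all that] by simp_all
  obtain \<eta> where \<eta>: "\<eta> > 0" "\<And>t. t \<in> {0..1} \<Longrightarrow> dist t e < \<eta> \<Longrightarrow> dist (\<phi> t) (\<phi> e) < min r \<rho>'"
    using cont[unfolded continuous_on_iff, rule_format, of e "min r \<rho>'"] e01 r C by auto
  \<comment> \<open>the time \<open>s\<close> is so close to \<open>e\<close> that between them the path stays near \<open>z\<close> and has no exceptional times\<close>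
  define g where "g = Max (insert 0 (F \<inter> {..<e}))"
  have g: "0 \<le> g" "g < e" "\<And>x. \<lbrakk>x \<in> F; x < e\<rbrakk> \<Longrightarrow> x \<le> g"
  proof -
    have fi: "finite (insert 0 (F \<inter> {..<e}))" using F by auto
    show "0 \<le> g" "\<And>x. \<lbrakk>x \<in> F; x < e\<rbrakk> \<Longrightarrow> x \<le> g" unfolding g_def using fi by (auto intro: Max_ge)
    have "g \<in> insert 0 (F \<inter> {..<e})" unfolding g_def using fi by (intro Max_in) auto
    then show "g < e" using e01 by auto
  qed
  define s where "s = max ((g + e) / 2) (e - \<eta> / 2)"
  have s: "g < s" "s < e" "e - s < \<eta>" "0 < s" "s < 1" using g \<eta>(1) e01 by (auto simp: s_def less_max_iff_disj)
  have near: "dist (\<phi> t) z < min r \<rho>'" if "t \<in> {s..e}" for t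
    using \<eta>(2)[of t] that s e01 by (auto simp: z_def dist_real_def)
  define \<delta> where "\<delta> = infdist (\<phi> s) L"
  have \<delta>: "\<delta> > 0" "\<delta> \<le> \<rho>'"
  proof -
    have "\<phi> s \<notin> L" using before s by auto
    then show "\<delta> > 0" unfolding \<delta>_def using in_closed_iff_infdist_zero[OF cL neL, of "\<phi> s"] infdist_nonneg[of "\<phi> s" L] by linarith
    have "\<delta> \<le> dist (\<phi> s) z" unfolding \<delta>_def using eL by (intro infdist_le) (simp add: z_def)
    then show "\<delta> \<le> \<rho>'" using near[of s] s by auto
  qed
  have lower: "ennreal (\<kappa> / a * \<delta>\<^sup>2) \<le> action H \<phi> s e"
  proof -
    have "ennreal (\<kappa> / a * \<delta>\<^sup>2) \<le> ennreal (f (\<phi> e) - f (\<phi> s))"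
      using f(4)[of "\<phi> s"] near[of s] s fz by (intro ennreal_leI) (auto simp: \<delta>_def z_def dist_commute)
    also have "\<dots> \<le> action H \<phi> s e"
    proof (rule action_ge_potential[of z r f \<theta>])
      show "y \<bullet> \<theta> x \<le> local_action H x y" if x: "x \<in> cball z r" for x y
      proof -
        have x': "x \<in> cball z \<rho>" using x r by auto
        have "H x (\<theta> x) \<le> 0" using M(2) x' f(2,3)[OF x] by force
        then show ?thesis using m x' by (intro local_action_lower[of 0 "b x" m]) auto
      qed
      show "continuous_on {s..e} \<phi>" using s e01 by (intro continuous_on_subset[OF cont]) auto
      show "abs_continuous_on {s..c} \<phi>" if h: "s \<le> c" "c < e" for c
      proof (rule abs_continuous_local[OF h(1)])
        fix x assume x: "x \<in> {s..c}"
        have "x \<notin> F" using g(3)[of x] x h s by auto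
        then have "x \<in> {0..1} - F" using x h s e01 by auto
        from F(3)[OF this] obtain d where "d > 0" "abs_continuous_on ({0..1} \<inter> {x - d..x + d}) \<phi>" by blast
        moreover from this(2) have "abs_continuous_on ({s..c} \<inter> {x - d..x + d}) \<phi>"
          by (rule abs_continuous_on_subset) (use h s e01 in auto)
        ultimately show "\<exists>d>0. abs_continuous_on ({s..c} \<inter> {x - d..x + d}) \<phi>" by blast
      qed
      show "\<phi> ` {s..e} \<subseteq> cball z r"
      proof (rule image_subsetI)
        fix t assume "t \<in> {s..e}"
        then show "\<phi> t \<in> cball z r" using near[of t] by (simp add: dist_commute)
      qed
    qed (use f s in auto)
    finally show ?thesis .
  qed
  have upper: "action H \<phi> s e \<le> ennreal (C * \<delta>\<^sup>2) + ennreal \<epsilon>" if \<epsilon>: "\<epsilon> > 0" for \<epsilon>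
  proof -
    have "reach H Dt 0 s (\<phi> 0) (\<phi> s) (action H \<phi> 0 s + ennreal \<epsilon>)"
    proof (rule reach_approx[OF D GD lrc H bc _ _ _ F(1) _ \<epsilon>])
      show "continuous_on {0..s} \<phi>" using s by (intro continuous_on_subset[OF cont]) auto
      show "\<phi> ` {0..s} \<subseteq> Dt" using im s by force
      fix x assume x: "x \<in> {0..s} - F"
      then have "x \<in> {0..1} - F" using s by auto
      from F(3)[OF this] obtain d where "d > 0" "abs_continuous_on ({0..1} \<inter> {x - d..x + d}) \<phi>" by blast
      moreover from this(2) have "abs_continuous_on ({0..s} \<inter> {x - d..x + d}) \<phi>"
        by (rule abs_continuous_on_subset) (use s in auto)
      ultimately show "\<exists>d>0. abs_continuous_on ({0..s} \<inter> {x - d..x + d}) \<phi>" by blast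
    qed (use s in auto)
    moreover have "reach H Dt s 1 (\<phi> s) (\<phi> 1) (ennreal (C * \<delta>\<^sup>2))"
      unfolding \<delta>_def using \<delta> \<phi>1 s by (intro C(3)) (auto simp: \<delta>_def)
    ultimately have "reach H Dt 0 1 (\<phi> 0) (\<phi> 1) (action H \<phi> 0 s + ennreal \<epsilon> + ennreal (C * \<delta>\<^sup>2))"
      by (rule reach_trans) (use s in auto)
    from reach_min_value[OF this \<phi>0(1) \<phi>1(1) GD SH]
    have up: "action H \<phi> 0 1 \<le> action H \<phi> 0 s + (ennreal (C * \<delta>\<^sup>2) + ennreal \<epsilon>)" by (simp add: act ac_simps)
    have "action H \<phi> 0 e \<le> action H \<phi> 0 1" using action_combine[of 0 e 1 H \<phi>] e01 by simp
    then have dn: "action H \<phi> 0 s + action H \<phi> s e \<le> action H \<phi> 0 1" using action_combine[of 0 s e H \<phi>] s by simp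
    then have "action H \<phi> 0 s < top" using fin by (meson le_less_trans le_iff_add order_trans)
    then show ?thesis using order_trans[OF dn up] by (auto simp: ennreal_add_left_cancel_le)
  qed
  have "ennreal (\<kappa> / a * \<delta>\<^sup>2) \<le> ennreal (C * \<delta>\<^sup>2)"
    by (rule ennreal_le_epsilon) (use order_trans[OF lower upper] in auto)
  then have "\<kappa> / a * \<delta>\<^sup>2 \<le> C * \<delta>\<^sup>2" using C by simp
  moreover have "C * \<delta>\<^sup>2 < \<kappa> / a * \<delta>\<^sup>2" using a \<delta> by (intro mult_strict_right_mono) auto
  ultimately show False by simp
qed

theorem proposition5:
  fixes D Dt L :: "'a::euclidean_space set"
    and S :: "'a curve \<Rightarrow> ennreal"
    and b :: "'a \<Rightarrow> 'a"
    and \<psi> :: "'a \<Rightarrow> real \<Rightarrow> 'a"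
  assumes "open D" and "connected D"
    and "Dt \<subseteq> D" and "connected Dt" and "closedin (top_of_set D) Dt"
    and "locally_rect_connected D Dt"
    and "S \<in> actions_0_plus D"
    and "natural_drift D S b"
    and "flow_of D b \<psi>"
    and "L \<subseteq> interior Dt"
    and "limit_cycle b \<psi> L"
  shows "(\<forall>A\<^sub>1 A\<^sub>2. A\<^sub>1 \<subseteq> Dt - L \<and> A\<^sub>2 \<subseteq> L \<longrightarrow>
            (\<nexists>\<gamma>. weak_minimizer D Dt S A\<^sub>1 A\<^sub>2 \<gamma>) \<and> (\<nexists>\<gamma>. strong_minimizer D Dt S A\<^sub>1 A\<^sub>2 \<gamma>)) \<and>
         (\<forall>x\<in>L. \<not> has_weak_local_minimizers D Dt S x \<and> \<not> has_strong_local_minimizers D Dt S x)"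
proof -
  have weak: "\<not> weak_minimizer D Dt S A\<^sub>1 A\<^sub>2 \<gamma>" if "A\<^sub>1 \<subseteq> Dt - L" "A\<^sub>2 \<subseteq> L" for A\<^sub>1 A\<^sub>2 \<gamma>
    using no_weak_minimizer[OF assms(1,3,6-11) that] .
  have strong: "\<not> strong_minimizer D Dt S A\<^sub>1 A\<^sub>2 \<gamma>" if "A\<^sub>1 \<subseteq> Dt - L" "A\<^sub>2 \<subseteq> L" for A\<^sub>1 A\<^sub>2 \<gamma>
    using strong_minimizer_imp_weak weak[OF that] by blast
  \<comment> \<open>arbitrarily close to a point of the cycle there are points of \<open>Dt\<close> off the cycle\<close>
  have off: "\<exists>x\<^sub>1\<in>cball x r \<inter> Dt. x\<^sub>1 \<notin> L" if x: "x \<in> L" and r: "r > 0" for x r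
  proof -
    have LD: "L \<subseteq> D" using assms(3,10) interior_subset by blast
    have b: "C1_on D b" using assms(8) by (simp add: natural_drift_def)
    obtain T w where w: "T > 0" "solves b w" "range w = L" "w ` {0..T} = L" "\<And>t. b (w t) \<noteq> 0"
      by (rule limit_cycle_orbit[OF assms(1) b assms(9,11) LD]) (rule that; assumption)
    obtain r' where r': "r' > 0" "ball x r' \<subseteq> interior Dt" 
      using subsetD[OF assms(10) x] open_contains_ball[of "interior Dt"] by auto
    have "\<not> ball x (min r r') \<subseteq> L"
      using limit_cycle_empty_interior[OF w(1,2) _ w(5), of "min r r'" x] w(3,4) r r' by simp
    then obtain x\<^sub>1 where "x\<^sub>1 \<in> ball x (min r r')" "x\<^sub>1 \<notin> L" by blast
    then show ?thesis using r'(2) interior_subset[of Dt] by (intro bexI[of _ x\<^sub>1]) auto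
  qed
  have self: "x \<in> cball x r \<inter> Dt" if "x \<in> L" "r > 0" for x r
    using that assms(10) interior_subset by auto
  have "\<not> has_weak_local_minimizers D Dt S x" if x: "x \<in> L" for x
  proof
    assume "has_weak_local_minimizers D Dt S x"
    then obtain r where r: "r > 0"
      "\<And>x\<^sub>1 x\<^sub>2. \<lbrakk>x\<^sub>1 \<in> cball x r \<inter> Dt; x\<^sub>2 \<in> cball x r \<inter> Dt\<rbrakk> \<Longrightarrow> \<exists>\<gamma>. weak_minimizer D Dt S {x\<^sub>1} {x\<^sub>2} \<gamma>"
      unfolding has_weak_local_minimizers_def by meson
    obtain x\<^sub>1 where "x\<^sub>1 \<in> cball x r \<inter> Dt" "x\<^sub>1 \<notin> L" using off[OF x r(1)] by blast
    then show False using r(2)[OF _ self[OF x r(1)], of x\<^sub>1] weak[of "{x\<^sub>1}" "{x}"] x by auto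
  qed
  moreover have "\<not> has_strong_local_minimizers D Dt S x" if x: "x \<in> L" for x
  proof
    assume "has_strong_local_minimizers D Dt S x"
    then obtain r where r: "r > 0"
      "\<And>x\<^sub>1 x\<^sub>2. \<lbrakk>x\<^sub>1 \<in> cball x r \<inter> Dt; x\<^sub>2 \<in> cball x r \<inter> Dt\<rbrakk> \<Longrightarrow> \<exists>\<gamma>. strong_minimizer D Dt S {x\<^sub>1} {x\<^sub>2} \<gamma>"
      unfolding has_strong_local_minimizers_def by meson
    obtain x\<^sub>1 where "x\<^sub>1 \<in> cball x r \<inter> Dt" "x\<^sub>1 \<notin> L" using off[OF x r(1)] by blast
    then show False using r(2)[OF _ self[OF x r(1)], of x\<^sub>1] strong[of "{x\<^sub>1}" "{x}"] x by auto
  qed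
  ultimately show ?thesis using weak strong by blast
qed

end
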